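(* Let $F=T^\varphi:Y\to Y$ be a good inducing scheme, and let $\mathcal{B}(X)$ be the collection of exchangeable observables. (i) Suppose in addition that $\mathcal{B}(Y)$ is embedded in $L^\infty(Y)$. Let $a=a(k)\in(0,\infty)$ be such that $\lim_{k\to\infty}a^rS_r(k,a)=0$ for some $r\in(0,1]$. Let $q\in(0,1]$. Then there exist $C>0$ and $k_0\ge1$ such that $$|\rho_{v,w}(n)|\le C|v|_\infty|w|_\infty\Bigl(\sum_{j>k}\mu(\varphi>j)+n\mu(\varphi>k)\Bigr)+C\|v\|\,|w|_\infty\,S_q(k,a)e^{-na}$$ for all $v\in\mathcal{B}(X)$, $w\in L^\infty(X)$, $n\ge k\ge k_0$. (ii) In the general case of good inducing schemes (no embedding of $\mathcal{B}(Y)$ in $L^\infty(Y)$ assumed), the same result holds but with $S_q(k,a)$ replaced by $k^2e^{2ka}$: if $a=a(k)\in(0,\infty)$ satisfies $\lim_{k\to\infty}a^rS_r(k,a)=0$ for some $r\in(0,1]$, then there exist $C>0$ and $k_0\ge1$ such that $$|\rho_{v,w}(n)|\le C|v|_\infty|w|_\infty\Bigl(\sum_{j>k}\mu(\varphi>j)+n\mu(\varphi>k)\Bigr)+C\|v\|\,|w|_\infty\,k^2e^{2ka}e^{-na}$$ for all $v\in\mathcal{B}(X)$, $w\in L^\infty(X)$, $n\ge k\ge k_0$.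
   Context: Setting. $T:X\to X$ is a measurable transformation, $Y\subset X$ is measurable, $\varphi:Y\to\mathbb{Z}^+$ is a measurable return time (not necessarily the first return) with $F(y)=T^{\varphi(y)}(y)\in Y$ for $y\in Y$, and $\mu$ is an ergodic $F$-invariant probability measure on $Y$. It is assumed that $\varphi\in L^1(Y)=L^1(Y,\mu)$; put $\bar\varphi=\int_Y\varphi\,d\mu$. The tower is $\Delta=\{(y,\ell)\in Y\times\mathbb{Z}:0\le\ell\le\varphi(y)-1\}$ with map $f(y,\ell)=(y,\ell+1)$ for $\ell\le\varphi(y)-2$ and $f(y,\varphi(y)-1)=(Fy,0)$, and $f$-invariant probability measure $\mu_\Delta=(\mu\times\text{counting})/\bar\varphi$. The map $\pi:\Delta\to X$, $\pi(y,\ell)=T^\ell y$, is a semiconjugacy and $\mu_X=\pi_*\mu_\Delta$ is a $T$-invariant probability measure; $L^1(X)=L^1(X,\mu_X)$, and $L^\infty(X)=L^\infty(X,\mu_X)$ with norm $|\cdot|_\infty$. The correlation function is $\rho_{v,w}(n)=\int_X v\,w\circ T^n\,d\mu_X-\int_X v\,d\mu_X\int_X w\,d\mu_X$. Write $\mu(\varphi>j)=\mu(\{y\in Y:\varphi(y)>j\})$. Good inducing scheme. $R:L^1(Y)\to L^1(Y)$ is the transfer operator of $F$: $\int_Y Rv\,w\,d\mu=\int_Y v\,w\circ F\,d\mu$ for $v\in L^1(Y)$, $w\in L^\infty(Y)$; $R_nv=R(1_{\{\varphi=n\}}v)$, $n\ge1$. $\mathcal{B}(Y)\subset L^1(Y)$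 is a Banach space (complexified when needed) with norm $\|\cdot\|$ such that $|v|_1\le\|v\|$ and constant functions lie in $\mathcal{B}(Y)$. The scheme is good if the $R_n$ are bounded operators on $\mathcal{B}(Y)$ with $\sum_{n=1}^\infty\sum_{j>n}\|R_j\|<\infty$, and, with $R(z)=\sum_{n=1}^\infty R_nz^n$ for $|z|\le1$ (operators on $\mathcal{B}(Y)$): (i) $1$ is a simple eigenvalue, isolated in the spectrum of $R(1)$; (ii) for $|z|\le1$, $z\neq1$, the spectrum of $R(z)$ does not contain $1$. Exchangeable observables. $\mathcal{B}(X)\subset L^1(X)$ consists of observables $v:X\to\mathbb{R}$. For $v:X\to\mathbb{R}$, a function $\hat v:Y\to\mathbb{R}$ is derived from $v$ if for every $n\ge1$ there exists $j\in\{0,1,\dots,n-1\}$ such that $\hat v(y)=v(T^jy)$ for all $y\in Y$ with $\varphi(y)=n$. Let $\mathcal{D}_v$ be the set of observables derived from $v$. $v$ is exchangeable if $\mathcal{D}_v$ is a bounded subset of $\mathcal{B}(Y)$, and then $\|v\|=\sup_{\hat v\in\mathcal{D}_v}\|\hat v\|$. Notation. For $k\ge1$ and $a,q\in[0,\infty)$, $S_q(k,a)=\sum_{j=1}^k\bigl(\sum_{\ell>j}\|R_\ell\|\bigr)j^qe^{ja}$.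
   Formalization: The formal theorem assumes in addition that μ(φ>1)>0; if φ=1 almost everywhere, the tails and S_q(k,a) all vanish and the stated bounds fail, e.g. for the doubling map with Lipschitz observables. *)

theory Defs
  imports "HOL-Probability.Probability" "HOL-Probability.Essential_Supremum"
begin

section \<open>Essentially bounded functions\<close>

definition Linf_norm :: "'a measure \<Rightarrow> ('a \<Rightarrow> real) \<Rightarrow> ennreal" where
  "Linf_norm M f = esssup M (\<lambda>x. ennreal \<bar>f x\<bar>)"

definition Linf :: "'a measure \<Rightarrow> ('a \<Rightarrow> real) set" where
  "Linf M = {f \<in> borel_measurable M. Linf_norm M f < \<infinity>}"


section \<open>Inducing schemes and the projected tower measure\<close>

definition return_map :: "('a \<Rightarrow> 'a) \<Rightarrow> ('a \<Rightarrow> nat) \<Rightarrow> 'a \<Rightarrow> 'a" where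
  "return_map T \<phi> y = (T ^^ \<phi> y) y"

definition ergodic_invariant :: "'a measure \<Rightarrow> ('a \<Rightarrow> 'a) \<Rightarrow> bool" where
  "ergodic_invariant \<mu> F \<longleftrightarrow>
     F \<in> measurable \<mu> \<mu> \<and> distr \<mu> \<mu> F = \<mu> \<and>
     (\<forall>A\<in>sets \<mu>. F -` A \<inter> space \<mu> = A \<longrightarrow> measure \<mu> A = 0 \<or> measure \<mu> A = 1)"

text \<open>The underlying measurable space \<open>X\<close> is \<open>space M\<close> with the sigma-algebra \<open>sets M\<close>; the
  measure component of \<open>M\<close> plays no role. The set \<open>Y\<close> is \<open>space \<mu>\<close>.\<close>

locale inducing_scheme =
  fixes M :: "'a measure" and T :: "'a \<Rightarrow> 'a" and Y :: "'a set"
    and \<phi> :: "'a \<Rightarrow> nat" and \<mu> :: "'a measure"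
  assumes T_measurable: "T \<in> measurable M M"
    and Y_measurable: "Y \<in> sets M"
    and space_\<mu>: "space \<mu> = Y"
    and sets_\<mu>: "sets \<mu> = sets (restrict_space M Y)"
    and prob_\<mu>: "prob_space \<mu>"
    and \<phi>_measurable: "\<phi> \<in> measurable \<mu> (count_space UNIV)"
    and \<phi>_pos: "\<And>y. y \<in> Y \<Longrightarrow> 1 \<le> \<phi> y"
    and F_into: "\<And>y. y \<in> Y \<Longrightarrow> return_map T \<phi> y \<in> Y"
    and F_ergodic: "ergodic_invariant \<mu> (return_map T \<phi>)"
    and \<phi>_integrable: "integrable \<mu> (\<lambda>y. real (\<phi> y))"

text \<open>The tower \<open>{(y, l). 0 \<le> l \<le> \<phi> y - 1}\<close> is indexed by naturals instead of integers. Only its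
  measure and its projection to \<open>X\<close> occur below, so the tower map is not needed.\<close>

definition tower_measure :: "('a \<Rightarrow> nat) \<Rightarrow> 'a measure \<Rightarrow> ('a \<times> nat) measure" where
  "tower_measure \<phi> \<mu> =
     scale_measure (ennreal (1 / (\<integral>y. real (\<phi> y) \<partial>\<mu>)))
       (restrict_space (\<mu> \<Otimes>\<^sub>M count_space UNIV) {(y, l). y \<in> space \<mu> \<and> l < \<phi> y})"

definition mu_X :: "'a measure \<Rightarrow> ('a \<Rightarrow> 'a) \<Rightarrow> ('a \<Rightarrow> nat) \<Rightarrow> 'a measure \<Rightarrow> 'a measure" where
  "mu_X M T \<phi> \<mu> = distr (tower_measure \<phi> \<mu>) M (\<lambda>(y, l). (T ^^ l) y)"

definition corr :: "'a measure \<Rightarrow> ('a \<Rightarrow> 'a) \<Rightarrow> ('a \<Rightarrow> real) \<Rightarrow> ('a \<Rightarrow> real) \<Rightarrow> nat \<Rightarrow> real" where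
  "corr N T v w n = (\<integral>x. v x * w ((T ^^ n) x) \<partial>N) - (\<integral>x. v x \<partial>N) * (\<integral>x. w x \<partial>N)"


section \<open>Transfer operators\<close>

text \<open>Operators on \<open>L\<^sup>1\<close> act on representatives, so they are determined only up to null sets.\<close>

definition transfer_operator ::
    "'a measure \<Rightarrow> ('a \<Rightarrow> 'a) \<Rightarrow> (('a \<Rightarrow> real) \<Rightarrow> 'a \<Rightarrow> real) \<Rightarrow> bool" where
  "transfer_operator \<mu> F R \<longleftrightarrow>
     (\<forall>v. integrable \<mu> v \<longrightarrow> integrable \<mu> (R v) \<and>
       (\<forall>w\<in>Linf \<mu>. (\<integral>y. R v y * w y \<partial>\<mu>) = (\<integral>y. v y * w (F y) \<partial>\<mu>)))"

definition R_part ::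
    "(('a \<Rightarrow> real) \<Rightarrow> 'a \<Rightarrow> real) \<Rightarrow> ('a \<Rightarrow> nat) \<Rightarrow> nat \<Rightarrow> ('a \<Rightarrow> real) \<Rightarrow> 'a \<Rightarrow> real" where
  "R_part R \<phi> n v = R (\<lambda>y. indicator {y. \<phi> y = n} y * v y)"


section \<open>Complexification and spectrum\<close>

text \<open>The complexification of a real Banach space \<open>'b\<close> is \<open>'b \<times> 'b\<close>, where \<open>(u, v)\<close> stands for
  \<open>u + i v\<close>. The product norm is equivalent to any norm making it a complex Banach space; only
  its topology enters below.\<close>

lift_definition cscale :: "complex \<Rightarrow> ('b::real_normed_vector \<times> 'b) \<Rightarrow>\<^sub>L ('b \<times> 'b)" is
  "\<lambda>z w. (Re z *\<^sub>R fst w - Im z *\<^sub>R snd w, Re z *\<^sub>R snd w + Im z *\<^sub>R fst w)"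
  by (intro bounded_linear_intros bounded_linear_Pair)

lift_definition complexify ::
    "('b::real_normed_vector \<Rightarrow>\<^sub>L 'b) \<Rightarrow> ('b \<times> 'b) \<Rightarrow>\<^sub>L ('b \<times> 'b)" is
  "\<lambda>A w. (A (fst w), A (snd w))"
  by (intro bounded_linear_Pair)
     (auto intro: bounded_linear_compose bounded_linear_fst bounded_linear_snd)

definition spectrum :: "(('b::real_normed_vector \<times> 'b) \<Rightarrow>\<^sub>L ('b \<times> 'b)) \<Rightarrow> complex set" where
  "spectrum A = {\<zeta>. \<not> (\<exists>S. S o\<^sub>L (cscale \<zeta> - A) = id_blinfun \<and> (cscale \<zeta> - A) o\<^sub>L S = id_blinfun)}"

text \<open>Simple means of algebraic multiplicity one: the kernel of \<open>\<zeta> - A\<close> is a complex line and is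
  complementary to the range of \<open>\<zeta> - A\<close>. For a point isolated in the spectrum this says that the
  spectral projection has rank one.\<close>

definition simple_eigenvalue ::
    "(('b::real_normed_vector \<times> 'b) \<Rightarrow>\<^sub>L ('b \<times> 'b)) \<Rightarrow> complex \<Rightarrow> bool" where
  "simple_eigenvalue A \<zeta> \<longleftrightarrow>
     (let K = {x. blinfun_apply (cscale \<zeta> - A) x = 0}; V = range (blinfun_apply (cscale \<zeta> - A)) in
       (\<exists>e. e \<noteq> 0 \<and> K = {blinfun_apply (cscale c) e | c. True}) \<and>
       K \<inter> V = {0} \<and> {x + y | x y. x \<in> K \<and> y \<in> V} = UNIV)"

definition isolated_in_spectrum ::
    "(('b::real_normed_vector \<times> 'b) \<Rightarrow>\<^sub>L ('b \<times> 'b)) \<Rightarrow> complex \<Rightarrow> bool" where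
  "isolated_in_spectrum A \<zeta> \<longleftrightarrow>
     \<zeta> \<in> spectrum A \<and> (\<exists>\<epsilon>>0. \<forall>\<eta>\<in>spectrum A. \<eta> \<noteq> \<zeta> \<longrightarrow> \<epsilon> \<le> dist \<eta> \<zeta>)"

definition R_series ::
    "(nat \<Rightarrow> 'b::banach \<Rightarrow>\<^sub>L 'b) \<Rightarrow> complex \<Rightarrow> ('b \<times> 'b) \<Rightarrow>\<^sub>L ('b \<times> 'b)" where
  "R_series Rn z = (\<Sum>\<^sub>\<infinity>n\<in>{1..}. cscale (z ^ n) o\<^sub>L complexify (Rn n))"


section \<open>Good inducing schemes\<close>

text \<open>The Banach space \<open>\<B>(Y) \<subseteq> L\<^sup>1(Y)\<close> is a type \<open>'b\<close> of class \<open>banach\<close> together with the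
  inclusion \<open>emb\<close>, which sends an element of \<open>'b\<close> to a representative of its class in \<open>L\<^sup>1(Y)\<close>.\<close>

locale L1_banach_subspace =
  fixes \<mu> :: "'a measure" and emb :: "'b::banach \<Rightarrow> 'a \<Rightarrow> real"
  assumes emb_integrable: "\<And>b. integrable \<mu> (emb b)"
    and emb_add: "\<And>b c. AE y in \<mu>. emb (b + c) y = emb b y + emb c y"
    and emb_scale: "\<And>s b. AE y in \<mu>. emb (s *\<^sub>R b) y = s * emb b y"
    and emb_inj: "\<And>b. (AE y in \<mu>. emb b y = 0) \<Longrightarrow> b = 0"
    and emb_L1: "\<And>b. (\<integral>y. \<bar>emb b y\<bar> \<partial>\<mu>) \<le> norm b"
    and emb_const: "\<And>s. \<exists>b. AE y in \<mu>. emb b y = s"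

text \<open>\<open>R\<close> is the transfer operator on \<open>L\<^sup>1(Y)\<close>, and \<open>Rn n\<close>, for \<open>n \<ge> 1\<close>, is the bounded operator
  that \<open>v \<mapsto> R (1\<^bsub>{\<phi> = n}\<^esub> v)\<close> induces on \<open>\<B>(Y)\<close>. The value \<open>Rn 0\<close> is irrelevant.\<close>

locale good_inducing_scheme =
  inducing_scheme M T Y \<phi> \<mu> + L1_banach_subspace \<mu> emb
  for M :: "'a measure" and T :: "'a \<Rightarrow> 'a" and Y :: "'a set"
    and \<phi> :: "'a \<Rightarrow> nat" and \<mu> :: "'a measure" and emb :: "'b::banach \<Rightarrow> 'a \<Rightarrow> real" +
  fixes R :: "('a \<Rightarrow> real) \<Rightarrow> 'a \<Rightarrow> real" and Rn :: "nat \<Rightarrow> 'b \<Rightarrow>\<^sub>L 'b"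
  assumes R_transfer: "transfer_operator \<mu> (return_map T \<phi>) R"
    and Rn_bounded: "\<And>n b. 1 \<le> n \<Longrightarrow>
          AE y in \<mu>. emb (blinfun_apply (Rn n) b) y = R_part R \<phi> n (emb b) y"
    and Rn_tail_summable: "\<And>n. 1 \<le> n \<Longrightarrow> (\<lambda>j. norm (Rn j)) summable_on {n<..}"
    and Rn_summable: "(\<lambda>n. \<Sum>\<^sub>\<infinity>j\<in>{n<..}. norm (Rn j)) summable_on {1..}"
    and R1_simple: "simple_eigenvalue (R_series Rn 1) 1"
    and R1_isolated: "isolated_in_spectrum (R_series Rn 1) 1"
    and Rz_spectrum: "\<And>z. norm z \<le> 1 \<Longrightarrow> z \<noteq> 1 \<Longrightarrow> 1 \<notin> spectrum (R_series Rn z)"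

definition embedded_in_Linf :: "'a measure \<Rightarrow> ('b::banach \<Rightarrow> 'a \<Rightarrow> real) \<Rightarrow> bool" where
  "embedded_in_Linf \<mu> emb \<longleftrightarrow> (\<exists>K\<ge>0. \<forall>b. Linf_norm \<mu> (emb b) \<le> ennreal (K * norm b))"

definition S_sum :: "(nat \<Rightarrow> 'b::real_normed_vector \<Rightarrow>\<^sub>L 'b) \<Rightarrow> real \<Rightarrow> nat \<Rightarrow> real \<Rightarrow> real" where
  "S_sum Rn q k a =
     (\<Sum>j=1..k. (\<Sum>\<^sub>\<infinity>l\<in>{j<..}. norm (Rn l)) * real j powr q * exp (real j * a))"


section \<open>Exchangeable observables\<close>

definition derived_from ::
    "('a \<Rightarrow> 'a) \<Rightarrow> 'a set \<Rightarrow> ('a \<Rightarrow> nat) \<Rightarrow> ('a \<Rightarrow> real) \<Rightarrow> ('a \<Rightarrow> real) \<Rightarrow> bool" where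
  "derived_from T Y \<phi> v vh \<longleftrightarrow>
     (\<forall>n\<ge>1. \<exists>j\<in>{0..n-1}. \<forall>y\<in>Y. \<phi> y = n \<longrightarrow> vh y = v ((T ^^ j) y))"

text \<open>The elements of \<open>\<B>(Y)\<close> that are classes of functions derived from \<open>v\<close>.\<close>

definition derived_set ::
    "('a \<Rightarrow> 'a) \<Rightarrow> 'a set \<Rightarrow> ('a \<Rightarrow> nat) \<Rightarrow> 'a measure \<Rightarrow> ('b::banach \<Rightarrow> 'a \<Rightarrow> real) \<Rightarrow>
      ('a \<Rightarrow> real) \<Rightarrow> 'b set" where
  "derived_set T Y \<phi> \<mu> emb v = {b. \<exists>vh. derived_from T Y \<phi> v vh \<and> (AE y in \<mu>. emb b y = vh y)}"

definition exchangeable ::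
    "('a \<Rightarrow> 'a) \<Rightarrow> 'a set \<Rightarrow> ('a \<Rightarrow> nat) \<Rightarrow> 'a measure \<Rightarrow> ('b::banach \<Rightarrow> 'a \<Rightarrow> real) \<Rightarrow>
      ('a \<Rightarrow> real) \<Rightarrow> bool" where
  "exchangeable T Y \<phi> \<mu> emb v \<longleftrightarrow>
     (\<forall>vh. derived_from T Y \<phi> v vh \<longrightarrow> (\<exists>b. AE y in \<mu>. emb b y = vh y)) \<and>
     bounded (derived_set T Y \<phi> \<mu> emb v)"

definition exch_norm ::
    "('a \<Rightarrow> 'a) \<Rightarrow> 'a set \<Rightarrow> ('a \<Rightarrow> nat) \<Rightarrow> 'a measure \<Rightarrow> ('b::banach \<Rightarrow> 'a \<Rightarrow> real) \<Rightarrow>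
      ('a \<Rightarrow> real) \<Rightarrow> real" where
  "exch_norm T Y \<phi> \<mu> emb v = (SUP b\<in>derived_set T Y \<phi> \<mu> emb v. norm b)"

definition B_X ::
    "'a measure \<Rightarrow> ('a \<Rightarrow> 'a) \<Rightarrow> 'a set \<Rightarrow> ('a \<Rightarrow> nat) \<Rightarrow> 'a measure \<Rightarrow>
      ('b::banach \<Rightarrow> 'a \<Rightarrow> real) \<Rightarrow> ('a \<Rightarrow> real) set" where
  "B_X M T Y \<phi> \<mu> emb = {v. integrable (mu_X M T \<phi> \<mu>) v \<and> exchangeable T Y \<phi> \<mu> emb v}"


section \<open>The correlation bound\<close>

definition tail_error :: "('a \<Rightarrow> nat) \<Rightarrow> 'a measure \<Rightarrow> nat \<Rightarrow> nat \<Rightarrow> real" where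
  "tail_error \<phi> \<mu> n k =
     (\<Sum>\<^sub>\<infinity>j\<in>{k<..}. measure \<mu> {y \<in> space \<mu>. j < \<phi> y}) +
     real n * measure \<mu> {y \<in> space \<mu>. k < \<phi> y}"

text \<open>The bound is stated in \<open>ennreal\<close>, since an exchangeable \<open>v\<close> need not be essentially bounded
  when \<open>\<B>(Y)\<close> is not embedded in \<open>L\<^sup>\<infinity>(Y)\<close>; the convention is \<open>\<infinity> * 0 = 0\<close>.

  If \<open>\<phi> = 1\<close> almost everywhere, then the tail error and \<open>S\<^sub>q(k, a)\<close> vanish for \<open>k \<ge> 1\<close> and every \<open>a\<close>,
  and the bound fails (for instance for the doubling map with Lipschitz observables). The theorem
  therefore assumes \<open>\<mu>(\<phi> > 1) > 0\<close>.\<close>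

definition corr_bound ::
    "'a measure \<Rightarrow> ('a \<Rightarrow> 'a) \<Rightarrow> 'a set \<Rightarrow> ('a \<Rightarrow> nat) \<Rightarrow> 'a measure \<Rightarrow>
      ('b::banach \<Rightarrow> 'a \<Rightarrow> real) \<Rightarrow> (nat \<Rightarrow> real) \<Rightarrow> (nat \<Rightarrow> real) \<Rightarrow> bool" where
  "corr_bound M T Y \<phi> \<mu> emb a G \<longleftrightarrow>
     (\<exists>C>0. \<exists>k0\<ge>1. \<forall>v\<in>B_X M T Y \<phi> \<mu> emb. \<forall>w\<in>Linf (mu_X M T \<phi> \<mu>). \<forall>n k. k0 \<le> k \<and> k \<le> n \<longrightarrow>
        ennreal \<bar>corr (mu_X M T \<phi> \<mu>) T v w n\<bar>
          \<le> ennreal C * Linf_norm (mu_X M T \<phi> \<mu>) v * Linf_norm (mu_X M T \<phi> \<mu>) w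
              * ennreal (tail_error \<phi> \<mu> n k)
            + ennreal C * ennreal (exch_norm T Y \<phi> \<mu> emb v) * Linf_norm (mu_X M T \<phi> \<mu>) w
              * ennreal (G k * exp (- real n * a k)))"

end

theory Submission
  imports Defs "HOL-Complex_Analysis.Complex_Analysis"
begin

text \<open>Cut the return time at a height \<open>k\<close>: keep the return map \<open>F\<close>, but replace \<open>\<phi>\<close> by
  \<open>min \<phi> k\<close>. The correlations on the tower and on the truncated tower are then compared, and the
  latter are estimated by operator renewal theory.

  Comparison (\<open>corr_truncated_corr_le\<close>, \<open>bad_measure_le\<close>). A point has the same orbit in both towers
  for \<open>n\<close> steps unless it lies in a column higher than \<open>k\<close> or enters the base of such a column. The first
  set has measure about \<open>\<Sum>\<^bsub>j > k\<^esub> \<mu>(\<phi> > j) + k \<mu>(\<phi> > k)\<close>; the second has measure at most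
  \<open>n \<mu>(\<phi> > k)\<close> because the truncated tower map preserves its measure.

  Renewal (\<open>base_obs_renewal\<close>, \<open>truncated_correlation_eq\<close>). Decompose an orbit segment into the ascent
  to the first return, complete excursions, and a last incomplete one. The generating function of the
  correlations becomes \<open>W(z) (1 - R\<^sub>k(z))\<inverse> V(z)\<close>, where the polynomial \<open>R\<^sub>k(z)\<close> is \<open>R(z)\<close> for the
  truncated return time, \<open>V(z)\<close> collects derived observables of \<open>v\<close>, and \<open>W(z)\<close> integrates against \<open>w\<close>
  over the levels of the tower. Exchangeability bounds the coefficients of \<open>V\<close> by
  \<open>\<parallel>v\<parallel> \<Sum>\<^bsub>l > j\<^esub> \<parallel>R\<^sub>l\<parallel>\<close>.

  Resolvent (\<open>truncated_resolvent_expansion\<close>). Since \<open>exp x - 1 \<le> x\<^sup>r exp x\<close>, the hypothesis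
  \<open>a\<^sup>r S\<^sub>r(k, a) \<rightarrow> 0\<close> implies that moving from the unit circle to radius \<open>exp a\<close> changes the coefficient
  sums by \<open>o(1)\<close>. So invertibility of \<open>1 - R(z)\<close> on the closed unit disc without \<open>1\<close> passes, uniformly in \<open>k\<close>,
  to \<open>1 - R\<^sub>k(z)\<close> on the disc of radius \<open>exp a\<close>. At \<open>1\<close> the inverse has a simple pole: the coefficient
  of \<open>1 / (1 - z)\<close> is the projection onto constants divided by the mean truncated return time, and the
  remainder is \<open>O(\<bar>1 - z\<bar>\<^bsup>q - 1\<^esup> S\<^sub>q(k, a))\<close>.

  Coefficients (\<open>renewal_coefficient_decay\<close>). The pole contributes the product of the integrals of \<open>v\<close> and
  \<open>w\<close>, which is subtracted in the correlation. What is left is holomorphic in the disc of radius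
  \<open>exp a\<close> with an integrable singularity on circles near \<open>1\<close>, so its \<open>n\<close>-th coefficient is of order
  \<open>S\<^sub>q(k, a) exp (- n a)\<close>. If \<open>\<B>(Y)\<close> embeds in \<open>L\<^sup>\<infinity>\<close>, the coefficients of \<open>W\<close> are bounded by
  \<open>\<mu>(\<phi> > l)\<close> and \<open>W\<close> stays bounded on the larger disc; otherwise only the trivial bound
  \<open>k exp (k a)\<close> is available, which turns \<open>S\<^sub>q(k, a)\<close> into \<open>k\<^sup>2 exp (2 k a)\<close>.\<close>

section \<open>Bounded inverses between Banach spaces\<close>

text \<open>The closures of the images of balls around the origin cover the target, so by Baire one of them has
  interior. By linearity every point is then approximated, up to half its norm, by the image of a
  vector of comparable norm.\<close>

lemma approximate_preimage:
  fixes f :: "'a::banach \<Rightarrow>\<^sub>L 'b::banach"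
  assumes "surj (blinfun_apply f)"
  obtains K where "K > 0" "\<And>y. \<exists>x. norm x \<le> K * norm y \<and> norm (y - f x) \<le> norm y / 2"
proof -
  define C where "C n = closure (f ` cball 0 (real n))" for n :: nat
  have cover: "(\<Union>n. C n) = UNIV"
  proof (intro equalityI subset_UNIV subsetI)
    fix y :: 'b
    obtain x where x: "y = f x" using assms by (metis surjD)
    obtain n where "norm x \<le> real n" using real_arch_simple by blast
    then have "y \<in> C n" unfolding C_def x by (intro subsetD[OF closure_subset]) auto
    then show "y \<in> (\<Union>n. C n)" by blast
  qed
  have "\<exists>n. interior (C n) \<noteq> {}"
  proof (rule ccontr)
    assume "\<nexists>n. interior (C n) \<noteq> {}"
    then have "euclidean interior_of \<Union>(range C) = {}"
      by (intro Baire_category_alt)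
         (auto simp: C_def completely_metrizable_space_euclidean)
    then show False using cover by simp
  qed
  then obtain n y0 e where e: "e > 0" "ball y0 e \<subseteq> C n"
    by (metis equals0I mem_interior)
  \<comment> \<open>Differences of points of \<open>ball y0 e\<close> cover a ball around the origin.\<close>
  have approx: "\<exists>x. norm x \<le> 2 * real n \<and> norm (y - f x) < \<epsilon>"
    if "norm y < e" "\<epsilon> > 0" for y \<epsilon>
  proof -
    have "y0 + y \<in> C n" "y0 \<in> C n"
      using e that by (auto simp: subset_iff dist_norm)
    then obtain u v where uv: "norm u \<le> real n" "norm v \<le> real n"
        "dist (f u) (y0 + y) < \<epsilon>/2" "dist (f v) y0 < \<epsilon>/2"
      unfolding C_def closure_approachable using \<open>\<epsilon> > 0\<close>
      by (force dest!: spec[of _ "\<epsilon>/2"])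
    have "norm (u - v) \<le> 2 * real n" using uv norm_triangle_ineq4[of u v] by linarith
    moreover have "norm (y - f (u - v)) < \<epsilon>"
    proof -
      have eq: "y - f (u - v) = (f v - y0) - (f u - (y0 + y))"
        by (simp add: blinfun.diff_right)
      show ?thesis unfolding eq using uv norm_triangle_ineq4[of "f v - y0" "f u - (y0 + y)"]
        by (simp add: dist_norm)
    qed
    ultimately show ?thesis by blast
  qed
  show ?thesis
  proof (rule that[of "4 * real n / e + 1"])
    show "4 * real n / e + 1 > 0" using e by (intro add_nonneg_pos) auto
    fix y :: 'b
    show "\<exists>x. norm x \<le> (4 * real n / e + 1) * norm y \<and> norm (y - f x) \<le> norm y / 2"
    proof (cases "y = 0")
      case False
      define s where "s = e / (2 * norm y)"
      have s: "s > 0" using e False by (simp add: s_def)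
      have "norm (s *\<^sub>R y) < e" using e False by (simp add: s_def)
      moreover have "s * norm y / 2 > 0" using s False by simp
      ultimately obtain x where x: "norm x \<le> 2 * real n" "norm (s *\<^sub>R y - f x) < s * norm y / 2"
        using approx by blast
      have "norm (x /\<^sub>R s) \<le> 4 * real n / e * norm y"
        using x s False e by (simp add: s_def field_simps)
      also have "\<dots> \<le> (4 * real n / e + 1) * norm y" by (intro mult_right_mono) auto
      finally have 1: "norm (x /\<^sub>R s) \<le> (4 * real n / e + 1) * norm y" .
      have eq: "y - f (x /\<^sub>R s) = (s *\<^sub>R y - f x) /\<^sub>R s"
        using s by (simp add: blinfun.scaleR_right algebra_simps)
      have "norm (y - f (x /\<^sub>R s)) = norm (s *\<^sub>R y - f x) / s"
        unfolding eq using s by (simp add: divide_inverse)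
      also have "\<dots> \<le> norm y / 2" using x s by (simp add: field_simps)
      finally show ?thesis using 1 by blast
    qed (auto intro: exI[of _ 0])
  qed
qed

text \<open>The constant bounds the norm of the inverse, which itself is not named.\<close>

definition invertible_within :: "('a::real_normed_vector \<Rightarrow>\<^sub>L 'b::real_normed_vector) \<Rightarrow> real \<Rightarrow> bool" where
  "invertible_within f c \<longleftrightarrow> surj (blinfun_apply f) \<and> (\<forall>x. norm x \<le> c * norm (f x))"

text \<open>Correct an approximate preimage repeatedly: the errors halve, so the corrections sum to an exact
  preimage of controlled norm.\<close>

theorem bounded_inverse_theorem:
  fixes f :: "'a::banach \<Rightarrow>\<^sub>L 'b::banach"
  assumes bij: "bij (blinfun_apply f)"
  obtains c where "invertible_within f c"
proof -
  obtain K where K: "K > 0" "\<And>y. \<exists>x. norm x \<le> K * norm y \<and> norm (y - f x) \<le> norm y / 2"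
    using approximate_preimage bij bij_is_surj by blast
  then obtain h where h: "\<And>y. norm (h y) \<le> K * norm y" "\<And>y. norm (y - f (h y)) \<le> norm y / 2"
    by metis
  have "norm x \<le> 2 * K * norm (f x)" for x
  proof -
    define y where "y n = ((\<lambda>y. y - f (h y)) ^^ n) (f x)" for n
    have y_Suc: "y (Suc n) = y n - f (h (y n))" for n by (simp add: y_def)
    have y: "norm (y n) \<le> norm (f x) * (1/2) ^ n" for n
    proof (induction n)
      case (Suc n)
      show ?case using h(2)[of "y n"] Suc.IH by (simp add: y_Suc)
    qed (simp add: y_def)
    have bd: "norm (h (y n)) \<le> K * norm (f x) * (1/2) ^ n" for n
      using order.trans[OF h(1)[of "y n"] mult_left_mono[OF y, of K]] K by (simp add: mult.assoc)
    have geo: "(\<lambda>n. K * norm (f x) * (1/2) ^ n) sums (K * norm (f x) * 2)"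
      using sums_mult[OF geometric_sums[of "1/2::real"]] by simp
    then have summ: "summable (\<lambda>n. norm (h (y n)))"
      using bd by (intro summable_comparison_test[OF _ sums_summable[OF geo]]) auto
    have "norm (\<Sum>n. h (y n)) \<le> (\<Sum>n. norm (h (y n)))" by (rule summable_norm[OF summ])
    also have "\<dots> \<le> K * norm (f x) * 2"
      unfolding sums_unique[OF geo] by (rule suminf_le[OF bd summ sums_summable[OF geo]])
    finally have le: "norm (\<Sum>n. h (y n)) \<le> 2 * K * norm (f x)" by simp
    have "f (\<Sum>n. h (y n)) = (\<Sum>n. f (h (y n)))"
      by (rule bounded_linear.suminf[OF blinfun.bounded_linear_right summable_norm_cancel[OF summ]])
    also have "\<dots> = (\<Sum>n. y n - y (Suc n))" by (simp add: y_Suc)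
    also have "\<dots> = f x"
    proof -
      have "y \<longlonglongrightarrow> 0"
      proof (rule Lim_null_comparison)
        show "(\<lambda>n. norm (f x) * (1/2) ^ n) \<longlonglongrightarrow> 0"
          by (intro tendsto_mult_right_zero LIMSEQ_power_zero) auto
      qed (use y in auto)
      from telescope_sums'[OF this] show ?thesis by (simp add: sums_iff y_def)
    qed
    finally have "(\<Sum>n. h (y n)) = x" using bij by (metis bij_is_inj injD)
    with le show ?thesis by simp
  qed
  then show ?thesis using that[of "2 * K"] bij by (simp add: invertible_within_def bij_is_surj)
qed

lemma invertible_within_inj:
  assumes "invertible_within f c" shows "inj (blinfun_apply f)"
proof (rule injI)
  fix x y assume "f x = f y"
  then have "norm (f (x - y)) = 0" by (simp add: blinfun.diff_right)
  then have "norm (x - y) \<le> 0" using assms unfolding invertible_within_def by (metis mult_zero_right)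
  then show "x = y" by simp
qed

lemma invertible_within_mono:
  assumes "invertible_within f c" "c \<le> c'" shows "invertible_within f c'"
  using assms unfolding invertible_within_def by (meson mult_right_mono norm_ge_zero order.trans)

lemma invertible_within_left_right_inverse:
  assumes "S o\<^sub>L f = id_blinfun" "f o\<^sub>L S = id_blinfun"
  shows "invertible_within f (norm S)"
proof -
  have "S (f x) = x" "f (S y) = y" for x y
    using assms by (metis blinfun_apply_blinfun_compose blinfun_apply_id_blinfun id_apply)+
  then show ?thesis unfolding invertible_within_def surj_def by (metis norm_blinfun)
qed

lemma invertible_within_perturb:
  fixes f X :: "'a::banach \<Rightarrow>\<^sub>L 'b::banach"
  assumes f: "invertible_within f c" "c \<ge> 0" and X: "c * norm (X - f) \<le> 1/2"
  shows "invertible_within X (2 * c)"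
  unfolding invertible_within_def
proof (intro conjI allI)
  have fb: "norm x \<le> c * norm (f x)" for x using f by (auto simp: invertible_within_def)
  have dif: "c * norm ((X - f) x) \<le> 1/2 * norm x" for x
    using mult_left_mono[OF norm_blinfun[of "X - f" x] f(2)] mult_right_mono[OF X, of "norm x"]
    by (simp add: mult.assoc)
  show "norm x \<le> 2 * c * norm (X x)" for x
  proof -
    have "norm (f x) \<le> norm (X x) + norm ((X - f) x)"
      using norm_triangle_ineq4[of "X x" "(X - f) x"] by (simp add: blinfun.diff_left)
    then have "c * norm (f x) \<le> c * norm (X x) + c * norm ((X - f) x)"
      using f(2) by (metis mult_left_mono distrib_left)
    then show ?thesis using fb[of x] dif[of x] by simp
  qed
  show "surj (blinfun_apply X)"
  unfolding surj_def
  proof (intro allI)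
    fix y
    obtain g where g: "\<And>z. f (g z) = z"
      using f(1) by (metis invertible_within_def surj_def)
    \<comment> \<open>Solve \<open>f x = y - (X - f) x\<close> by the contraction principle.\<close>
    define \<Phi> where "\<Phi> x = g (y - (X - f) x)" for x
    have "dist (\<Phi> x) (\<Phi> x') \<le> 1/2 * dist x x'" for x x'
    proof -
      have "norm (\<Phi> x - \<Phi> x') \<le> c * norm (f (\<Phi> x - \<Phi> x'))" by (rule fb)
      also have "f (\<Phi> x - \<Phi> x') = - (X - f) (x - x')"
        unfolding \<Phi>_def by (simp add: blinfun.diff_right g)
      also have "c * norm (- (X - f) (x - x')) \<le> 1/2 * norm (x - x')"
        using dif[of "x - x'"] by simp
      finally show ?thesis by (simp add: dist_norm)
    qed
    then have "\<exists>!x. \<Phi> x = x"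
      by (intro banach_fix_type[of "1/2"]) auto
    then obtain x where "\<Phi> x = x" by blast
    then have "f x = y - (X - f) x" by (metis \<Phi>_def g)
    then show "\<exists>x. y = X x" by (auto simp: blinfun.diff_left intro!: exI[of _ x])
  qed
qed

text \<open>Perturbation handles a neighbourhood of each value of \<open>f\<close>; finitely many neighbourhoods cover the
  compact image.\<close>

lemma invertible_within_compact:
  fixes f :: "'s::topological_space \<Rightarrow> 'a::banach \<Rightarrow>\<^sub>L 'b::banach"
  assumes "compact S" "continuous_on S f" and inv: "\<And>s. s \<in> S \<Longrightarrow> \<exists>c. invertible_within (f s) c"
  obtains \<eta> C where "\<eta> > 0" "C > 0"
    "\<And>s X. s \<in> S \<Longrightarrow> norm (X - f s) \<le> \<eta> \<Longrightarrow> invertible_within X C"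
proof -
  have "\<exists>c>0. invertible_within (f s) c" if "s \<in> S" for s
  proof -
    from inv[OF that] obtain c where "invertible_within (f s) c" by blast
    then have "invertible_within (f s) (max c 1)" by (rule invertible_within_mono) simp
    then show ?thesis by (intro exI[of _ "max c 1"]) auto
  qed
  then obtain c where c: "\<And>s. s \<in> S \<Longrightarrow> c s > 0" "\<And>s. s \<in> S \<Longrightarrow> invertible_within (f s) (c s)" by metis
  define B where "B s = ball (f s) (1 / (4 * c s))" for s
  have cover: "f ` S \<subseteq> (\<Union>s\<in>S. B s)" using c by (auto simp: B_def)
  have "compact (f ` S)" using assms by (intro compact_continuous_image)
  from compactE_image[OF this, of S B] cover
  obtain F where F: "F \<subseteq> S" "finite F" "f ` S \<subseteq> (\<Union>s\<in>F. B s)"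
    by (metis B_def open_ball)
  define C where "C = Max (insert 1 ((\<lambda>s. 2 * c s) ` F))"
  have C: "C \<ge> 1" "\<And>s. s \<in> F \<Longrightarrow> 2 * c s \<le> C" using F by (auto simp: C_def)
  show ?thesis
  proof (rule that[of "1 / (2 * C)" C])
    fix s X assume s: "s \<in> S" "norm (X - f s) \<le> 1 / (2 * C)"
    then obtain t where t: "t \<in> F" "f s \<in> B t" using F by blast
    have ct: "c t > 0" using c F t by blast
    have "norm (X - f t) \<le> norm (X - f s) + norm (f s - f t)"
      by (rule norm_diff_triangle_le) auto
    also have "\<dots> \<le> 1 / (4 * c t) + 1 / (4 * c t)"
    proof (intro add_mono)
      have "1 / (2 * C) \<le> 1 / (4 * c t)" using C(2)[OF t(1)] ct C(1) by (intro divide_left_mono) auto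
      then show "norm (X - f s) \<le> 1 / (4 * c t)" using s by linarith
    qed (use t in \<open>simp add: B_def dist_norm norm_minus_commute\<close>)
    finally have "c t * norm (X - f t) \<le> 1/2" using ct by (simp add: field_simps)
    then have "invertible_within X (2 * c t)"
      using c F t ct by (intro invertible_within_perturb[of "f t"]) auto
    then show "invertible_within X C" using C(2)[OF t(1)] by (rule invertible_within_mono)
  qed (use C in auto)
qed

section \<open>Operators on the complexification\<close>

lemma cscale_mult: "cscale z (cscale w x) = cscale (z * w) x"
  by (simp add: cscale.rep_eq algebra_simps)

lemma cscale_add_left: "cscale (z + w) x = cscale z x + cscale w x"
  by (simp add: cscale.rep_eq algebra_simps)

lemma cscale_diff_left: "cscale (z - w) x = cscale z x - cscale w x"
  by (simp add: cscale.rep_eq algebra_simps)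

lemma cscale_minus_left: "cscale (- z) x = - cscale z x"
  by (simp add: cscale.rep_eq algebra_simps)

lemma cscale_0 [simp]: "cscale 0 x = 0"
  by (simp add: cscale.rep_eq zero_prod_def)

lemma cscale_1 [simp]: "cscale 1 x = x"
  by (simp add: cscale.rep_eq)

lemma norm_cscale_le: "norm (cscale z x) \<le> 2 * norm z * norm x"
proof -
  obtain u v where x: "x = (u, v)" by (cases x)
  have "norm (cscale z x) \<le> norm (Re z *\<^sub>R u - Im z *\<^sub>R v) + norm (Re z *\<^sub>R v + Im z *\<^sub>R u)"
    unfolding x cscale.rep_eq by (simp add: norm_Pair sqrt_sum_squares_le_sum)
  also have "\<dots> \<le> (\<bar>Re z\<bar> * norm u + \<bar>Im z\<bar> * norm v) + (\<bar>Re z\<bar> * norm v + \<bar>Im z\<bar> * norm u)"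
    using norm_triangle_ineq4[of "Re z *\<^sub>R u" "Im z *\<^sub>R v"]
      norm_triangle_ineq[of "Re z *\<^sub>R v" "Im z *\<^sub>R u"] by simp
  also have "\<dots> = (\<bar>Re z\<bar> + \<bar>Im z\<bar>) * (norm u + norm v)" by (simp add: algebra_simps)
  also have "\<dots> \<le> (sqrt 2 * norm z) * (sqrt 2 * norm x)"
  proof (rule mult_mono)
    show "\<bar>Re z\<bar> + \<bar>Im z\<bar> \<le> sqrt 2 * norm z" by (rule complex_abs_le_norm)
    show "norm u + norm v \<le> sqrt 2 * norm x"
      using complex_abs_le_norm[of "Complex (norm u) (norm v)"]
      unfolding x by (simp add: norm_Pair cmod_def)
  qed auto
  also have "\<dots> = 2 * norm z * norm x" by simp
  finally show ?thesis .
qed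

lemma bounded_linear_cscale: "bounded_linear cscale"
proof (rule bounded_linear_intro[of _ 2])
  show "cscale (x + y) = cscale x + cscale y" for x y
    by (intro blinfun_eqI) (simp add: cscale_add_left blinfun.add_left)
  show "cscale (r *\<^sub>R x) = r *\<^sub>R cscale x" for r x
    by (intro blinfun_eqI) (simp add: cscale.rep_eq blinfun.scaleR_left algebra_simps)
  show "norm (cscale x) \<le> norm x * 2" for x
    using norm_cscale_le by (intro norm_blinfun_bound) (auto simp: mult.commute)
qed

lemma complexify_cscale: "complexify A (cscale z x) = cscale z (complexify A x)"
  by (simp add: cscale.rep_eq complexify.rep_eq blinfun.bilinear_simps)

lemma norm_complexify_le:
  fixes A :: "'b::real_normed_vector \<Rightarrow>\<^sub>L 'b"
  shows "norm (complexify A) \<le> norm A"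
proof (rule norm_blinfun_bound)
  fix x :: "'b \<times> 'b"
  obtain u v where x: "x = (u, v)" by (cases x)
  have "norm (complexify A x) \<le> sqrt ((norm A * norm u)\<^sup>2 + (norm A * norm v)\<^sup>2)"
    unfolding x complexify.rep_eq using norm_blinfun[of A]
    by (auto simp: norm_Pair intro!: power_mono add_mono)
  also have "\<dots> = norm A * norm x"
    by (simp add: x norm_Pair power_mult_distrib real_sqrt_mult flip: distrib_left)
  finally show "norm (complexify A x) \<le> norm A * norm x" .
qed simp

lemma bounded_linear_complexify:
  "bounded_linear (complexify :: ('b::real_normed_vector \<Rightarrow>\<^sub>L 'b) \<Rightarrow> _)"
proof (rule bounded_linear_intro[of _ 1])
  show "complexify (x + y) = complexify x + complexify y" for x y :: "'b \<Rightarrow>\<^sub>L 'b"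
    by (intro blinfun_eqI) (simp add: complexify.rep_eq blinfun.add_left)
  show "complexify (r *\<^sub>R x) = r *\<^sub>R complexify x" for r and x :: "'b \<Rightarrow>\<^sub>L 'b"
    by (intro blinfun_eqI) (simp add: complexify.rep_eq blinfun.scaleR_left)
  show "norm (complexify x) \<le> norm x * 1" for x :: "'b \<Rightarrow>\<^sub>L 'b"
    using norm_complexify_le by simp
qed

lemma norm_cscale_complexify_le:
  fixes A :: "'b::real_normed_vector \<Rightarrow>\<^sub>L 'b"
  shows "norm (cscale z o\<^sub>L complexify A) \<le> 2 * norm z * norm A"
proof (rule norm_blinfun_bound)
  fix x :: "'b \<times> 'b"
  have "norm (cscale z (complexify A x)) \<le> 2 * norm z * norm (complexify A x)" by (rule norm_cscale_le)
  also have "\<dots> \<le> 2 * norm z * (norm A * norm x)"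
    by (intro mult_left_mono order.trans[OF norm_blinfun mult_right_mono[OF norm_complexify_le]]) auto
  finally show "norm ((cscale z o\<^sub>L complexify A) x) \<le> 2 * norm z * norm A * norm x"
    by (simp add: mult.assoc)
qed simp

definition complex_functional :: "('b::real_normed_vector \<Rightarrow> real) \<Rightarrow> 'b \<times> 'b \<Rightarrow> complex" where
  "complex_functional f x = Complex (f (fst x)) (f (snd x))"

lemma complex_functional_cscale:
  "bounded_linear f \<Longrightarrow> complex_functional f (cscale z x) = z * complex_functional f x"
  by (simp add: complex_functional_def cscale.rep_eq complex_eq_iff linear_simps)

lemma complex_functional_complexify:
  "complex_functional f (complexify A x) = complex_functional (\<lambda>b. f (A b)) x"
  by (simp add: complex_functional_def complexify.rep_eq)

lemma norm_complex_functional_le: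
  fixes f :: "'b::real_normed_vector \<Rightarrow> real"
  assumes f: "\<And>b. \<bar>f b\<bar> \<le> c * norm b"
  shows "norm (complex_functional f x) \<le> c * norm x"
proof (cases "c \<ge> 0")
  case True
  have "norm (complex_functional f x) \<le> sqrt ((c * norm (fst x))\<^sup>2 + (c * norm (snd x))\<^sup>2)"
    using f unfolding complex_functional_def
    by (auto simp: cmod_def simp flip: abs_le_square_iff intro!: add_mono) (metis abs_ge_self order.trans)+
  also have "\<dots> = c * norm x"
    using True by (simp add: norm_prod_def power_mult_distrib real_sqrt_mult flip: distrib_left)
  finally show ?thesis .
next
  case False
  \<comment> \<open>A negative constant is only possible on the trivial space.\<close>
  have "b = 0" for b :: 'b
    using f[of b] False abs_ge_zero[of "f b"]
    by (metis linorder_not_le mult_less_0_iff norm_le_zero_iff order.trans)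
  from this[of "fst x"] this[of "snd x"] f[of 0] show ?thesis
    by (simp add: complex_functional_def norm_prod_def complex_eq_iff)
qed

lemma bounded_linear_complex_functional:
  assumes "bounded_linear f" shows "bounded_linear (complex_functional f)"
proof -
  obtain K where K: "\<And>x. norm (f x) \<le> norm x * K"
    using bounded_linear.bounded[OF assms] by blast
  show ?thesis
  proof (rule bounded_linear_intro[of _ K])
    show "norm (complex_functional f x) \<le> norm x * K" for x
      using norm_complex_functional_le[of f K x] K by (simp add: mult.commute)
  qed (use assms in \<open>auto simp: complex_functional_def linear_simps complex_eq_iff\<close>)
qed

text \<open>Interpolates between the Lipschitz bound, with factor \<open>j \<bar>z - 1\<bar>\<close>, and the trivial bound, with
  factor \<open>2\<close>. This is where the weight \<open>j\<^sup>q exp (j a)\<close> comes from.\<close>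

lemma norm_power_diff_one_le:
  fixes z :: complex
  assumes q: "0 < q" "q \<le> 1" and z: "norm z \<le> exp a" "a \<ge> 0"
  shows "norm (z ^ j - 1) \<le> 2 * (norm (z - 1) powr q * (real j powr q * exp (real j * a)))"
proof (cases "z = 1 \<or> j = 0")
  case False
  have zj: "norm z ^ i \<le> exp (real j * a)" if "i \<le> j" for i
  proof -
    have "norm z ^ i \<le> exp a ^ i" using z by (intro power_mono) auto
    also have "\<dots> \<le> exp a ^ j" using z that by (intro power_increasing) auto
    finally show ?thesis by (simp add: exp_of_nat_mult)
  qed
  have e1: "1 \<le> exp (real j * a)" using z by simp
  have A: "norm (z ^ j - 1) \<le> norm (z - 1) * (real j * exp (real j * a))"
  proof -
    have "z ^ j - 1 = (z - 1) * (\<Sum>i<j. z ^ i)" by (rule power_diff_1_eq)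
    moreover have "norm (\<Sum>i<j. z ^ i) \<le> (\<Sum>i<j. exp (real j * a))"
      using zj by (intro sum_norm_le) (auto simp: norm_power)
    ultimately show ?thesis by (simp add: norm_mult mult_left_mono)
  qed
  have B: "norm (z ^ j - 1) \<le> 2 * exp (real j * a)"
    using norm_triangle_ineq4[of "z ^ j" 1] zj[of j] e1 unfolding norm_power norm_one by linarith
  show ?thesis
  proof (cases "norm (z ^ j - 1) = 0")
    case nz: False
    define X where "X = norm (z - 1) * real j"
    have X: "X > 0" using False by (simp add: X_def)
    have "norm (z ^ j - 1) \<le> 2 * exp (real j * a) * min X 1"
    proof -
      have "norm (z ^ j - 1) \<le> exp (real j * a) * X" using A by (simp add: X_def mult_ac)
      also have "\<dots> \<le> 2 * exp (real j * a) * X" using X by simp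
      finally show ?thesis using B by (simp add: min_def)
    qed
    also have "min X 1 \<le> X powr q"
    proof (cases "X \<le> 1")
      case True
      then have "X powr 1 \<le> X powr q" using q X by (intro powr_mono') auto
      then show ?thesis using X True by simp
    qed (use q in \<open>simp add: ge_one_powr_ge_zero\<close>)
    also have "X powr q = norm (z - 1) powr q * real j powr q" by (simp add: X_def powr_mult)
    finally show ?thesis by (simp add: mult_ac)
  qed (simp add: zero_le_mult_iff)
qed auto

section \<open>Tails of a sequence of operators and the truncated series\<close>

definition tail_op :: "(nat \<Rightarrow> 'b::banach \<Rightarrow>\<^sub>L 'b) \<Rightarrow> nat \<Rightarrow> 'b \<Rightarrow>\<^sub>L 'b" where
  "tail_op Rn j = (\<Sum>\<^sub>\<infinity>l\<in>{j<..}. Rn l)"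

definition tail_norm :: "(nat \<Rightarrow> 'b::banach \<Rightarrow>\<^sub>L 'b) \<Rightarrow> nat \<Rightarrow> real" where
  "tail_norm Rn j = (\<Sum>\<^sub>\<infinity>l\<in>{j<..}. norm (Rn l))"

locale summable_tails =
  fixes Rn :: "nat \<Rightarrow> 'b::banach \<Rightarrow>\<^sub>L 'b"
  assumes Rn_tail_summable': "\<And>n. 1 \<le> n \<Longrightarrow> (\<lambda>j. norm (Rn j)) summable_on {n<..}"
    and Rn_summable': "(\<lambda>n. \<Sum>\<^sub>\<infinity>j\<in>{n<..}. norm (Rn j)) summable_on {1..}"
begin

abbreviation "r \<equiv> tail_norm Rn"
abbreviation "Rt \<equiv> tail_op Rn"

lemma greaterThan_eq_insert_Suc: "{j<..} = insert (Suc j) {Suc j<..}" by auto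

lemma norm_summable: "(\<lambda>l. norm (Rn l)) summable_on {j<..}"
  using Rn_tail_summable'[of "Suc j"] by (subst greaterThan_eq_insert_Suc) (simp add: summable_on_insert_iff)

lemma op_summable: "Rn summable_on {j<..}"
  using norm_summable by (rule abs_summable_summable)

lemma tail_norm_nonneg: "r j \<ge> 0"
  unfolding tail_norm_def by (rule infsum_nonneg) simp

lemma tail_op_Suc: "Rt j = Rn (Suc j) + Rt (Suc j)"
  unfolding tail_op_def
  by (subst greaterThan_eq_insert_Suc) (simp add: infsum_insert op_summable)

lemma norm_tail_op_le: "norm (Rt j) \<le> r j"
  unfolding tail_op_def tail_norm_def by (rule norm_infsum_bound[OF norm_summable])

lemma summable_tail_norm: "summable r"
proof -
  have "r summable_on {1..}" using Rn_summable' by (simp add: tail_norm_def[abs_def])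
  moreover have "insert 0 {1..} = (UNIV :: nat set)" by auto
  ultimately have "r summable_on UNIV" by (metis summable_on_insert_iff)
  then show ?thesis by (rule summable_on_imp_summable)
qed

text \<open>\<open>trR k z\<close> is the series \<open>R(z)\<close> for the return time cut at \<open>k\<close>. Summation by parts writes it as
  \<open>R(1) + (z - 1) trD k z\<close>, where the coefficients of \<open>trD\<close> are tails and hence summable in norm.\<close>

definition trD :: "nat \<Rightarrow> complex \<Rightarrow> ('b \<times> 'b) \<Rightarrow>\<^sub>L ('b \<times> 'b)" where
  "trD k z = (\<Sum>j<k. cscale (z ^ j) o\<^sub>L complexify (Rt j))"

definition trR :: "nat \<Rightarrow> complex \<Rightarrow> ('b \<times> 'b) \<Rightarrow>\<^sub>L ('b \<times> 'b)" where
  "trR k z = complexify (Rt 0) + (cscale (z - 1) o\<^sub>L trD k z)"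

lemma trD_apply: "trD k z x = (\<Sum>j<k. cscale (z ^ j) (complexify (Rt j) x))"
  by (simp add: trD_def blinfun.sum_left)

lemma trR_apply: "trR k z x = complexify (Rt 0) x + cscale (z - 1) (trD k z x)"
  by (simp add: trR_def blinfun.add_left)

lemma trD_cscale: "trD k z (cscale w x) = cscale w (trD k z x)"
  by (simp add: trD_apply complexify_cscale cscale_mult blinfun.sum_right mult.commute)

lemma trR_cscale: "trR k z (cscale w x) = cscale w (trR k z x)"
  by (simp add: trR_apply trD_cscale complexify_cscale cscale_mult blinfun.add_right mult.commute)

lemma norm_cscale_power_tail_op_le:
  assumes "norm z \<le> exp a"
  shows "norm (cscale (z ^ j) o\<^sub>L complexify (Rt j)) \<le> 2 * (r j * exp (real j * a))"
proof -
  have "norm (z ^ j) \<le> exp (real j * a)"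
    using power_mono[OF assms norm_ge_zero, of j] by (simp add: norm_power exp_of_nat_mult)
  then have "norm (z ^ j) * norm (Rt j) \<le> exp (real j * a) * r j"
    using norm_tail_op_le by (intro mult_mono) auto
  then show ?thesis using norm_cscale_complexify_le[of "z ^ j" "Rt j"] by (simp add: mult_ac)
qed

lemma norm_trD_le:
  assumes "norm z \<le> exp a"
  shows "norm (trD k z) \<le> 2 * (\<Sum>j<k. r j * exp (real j * a))"
  unfolding trD_def sum_distrib_left
  using norm_cscale_power_tail_op_le[OF assms] by (intro sum_norm_le) auto

lemma trR_eq_sum:
  assumes "k \<ge> 1"
  shows "trR k z = (\<Sum>j=1..<k. cscale (z ^ j) o\<^sub>L complexify (Rn j)) + (cscale (z ^ k) o\<^sub>L complexify (Rt (k - 1)))"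
  using assms
proof (induction k rule: dec_induct)
  case base
  show ?case by (intro blinfun_eqI)
    (simp add: trR_apply trD_apply cscale_diff_left)
next
  case (step k)
  have Rt: "complexify (Rt (k - 1)) x = complexify (Rn k) x + complexify (Rt k) x" for x
    using tail_op_Suc[of "k - 1"] step.hyps
    by (simp add: linear_simps(1)[OF bounded_linear_complexify] blinfun.add_left)
  have pow: "(z - 1) * z ^ k = z ^ Suc k - z ^ k" by (simp add: algebra_simps)
  show ?case
  proof (rule blinfun_eqI)
    fix x
    let ?s = "\<Sum>j=1..<k. cscale (z ^ j) o\<^sub>L complexify (Rn j)"
    have "trR (Suc k) z x = trR k z x + cscale (z - 1) (cscale (z ^ k) (complexify (Rt k) x))"
      by (simp add: trR_apply trD_apply blinfun.add_right)
    also have "\<dots> = trR k z x + (cscale (z ^ Suc k) (complexify (Rt k) x) - cscale (z ^ k) (complexify (Rt k) x))"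
      by (simp only: cscale_mult pow cscale_diff_left)
    also have "trR k z x = ?s x + cscale (z ^ k) (complexify (Rt (k - 1)) x)"
      by (simp only: step.IH blinfun.add_left blinfun_apply_blinfun_compose)
    also have "cscale (z ^ k) (complexify (Rt (k - 1)) x)
        = cscale (z ^ k) (complexify (Rn k) x) + cscale (z ^ k) (complexify (Rt k) x)"
      by (simp only: Rt blinfun.add_right)
    also have "?s x + (cscale (z ^ k) (complexify (Rn k) x) + cscale (z ^ k) (complexify (Rt k) x))
        + (cscale (z ^ Suc k) (complexify (Rt k) x) - cscale (z ^ k) (complexify (Rt k) x))
        = (?s + (cscale (z ^ k) o\<^sub>L complexify (Rn k)) + (cscale (z ^ Suc k) o\<^sub>L complexify (Rt k))) x"
      by (simp only: blinfun.add_left blinfun_apply_blinfun_compose) (simp only: algebra_simps)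
    also have "?s + (cscale (z ^ k) o\<^sub>L complexify (Rn k)) = (\<Sum>j=1..<Suc k. cscale (z ^ j) o\<^sub>L complexify (Rn j))"
      using step.hyps by (simp only: sum.atLeastLessThan_Suc)
    finally show "trR (Suc k) z x = ((\<Sum>j=1..<Suc k. cscale (z ^ j) o\<^sub>L complexify (Rn j))
        + (cscale (z ^ Suc k) o\<^sub>L complexify (Rt (Suc k - 1)))) x" by simp
  qed
qed

lemma norm_series_term_le:
  assumes "norm z \<le> 1" shows "norm (cscale (z ^ n) o\<^sub>L complexify (Rn n)) \<le> 2 * norm (Rn n)"
proof -
  have "norm (z ^ n) * norm (Rn n) \<le> 1 * norm (Rn n)"
    using assms by (intro mult_right_mono) (auto simp: norm_power power_le_one)
  then show ?thesis using norm_cscale_complexify_le[of "z ^ n" "Rn n"] by simp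
qed

lemma series_abs_summable:
  assumes "norm z \<le> 1"
  shows "(\<lambda>n. norm (cscale (z ^ n) o\<^sub>L complexify (Rn n))) summable_on {j<..}"
proof (rule summable_on_comparison_test)
  show "(\<lambda>n. 2 * norm (Rn n)) summable_on {j<..}"
    by (rule summable_on_cmult_right[OF norm_summable])
qed (use norm_series_term_le[OF assms] in auto)

lemma R_series_1: "R_series Rn 1 = complexify (Rt 0)"
proof -
  have "cscale (1 ^ n) o\<^sub>L complexify (Rn n) = complexify (Rn n)" for n
    by (intro blinfun_eqI) simp
  moreover have "{1..} = {0::nat<..}" by auto
  ultimately have "R_series Rn 1 = (\<Sum>\<^sub>\<infinity>n\<in>{0<..}. complexify (Rn n))"
    by (simp add: R_series_def)
  also have "\<dots> = complexify (\<Sum>\<^sub>\<infinity>n\<in>{0<..}. Rn n)"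
    by (rule infsum_bounded_linear_strong[OF _ bounded_linear_complexify])
       (use summable_on_bounded_linear[OF bounded_linear_complexify op_summable] op_summable in auto)
  finally show ?thesis by (simp add: tail_op_def)
qed

text \<open>Cutting only moves the terms of index at least \<open>k\<close> to the power \<open>z\<^sup>k\<close>.\<close>

lemma trR_near_R_series:
  assumes z: "norm z \<le> 1" and k: "k \<ge> 1"
  shows "norm (trR k z - R_series Rn z) \<le> 4 * r (k - 1)"
proof -
  let ?f = "\<lambda>n. cscale (z ^ n) o\<^sub>L complexify (Rn n)"
  have "{1..} = {1..<k} \<union> {k - 1<..}" using k by auto
  then have "R_series Rn z = infsum ?f {1..<k} + infsum ?f {k - 1<..}"
    unfolding R_series_def
    using abs_summable_summable[OF series_abs_summable[OF z, of "k - 1"]]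
    by (simp only:) (rule infsum_Un_disjoint, auto)
  then have "trR k z - R_series Rn z = (cscale (z ^ k) o\<^sub>L complexify (Rt (k - 1))) - infsum ?f {k - 1<..}"
    by (simp add: trR_eq_sum[OF k])
  also have "norm \<dots> \<le> norm (cscale (z ^ k) o\<^sub>L complexify (Rt (k - 1))) + norm (infsum ?f {k - 1<..})"
    by (rule norm_triangle_ineq4)
  also have "norm (cscale (z ^ k) o\<^sub>L complexify (Rt (k - 1))) \<le> 2 * r (k - 1)"
  proof -
    have "norm (z ^ k) * norm (Rt (k - 1)) \<le> 1 * r (k - 1)"
      using z norm_tail_op_le by (intro mult_mono) (auto simp: norm_power power_le_one)
    then show ?thesis using norm_cscale_complexify_le[of "z ^ k" "Rt (k - 1)"] by simp
  qed
  also have "norm (infsum ?f {k - 1<..}) \<le> (\<Sum>\<^sub>\<infinity>n\<in>{k - 1<..}. norm (?f n))"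
    by (rule norm_infsum_bound[OF series_abs_summable[OF z]])
  also have "\<dots> \<le> (\<Sum>\<^sub>\<infinity>n\<in>{k - 1<..}. 2 * norm (Rn n))"
    using norm_series_term_le[OF z] series_abs_summable[OF z] summable_on_cmult_right[OF norm_summable]
    by (intro infsum_mono) auto
  also have "\<dots> = 2 * r (k - 1)" by (simp add: infsum_cmult_right' tail_norm_def)
  finally show ?thesis by simp
qed

lemma continuous_on_trR: "continuous_on S (trR k)"
  unfolding trR_def[abs_def] trD_def
  by (intro continuous_intros bounded_bilinear.continuous_on[OF bounded_bilinear_blinfun_compose]
        bounded_linear.continuous_on[OF bounded_linear_cscale])

lemma tail_norm_tendsto_0: "r \<longlonglongrightarrow> 0"
  by (rule summable_LIMSEQ_zero[OF summable_tail_norm])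

lemma continuous_on_R_series: "continuous_on (cball 0 1) (R_series Rn)"
proof (rule uniform_limit_theorem[of _ trR])
  show "uniform_limit (cball 0 1) trR (R_series Rn) sequentially"
  proof (rule uniform_limitI)
    fix \<epsilon> :: real assume "\<epsilon> > 0"
    have "(\<lambda>k. 4 * r (k - 1)) \<longlonglongrightarrow> 4 * 0"
      by (intro tendsto_mult_left filterlim_compose[OF tail_norm_tendsto_0] filterlim_minus_const_nat_at_top)
    then have "\<forall>\<^sub>F k in sequentially. 4 * r (k - 1) < \<epsilon>"
      using \<open>\<epsilon> > 0\<close> by (intro order_tendstoD(2)) auto
    then show "\<forall>\<^sub>F k in sequentially. \<forall>z\<in>cball 0 1. dist (trR k z) (R_series Rn z) < \<epsilon>"
      using eventually_ge_at_top[of 1]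
      by eventually_elim (auto simp: dist_norm intro: le_less_trans[OF trR_near_R_series])
  qed
qed (auto intro!: always_eventually continuous_on_trR)

lemma exp_minus_one_le_powr:
  assumes "x > 0" "0 < p" "p \<le> (1::real)" shows "exp x - 1 \<le> x powr p * exp x"
proof (cases "x \<le> 1")
  case True
  have "1 - exp (- x) \<le> x" using exp_ge_add_one_self[of "- x"] by simp
  then have "exp x * (1 - exp (- x)) \<le> exp x * x" by (intro mult_left_mono) auto
  then have "exp x - 1 \<le> exp x * x" by (simp add: algebra_simps flip: exp_add)
  also have "exp x * x \<le> exp x * x powr p" using True assms powr_mono'[of p 1 x] by simp
  finally show ?thesis by (simp add: mult.commute)
next
  case False
  then have "1 \<le> x powr p" using assms by (simp add: ge_one_powr_ge_zero)
  from mult_right_mono[OF this, of "exp x"] have "exp x \<le> x powr p * exp x"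
    by (simp only: mult_1_left exp_ge_zero)
  then show ?thesis by linarith
qed

lemma S_sum_eq: "S_sum Rn q k a = (\<Sum>j=1..k. r j * real j powr q * exp (real j * a))"
  by (simp add: S_sum_def tail_norm_def)

lemma S_sum_term_le:
  assumes "1 \<le> j" "j \<le> k" shows "r j * real j powr q * exp (real j * a) \<le> S_sum Rn q k a"
  unfolding S_sum_eq using assms tail_norm_nonneg
  by (intro member_le_sum) auto

lemma weighted_tail_le_S_sum:
  assumes "q > 0" shows "(\<Sum>j<k. r j * (real j powr q * exp (real j * a))) \<le> S_sum Rn q k a"
proof -
  have "(\<Sum>j<k. r j * (real j powr q * exp (real j * a)))
      = (\<Sum>j\<in>{..<k} - {0}. r j * (real j powr q * exp (real j * a)))"
    by (rule sum.mono_neutral_right) auto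
  also have "\<dots> \<le> S_sum Rn q k a" unfolding S_sum_eq
    using tail_norm_nonneg by (auto simp: mult.assoc intro!: sum_mono2)
  finally show ?thesis .
qed

text \<open>Converts the hypothesis on the radius into smallness of what the larger radius adds to the
  coefficient sums.\<close>

lemma exp_excess_le:
  assumes "a > 0" "0 < p" "p \<le> 1"
  shows "(\<Sum>j<k. r j * (exp (real j * a) - 1)) \<le> a powr p * S_sum Rn p k a"
proof -
  have "exp (real j * a) - 1 \<le> a powr p * (real j powr p * exp (real j * a))" for j
    using exp_minus_one_le_powr[of "real j * a" p] assms by (cases "j = 0") (auto simp: powr_mult mult_ac)
  then have "(\<Sum>j<k. r j * (exp (real j * a) - 1))
      \<le> (\<Sum>j<k. r j * (a powr p * (real j powr p * exp (real j * a))))"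
    using tail_norm_nonneg by (intro sum_mono mult_left_mono) auto
  also have "\<dots> = a powr p * (\<Sum>j<k. r j * (real j powr p * exp (real j * a)))"
    by (simp add: sum_distrib_left mult_ac)
  also have "\<dots> \<le> a powr p * S_sum Rn p k a"
    using weighted_tail_le_S_sum assms by (intro mult_left_mono) auto
  finally show ?thesis .
qed

end

section \<open>The pole of the resolvent at one\<close>

text \<open>What renewal theory needs to know about a good inducing scheme: \<open>I\<close> is integration and \<open>e\<close> the constant
  function one.\<close>

locale renewal_operators = summable_tails Rn
  for Rn :: "nat \<Rightarrow> 'b::banach \<Rightarrow>\<^sub>L 'b" +
  fixes I :: "'b \<Rightarrow> real" and e :: 'b
  assumes I_linear: "bounded_linear I"
    and I_le: "\<And>b. \<bar>I b\<bar> \<le> norm b"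
    and I_invariant: "\<And>b. I (tail_op Rn 0 b) = I b"
    and e_fixed: "tail_op Rn 0 e = e"
    and I_e: "I e = 1"
    and I_tail_nonneg: "\<And>j. 0 \<le> I (tail_op Rn j e)"
    and simple: "simple_eigenvalue (R_series Rn 1) 1"
    and resolvent: "\<And>z. norm z \<le> 1 \<Longrightarrow> z \<noteq> 1 \<Longrightarrow> 1 \<notin> spectrum (R_series Rn z)"
begin

abbreviation "J \<equiv> complex_functional I"
abbreviation "E \<equiv> (e, 0 :: 'b)"
abbreviation "A \<equiv> complexify (Rt 0)"

definition mean_return :: "nat \<Rightarrow> real" where "mean_return k = (\<Sum>j<k. I (Rt j e))"

lemma J_cscale: "J (cscale z x) = z * J x"
  by (rule complex_functional_cscale[OF I_linear])

lemma norm_J_le: "norm (J x) \<le> norm x"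
  using norm_complex_functional_le[of I 1 x] I_le by simp

lemma J_linear: "bounded_linear J"
  by (rule bounded_linear_complex_functional[OF I_linear])

lemmas J_simps = linear_simps[OF J_linear]

lemma J_A: "J (A x) = J x"
  by (simp add: complex_functional_complexify I_invariant)

lemma J_E: "J E = 1"
  by (simp add: complex_functional_def I_e linear_simps[OF I_linear] complex_eq_iff)

lemma A_E: "A E = E"
  by (simp add: complexify.rep_eq e_fixed blinfun.zero_right)

lemma norm_E: "norm E = norm e" by (simp add: norm_Pair)

lemma norm_e_ge: "norm e \<ge> 1" using I_le[of e] I_e by simp

lemma mean_return_ge_1: "k \<ge> 1 \<Longrightarrow> mean_return k \<ge> 1"
proof -
  assume "k \<ge> 1"
  then have "I (Rt 0 e) \<le> mean_return k"
    unfolding mean_return_def using I_tail_nonneg by (intro member_le_sum) auto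
  then show ?thesis by (simp add: e_fixed I_e)
qed

text \<open>The spectral projection at the eigenvalue one.\<close>

definition P :: "('b \<times> 'b) \<Rightarrow>\<^sub>L ('b \<times> 'b)" where "P = Blinfun (\<lambda>x. cscale (J x) E)"

lemma P_apply: "P x = cscale (J x) E"
proof -
  have "bounded_linear (\<lambda>x. blinfun_apply (cscale (J x)) E)"
    by (rule bounded_linear_compose[OF blinfun.bounded_linear_left
          bounded_linear_compose[OF bounded_linear_cscale J_linear]])
  then show ?thesis by (simp add: P_def bounded_linear_Blinfun_apply)
qed

text \<open>\<open>1 - A\<close> kills the line of \<open>E\<close> and, the eigenvalue being simple, is bijective on its range; that range lies in
  the kernel of \<open>J\<close>, so adding \<open>P\<close> repairs exactly the missing direction.\<close>

lemma bijective_one_minus_A_plus_P: "bij (blinfun_apply (id_blinfun - A + P))"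
proof -
  let ?B = "id_blinfun - A"
  have B: "blinfun_apply (cscale 1 - R_series Rn 1) = blinfun_apply ?B"
    by (rule ext) (simp add: R_series_1 blinfun.diff_left)
  obtain f where f: "f \<noteq> 0" "{x. ?B x = 0} = {blinfun_apply (cscale c) f | c. True}"
      "{x. ?B x = 0} \<inter> range (blinfun_apply ?B) = {0}"
      "{x + y | x y. x \<in> {x. ?B x = 0} \<and> y \<in> range (blinfun_apply ?B)} = UNIV"
    using simple unfolding simple_eigenvalue_def B Let_def by blast
  have BE: "?B (cscale c E) = 0" for c
    by (simp add: blinfun.diff_left complexify_cscale A_E)
  have J0: "J (?B x) = 0" for x by (simp add: blinfun.diff_left J_simps J_A)
  have ker: "\<exists>c. x = cscale c E" if "?B x = 0" for x
  proof -
    obtain c where c: "E = cscale c f" using BE[of 1] f(2) by auto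
    have "x \<in> {x. ?B x = 0}" using that by simp
    then obtain d where d: "x = cscale d f" unfolding f(2) by blast
    have "c \<noteq> 0" using c J_E J_simps(3) by (metis cscale_0 zero_neq_one)
    then have "x = cscale (d / c) E" unfolding c d by (simp add: cscale_mult)
    then show ?thesis by blast
  qed
  show ?thesis
  proof (rule bijI)
    show "inj (blinfun_apply (?B + P))"
    proof (rule injI)
      fix x y assume "(?B + P) x = (?B + P) y"
      then have "(?B + P) (x - y) = 0" by (simp only: blinfun.diff_right) simp
      then have *: "?B (x - y) = cscale (- J (x - y)) E"
        by (simp add: blinfun.add_left P_apply cscale_minus_left eq_neg_iff_add_eq_0)
      then have "J (cscale (- J (x - y)) E) = 0" using J0 by metis
      then have "J (x - y) = 0" by (simp add: J_cscale J_E)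
      with * have "?B (x - y) = 0" by simp
      with ker obtain c where "x - y = cscale c E" by blast
      with \<open>J (x - y) = 0\<close> show "x = y" by (simp add: J_cscale J_E)
    qed
    show "surj (blinfun_apply (?B + P))"
      unfolding surj_def
    proof
      fix y
      have "y \<in> {x + y | x y. x \<in> {x. ?B x = 0} \<and> y \<in> range (blinfun_apply ?B)}"
        unfolding f(4) by simp
      then obtain k u where y: "y = k + ?B u" "?B k = 0" by blast
      with ker obtain c where c: "k = cscale c E" by blast
      have "(?B + P) (u - cscale (J u) E + cscale c E) = ?B u + cscale c E"
        by (simp only: blinfun.add_left blinfun.add_right blinfun.diff_right BE P_apply J_cscale J_E
            J_simps) (simp add: cscale_add_left cscale_diff_left)
      then show "\<exists>x. y = (?B + P) x" unfolding y c by (metis add.commute)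
    qed
  qed
qed

definition inverse_bound :: real where
  "inverse_bound = (SOME c. c \<ge> 1 \<and> invertible_within (id_blinfun - A + P) c)"

lemma inverse_bound: "inverse_bound \<ge> 1" "invertible_within (id_blinfun - A + P) inverse_bound"
proof -
  obtain c where "invertible_within (id_blinfun - A + P) c"
    using bounded_inverse_theorem[OF bijective_one_minus_A_plus_P] by blast
  then have "invertible_within (id_blinfun - A + P) (max 1 c)"
    by (rule invertible_within_mono) simp
  then have "\<exists>c. c \<ge> 1 \<and> invertible_within (id_blinfun - A + P) c"
    by (intro exI[of _ "max 1 c"]) auto
  from someI_ex[OF this] show "inverse_bound \<ge> 1" "invertible_within (id_blinfun - A + P) inverse_bound"
    unfolding inverse_bound_def by blast+
qed

lemma norm_le_inverse_bound:
  assumes "J x = 0" shows "norm x \<le> inverse_bound * norm (x - A x)"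
  using inverse_bound(2) assms unfolding invertible_within_def
  by (metis (no_types, lifting) P_apply add.right_neutral blinfun.add_left blinfun.diff_left
      blinfun_apply_id_blinfun cscale_0 id_apply)

lemma norm_cscale_trD_le:
  assumes D: "norm (trD k z) \<le> d"
  shows "norm (cscale w (trD k z x)) \<le> 2 * norm w * (d * norm x)"
proof -
  have "norm (trD k z x) \<le> d * norm x"
    using norm_blinfun[of "trD k z" x] mult_right_mono[OF D norm_ge_zero[of x]] by linarith
  then have "2 * norm w * norm (trD k z x) \<le> 2 * norm w * (d * norm x)"
    by (intro mult_left_mono) auto
  then show ?thesis using norm_cscale_le[of w "trD k z x"] by linarith
qed

text \<open>Split \<open>x\<close> into a multiple of \<open>E\<close> and a part in the kernel of \<open>J\<close>. On that kernel \<open>1 - A\<close> is bounded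
  below, so the second part is controlled by \<open>y\<close> and \<open>\<bar>1 - z\<bar> \<bar>J x\<bar>\<close>. Applying \<open>J\<close> to the equation
  removes \<open>1 - A\<close> and leaves \<open>(1 - z) J (trD k z x) = J y\<close>, which determines \<open>J x\<close>; the factor
  \<open>J (trD k z E)\<close> is close to the mean return time.\<close>

lemma near_one_estimate:
  assumes k: "k \<ge> 1" and z: "z \<noteq> 1"
    and D: "norm (trD k z) \<le> d" "d \<ge> 1"
    and small: "32 * inverse_bound * d\<^sup>2 * norm e * norm (1 - z) \<le> 1"
    and pole: "norm (J (trD k z E) - mean_return k) \<le> 1/2"
    and eq: "x - trR k z x = y"
  shows "norm (1 - z) * norm (J x) \<le> 6 * norm y"
    and "norm (x - cscale (J x) E) \<le> (2 * inverse_bound + 48 * inverse_bound * d * norm e) * norm y"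
    and "norm (J x - J y / ((1 - z) * mean_return k))
           \<le> 6 * norm y * (norm (J (trD k z E) - mean_return k) / norm (1 - z))
              + d * ((2 * inverse_bound + 48 * inverse_bound * d * norm e) * norm y)"
proof -
  define m where "m = norm (1 - z)"
  define \<alpha> where "\<alpha> = J x"
  define xt where "xt = x - cscale \<alpha> E"
  define \<epsilon> where "\<epsilon> = J (trD k z E)"
  define c where "c = inverse_bound"
  define \<kappa> where "\<kappa> = norm e"
  have m: "m > 0" "norm (z - 1) = m" using z by (auto simp: m_def norm_minus_commute)
  have c: "c \<ge> 1" using inverse_bound by (simp add: c_def)
  have \<kappa>: "\<kappa> \<ge> 1" using norm_e_ge by (simp add: \<kappa>_def)
  have x: "x = xt + cscale \<alpha> E" by (simp add: xt_def)
  have Jxt: "J xt = 0" by (simp add: xt_def \<alpha>_def J_simps J_cscale J_E)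
  have small1: "32 * c * d * d * \<kappa> * m \<le> 1"
    using small by (simp add: m_def c_def \<kappa>_def power2_eq_square mult_ac)
  have small2: "4 * c * d * m \<le> 1"
  proof -
    have "1 * 1 \<le> d * \<kappa>" using D \<kappa> by (intro mult_mono) auto
    then have "(c * d * m) * 1 \<le> (c * d * m) * (d * \<kappa>)"
      using c D m by (intro mult_left_mono) auto
    moreover have "0 \<le> c * d * m * (d * \<kappa>)" using c D m \<kappa> by simp
    ultimately show ?thesis using small1 by (simp add: mult_ac)
  qed
  have eqt: "xt - A xt = y + cscale (z - 1) (trD k z x)"
    using eq unfolding trR_apply x
    by (simp add: blinfun.add_right complexify_cscale A_E algebra_simps)
  have nx: "norm x \<le> 2 * norm \<alpha> * \<kappa> + norm xt"
    using norm_triangle_ineq[of xt "cscale \<alpha> E"] norm_cscale_le[of \<alpha> E]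
    unfolding x[symmetric] \<kappa>_def norm_E by linarith
  have "norm xt \<le> c * (norm y + 2 * m * (d * norm x))"
  proof -
    have "norm (xt - A xt) \<le> norm y + 2 * m * (d * norm x)"
      unfolding eqt
      using norm_triangle_ineq[of y "cscale (z - 1) (trD k z x)"]
        norm_cscale_trD_le[OF D(1), of "z - 1" x] m by simp
    then have "c * norm (xt - A xt) \<le> c * (norm y + 2 * m * (d * norm x))"
      using c by (intro mult_left_mono) auto
    then show ?thesis using norm_le_inverse_bound[OF Jxt] by (simp add: c_def)
  qed
  also have "\<dots> = c * norm y + 2 * c * d * m * norm x" by (simp add: algebra_simps)
  also have "\<dots> \<le> c * norm y + 2 * c * d * m * (2 * norm \<alpha> * \<kappa> + norm xt)"
    using nx c D m by (intro add_left_mono mult_left_mono) auto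
  also have "\<dots> = c * norm y + 4 * c * d * \<kappa> * (m * norm \<alpha>) + (4 * c * d * m) * (norm xt / 2)"
    by (simp add: algebra_simps)
  also have "\<dots> \<le> c * norm y + 4 * c * d * \<kappa> * (m * norm \<alpha>) + 1 * (norm xt / 2)"
    using small2 by (intro add_left_mono mult_right_mono) auto
  finally have xt1: "norm xt \<le> 2 * c * norm y + 8 * c * d * \<kappa> * (m * norm \<alpha>)" by simp
  have JD: "norm (J (trD k z xt)) \<le> d * norm xt"
    using norm_J_le[of "trD k z xt"] norm_blinfun[of "trD k z" xt] mult_right_mono[OF D(1) norm_ge_zero[of xt]]
    by linarith
  have Jeq: "J y = (1 - z) * (\<alpha> * \<epsilon> + J (trD k z xt))"
  proof -
    have "J (xt - A xt) = J y + (z - 1) * J (trD k z x)" unfolding eqt by (simp add: J_simps J_cscale)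
    moreover have "J (xt - A xt) = 0" by (simp add: J_simps J_A)
    ultimately have 0: "J y + (z - 1) * J (trD k z x) = 0" by simp
    have "J y = (1 - z) * J (trD k z x) + (J y + (z - 1) * J (trD k z x))" by (simp add: algebra_simps)
    then have "J y = (1 - z) * J (trD k z x)" unfolding 0 by simp
    moreover have "J (trD k z x) = \<alpha> * \<epsilon> + J (trD k z xt)"
      unfolding x by (simp add: blinfun.add_right J_simps trD_cscale J_cscale \<epsilon>_def)
    ultimately show ?thesis by simp
  qed
  have \<epsilon>: "norm \<epsilon> \<ge> 1/2"
    using pole mean_return_ge_1[OF k] norm_triangle_ineq2[of "complex_of_real (mean_return k)" \<epsilon>]
    by (simp add: \<epsilon>_def norm_minus_commute)
  have "m * norm \<alpha> * (1/2) \<le> m * norm \<alpha> * norm \<epsilon>" using \<epsilon> m by (intro mult_left_mono) auto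
  also have "\<dots> = norm (J y - (1 - z) * J (trD k z xt))"
  proof -
    have "J y - (1 - z) * J (trD k z xt) = (1 - z) * \<alpha> * \<epsilon>" unfolding Jeq by (simp add: algebra_simps)
    then show ?thesis by (simp add: norm_mult m_def)
  qed
  also have "\<dots> \<le> norm y + m * (d * norm xt)"
    using norm_triangle_ineq4[of "J y" "(1 - z) * J (trD k z xt)"] norm_J_le[of y]
      mult_left_mono[OF JD, of m] m(1) unfolding norm_mult m_def[symmetric] by linarith
  also have "\<dots> \<le> norm y + m * (d * (2 * c * norm y + 8 * c * d * \<kappa> * (m * norm \<alpha>)))"
    using xt1 m D by (intro add_left_mono mult_left_mono) auto
  also have "\<dots> = norm y + (4 * c * d * m) * (norm y / 2) + (32 * c * d * d * \<kappa> * m) * (m * norm \<alpha> / 4)"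
    by (simp add: algebra_simps)
  also have "\<dots> \<le> norm y + 1 * (norm y / 2) + 1 * (m * norm \<alpha> / 4)"
    using small1 small2 m by (intro add_mono mult_right_mono order.refl) auto
  finally have m\<alpha>: "m * norm \<alpha> \<le> 6 * norm y" by simp
  then show "norm (1 - z) * norm (J x) \<le> 6 * norm y" by (simp add: m_def \<alpha>_def)
  have "8 * c * d * \<kappa> * (m * norm \<alpha>) \<le> 8 * c * d * \<kappa> * (6 * norm y)"
    using m\<alpha> c D \<kappa> by (intro mult_left_mono) auto
  with xt1 have xt2: "norm xt \<le> (2 * c + 48 * c * d * \<kappa>) * norm y" by (simp add: algebra_simps)
  then show "norm (x - cscale (J x) E) \<le> (2 * inverse_bound + 48 * inverse_bound * d * norm e) * norm y"
    by (simp add: xt_def \<alpha>_def c_def \<kappa>_def)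
  have p: "mean_return k \<ge> 1" by (rule mean_return_ge_1[OF k])
  have "J x - J y / ((1 - z) * mean_return k) = (\<alpha> * (complex_of_real (mean_return k) - \<epsilon>) - J (trD k z xt)) / mean_return k"
    unfolding Jeq \<alpha>_def[symmetric] using z p by (simp add: field_simps)
  also have "norm \<dots> = norm (\<alpha> * (complex_of_real (mean_return k) - \<epsilon>) - J (trD k z xt)) / mean_return k"
    using p by (simp add: norm_divide)
  also have "\<dots> \<le> norm (\<alpha> * (complex_of_real (mean_return k) - \<epsilon>) - J (trD k z xt))"
    using p mult_left_mono[OF p norm_ge_zero[of "\<alpha> * (complex_of_real (mean_return k) - \<epsilon>) - J (trD k z xt)"]]
    by (simp add: divide_le_eq)
  also have "\<dots> \<le> norm \<alpha> * norm (\<epsilon> - mean_return k) + d * norm xt"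
    using norm_triangle_ineq4[of "\<alpha> * (complex_of_real (mean_return k) - \<epsilon>)" "J (trD k z xt)"] JD
    by (simp add: norm_mult norm_minus_commute)
  also have "norm \<alpha> * norm (\<epsilon> - mean_return k) = (m * norm \<alpha>) * (norm (\<epsilon> - mean_return k) / m)"
    using m by simp
  also have "\<dots> \<le> 6 * norm y * (norm (\<epsilon> - mean_return k) / m)"
    using m\<alpha> m by (intro mult_right_mono) auto
  also have "d * norm xt \<le> d * ((2 * c + 48 * c * d * \<kappa>) * norm y)"
    using xt2 D by (intro mult_left_mono) auto
  finally show "norm (J x - J y / ((1 - z) * mean_return k))
           \<le> 6 * norm y * (norm (J (trD k z E) - mean_return k) / norm (1 - z))
              + d * ((2 * inverse_bound + 48 * inverse_bound * d * norm e) * norm y)"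
    by (simp add: \<epsilon>_def m_def c_def \<kappa>_def)
qed

text \<open>\<open>1 - trR k z\<close> is a rank one perturbation of the invertible \<open>1 - trR k z + P\<close>, so injectivity, which the
  preceding estimate provides, implies surjectivity.\<close>

lemma near_one_surj:
  assumes k: "k \<ge> 1" and z: "z \<noteq> 1"
    and D: "norm (trD k z) \<le> d" "d \<ge> 1"
    and small: "32 * inverse_bound * d\<^sup>2 * norm e * norm (1 - z) \<le> 1"
    and pole: "norm (J (trD k z E) - mean_return k) \<le> 1/2"
  shows "surj (blinfun_apply (id_blinfun - trR k z))"
proof -
  let ?M = "id_blinfun - trR k z + P"
  have "1 * 1 \<le> d * norm e" using D norm_e_ge by (intro mult_mono) auto
  then have "(inverse_bound * d * norm (1 - z)) * 1 \<le> (inverse_bound * d * norm (1 - z)) * (d * norm e)"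
    using inverse_bound D by (intro mult_left_mono) auto
  moreover have "0 \<le> inverse_bound * d * norm (1 - z) * (d * norm e)" using inverse_bound D by simp
  ultimately have small2: "4 * inverse_bound * d * norm (1 - z) \<le> 1"
    using small by (simp add: mult_ac power2_eq_square)
  have "norm (?M - (id_blinfun - A + P)) \<le> 2 * norm (1 - z) * d"
  proof (rule norm_blinfun_bound)
    fix x
    have "(?M - (id_blinfun - A + P)) x = - cscale (z - 1) (trD k z x)"
      by (simp add: blinfun.diff_left blinfun.add_left trR_apply)
    then show "norm ((?M - (id_blinfun - A + P)) x) \<le> 2 * norm (1 - z) * d * norm x"
      using norm_cscale_trD_le[OF D(1), of "z - 1" x] by (simp add: norm_minus_commute mult_ac)
  qed (use D in simp)
  then have "inverse_bound * norm (?M - (id_blinfun - A + P)) \<le> inverse_bound * (2 * norm (1 - z) * d)"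
    using inverse_bound by (intro mult_left_mono) auto
  also have "\<dots> \<le> 1/2" using small2 by (simp add: mult_ac)
  finally have "invertible_within ?M (2 * inverse_bound)"
    using inverse_bound by (intro invertible_within_perturb[OF inverse_bound(2)]) auto
  then obtain g where g: "\<And>y. ?M (g y) = y" by (metis invertible_within_def surj_def)
  have Mx: "?M x = x - trR k z x + cscale (J x) E" for x
    by (simp add: blinfun.diff_left blinfun.add_left P_apply)
  \<comment> \<open>A solution of \<open>M x = E\<close> with \<open>J x = 1\<close> would be a fixed vector of the truncated operator.\<close>
  have J1: "J (g E) \<noteq> 1"
  proof
    assume J: "J (g E) = 1"
    have "g E - trR k z (g E) = 0" using g[of E] unfolding Mx J by simp
    from near_one_estimate(1)[OF k z D small pole this] show False using J z by simp
  qed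
  show ?thesis unfolding surj_def
  proof
    fix y
    define \<beta> where "\<beta> = J (g y) / (1 - J (g E))"
    define x where "x = g y + cscale \<beta> (g E)"
    have \<beta>: "J (g y) + \<beta> * J (g E) = \<beta>" using J1 by (simp add: \<beta>_def field_simps)
    have "x - trR k z x = (g y - trR k z (g y)) + cscale \<beta> (g E - trR k z (g E))"
      by (simp add: x_def blinfun.add_right blinfun.diff_right trR_cscale)
    also have "g y - trR k z (g y) = y - cscale (J (g y)) E" using g[of y] unfolding Mx by (simp add: algebra_simps)
    also have "g E - trR k z (g E) = E - cscale (J (g E)) E" using g[of E] unfolding Mx by (simp add: algebra_simps)
    also have "y - cscale (J (g y)) E + cscale \<beta> (E - cscale (J (g E)) E)
        = y + cscale (\<beta> - (J (g y) + \<beta> * J (g E))) E"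
      by (simp only: blinfun.diff_right cscale_mult cscale_diff_left cscale_add_left) (simp only: algebra_simps)
    also have "\<dots> = y" unfolding \<beta> by simp
    finally have "(id_blinfun - trR k z) x = y" by (simp add: blinfun.diff_left)
    then show "\<exists>x. y = (id_blinfun - trR k z) x" by metis
  qed
qed

end

section \<open>Uniform control of the truncated resolvent\<close>

text \<open>Adds the height dependence of the radius \<open>exp (a k)\<close>. A nonzero tail forces \<open>a k \<rightarrow> 0\<close> and keeps
  \<open>S\<^sub>q(k, a k)\<close> away from zero, so that bounded terms can be absorbed into it.\<close>

locale truncation_rate = renewal_operators Rn I e
  for Rn :: "nat \<Rightarrow> 'b::banach \<Rightarrow>\<^sub>L 'b" and I :: "'b \<Rightarrow> real" and e :: 'b +
  fixes a :: "nat \<Rightarrow> real" and p :: real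
  assumes a_pos: "\<And>k. 1 \<le> k \<Longrightarrow> 0 < a k"
    and p: "0 < p" "p \<le> 1"
    and a_lim: "(\<lambda>k. a k powr p * S_sum Rn p k (a k)) \<longlonglongrightarrow> 0"
    and tail_pos: "0 < tail_norm Rn 1"
begin

lemma tail_le_S_sum:
  assumes "1 \<le> k" shows "r 1 \<le> S_sum Rn q k (a k)"
proof -
  have "r 1 * 1 \<le> r 1 * exp (a k)"
    using a_pos[OF assms] tail_pos by (intro mult_left_mono) auto
  then show ?thesis using S_sum_term_le[of 1 k q "a k"] assms by simp
qed

lemma eventually_a_le:
  assumes "\<epsilon> > 0" shows "\<forall>\<^sub>F k in sequentially. a k \<le> \<epsilon>"
proof -
  have "\<forall>\<^sub>F k in sequentially. a k powr p * S_sum Rn p k (a k) < r 1 * \<epsilon> powr p"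
    using a_lim tail_pos assms by (intro order_tendstoD(2)) auto
  then show ?thesis using eventually_ge_at_top[of 1]
  proof eventually_elim
    case (elim k)
    show ?case
    proof (rule ccontr)
      assume "\<not> a k \<le> \<epsilon>"
      then have "\<epsilon> powr p \<le> a k powr p" using assms p by (intro powr_mono2) auto
      then have "\<epsilon> powr p * r 1 \<le> a k powr p * S_sum Rn p k (a k)"
        using tail_le_S_sum[OF elim(2)] tail_pos by (intro mult_mono) auto
      with elim show False by (simp add: mult.commute)
    qed
  qed
qed

lemma eventually_exp_excess_le:
  assumes "\<epsilon> > 0"
  shows "\<forall>\<^sub>F k in sequentially. (\<Sum>j<k. r j * (exp (real j * a k) - 1)) \<le> \<epsilon>"
proof -
  have "\<forall>\<^sub>F k in sequentially. a k powr p * S_sum Rn p k (a k) < \<epsilon>"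
    using a_lim assms by (intro order_tendstoD(2)) auto
  then show ?thesis using eventually_ge_at_top[of 1]
  proof eventually_elim
    case (elim k)
    show ?case using exp_excess_le[OF a_pos[OF elim(2)] p, of k] elim(1) by linarith
  qed
qed

text \<open>Bounds the operators \<open>trD k z\<close> on the disc of radius \<open>exp (a k)\<close> for large \<open>k\<close>; the factor \<open>2\<close> comes from
  the product norm on the complexification.\<close>

definition dbound :: real where "dbound = 2 * (suminf r + 1)"

lemma dbound_ge_1: "dbound \<ge> 1"
  using suminf_nonneg[OF summable_tail_norm] tail_norm_nonneg by (simp add: dbound_def)

lemma eventually_weighted_tail_le:
  "\<forall>\<^sub>F k in sequentially. 2 * (\<Sum>j<k. r j * exp (real j * a k)) \<le> dbound"
  using eventually_exp_excess_le[of 1, OF zero_less_one]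
proof eventually_elim
  case (elim k)
  have "(\<Sum>j<k. r j * exp (real j * a k)) = (\<Sum>j<k. r j * (exp (real j * a k) - 1)) + (\<Sum>j<k. r j)"
    by (simp add: right_diff_distrib sum_subtractf)
  also have "(\<Sum>j<k. r j) \<le> suminf r"
    using summable_tail_norm tail_norm_nonneg by (intro sum_le_suminf) auto
  finally show ?case using elim by (simp add: dbound_def)
qed

lemma eventually_norm_trD_le:
  "\<forall>\<^sub>F k in sequentially. \<forall>z. norm z \<le> exp (a k) \<longrightarrow> norm (trD k z) \<le> dbound"
  using eventually_weighted_tail_le by eventually_elim (auto intro: order.trans[OF norm_trD_le])

lemma pole_coefficient_diff_le:
  "norm (J (trD k z E) - mean_return k) \<le> norm e * (\<Sum>j<k. r j * norm (z ^ j - 1))"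
proof -
  have "J (trD k z E) = (\<Sum>j<k. z ^ j * I (Rt j e))"
    by (simp add: trD_apply linear_sum[OF bounded_linear.linear[OF J_linear]] J_cscale
        complex_functional_complexify)
       (simp add: complex_functional_def linear_simps[OF I_linear] complex_of_real_def blinfun.zero_right)
  then have "J (trD k z E) - mean_return k = (\<Sum>j<k. (z ^ j - 1) * I (Rt j e))"
    by (simp add: mean_return_def sum_subtractf left_diff_distrib)
  also have "norm \<dots> \<le> (\<Sum>j<k. norm e * (r j * norm (z ^ j - 1)))"
  proof (intro sum_norm_le)
    fix j
    have "\<bar>I (Rt j e)\<bar> \<le> r j * norm e"
      using I_le[of "Rt j e"] norm_blinfun[of "Rt j" e] mult_right_mono[OF norm_tail_op_le[of j] norm_ge_zero[of e]]
      by linarith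
    then have "norm (z ^ j - 1) * \<bar>I (Rt j e)\<bar> \<le> norm (z ^ j - 1) * (r j * norm e)"
      by (intro mult_left_mono) auto
    then show "norm ((z ^ j - 1) * I (Rt j e)) \<le> norm e * (r j * norm (z ^ j - 1))"
      by (simp add: norm_mult mult_ac)
  qed
  finally show ?thesis by (simp add: sum_distrib_left)
qed

lemma pole_coefficient_diff_powr_le:
  assumes "0 < q" "q \<le> 1" "norm z \<le> exp (a k)" "k \<ge> 1"
  shows "norm (J (trD k z E) - mean_return k) \<le> 2 * norm e * norm (z - 1) powr q * S_sum Rn q k (a k)"
proof -
  have "(\<Sum>j<k. r j * norm (z ^ j - 1))
      \<le> (\<Sum>j<k. r j * (2 * (norm (z - 1) powr q * (real j powr q * exp (real j * a k)))))"
    using norm_power_diff_one_le[OF assms(1,2,3)] a_pos[OF assms(4)] tail_norm_nonneg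
    by (intro sum_mono mult_left_mono) auto
  also have "\<dots> = 2 * norm (z - 1) powr q * (\<Sum>j<k. r j * (real j powr q * exp (real j * a k)))"
    by (simp add: sum_distrib_left mult_ac)
  also have "\<dots> \<le> 2 * norm (z - 1) powr q * S_sum Rn q k (a k)"
    using weighted_tail_le_S_sum assms by (intro mult_left_mono) auto
  finally have "norm e * (\<Sum>j<k. r j * norm (z ^ j - 1))
      \<le> norm e * (2 * norm (z - 1) powr q * S_sum Rn q k (a k))"
    by (rule mult_left_mono) simp
  then show ?thesis using pole_coefficient_diff_le[of k z] by (simp add: mult_ac)
qed

text \<open>The neighbourhood of \<open>1\<close> must not depend on \<open>k\<close>, so a bound by \<open>S\<^sub>q(k, a k)\<close>, which may grow with
  \<open>k\<close>, does not suffice; the sum is split at an index beyond which the tails are small.\<close>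

lemma pole_coefficient_near:
  obtains \<delta> where "\<delta> > 0"
    "\<forall>\<^sub>F k in sequentially. \<forall>z. norm z \<le> exp (a k) \<longrightarrow> norm (1 - z) \<le> \<delta> \<longrightarrow>
       norm (J (trD k z E) - mean_return k) \<le> 1/2"
proof -
  define \<epsilon> where "\<epsilon> = 1 / (8 * norm e)"
  have \<epsilon>: "\<epsilon> > 0" "norm e * \<epsilon> = 1/8" using norm_e_ge by (auto simp: \<epsilon>_def)
  \<comment> \<open>The terms with \<open>j \<ge> n\<close> are small because the tails are summable, the others by continuity.\<close>
  obtain n where n: "(\<Sum>j. r (j + n)) < \<epsilon>"
    using suminf_exist_split[OF \<epsilon>(1) summable_tail_norm] suminf_nonneg[OF summable_ignore_initial_segment[OF summable_tail_norm]]
      tail_norm_nonneg by (metis abs_of_nonneg order_refl real_norm_def)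
  define L where "L = (\<Sum>j<n. r j * (real j * 2 ^ j)) + 1"
  have L: "L > 0" unfolding L_def using tail_norm_nonneg by (intro add_nonneg_pos sum_nonneg) auto
  show ?thesis
  proof (rule that[of "\<epsilon> / L"])
    show "\<epsilon> / L > 0" using \<epsilon> L by simp
    have "\<forall>\<^sub>F k in sequentially. a k \<le> ln 2" by (rule eventually_a_le) simp
    then show "\<forall>\<^sub>F k in sequentially. \<forall>z. norm z \<le> exp (a k) \<longrightarrow> norm (1 - z) \<le> \<epsilon> / L \<longrightarrow>
       norm (J (trD k z E) - mean_return k) \<le> 1/2"
      using eventually_exp_excess_le[OF \<epsilon>(1)] eventually_ge_at_top[of 1]
    proof eventually_elim
      case (elim k)
      show ?case
      proof (intro allI impI)
        fix z :: complex assume z: "norm z \<le> exp (a k)" "norm (1 - z) \<le> \<epsilon> / L"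
        have z2: "norm z \<le> 2" using z elim by (metis exp_le_cancel_iff exp_ln order.trans zero_less_numeral)
        have ak: "a k > 0" using a_pos elim by simp
        have low: "norm (z ^ j - 1) \<le> norm (1 - z) * (real j * 2 ^ j)" for j
        proof -
          have "norm (\<Sum>i<j. z ^ i) \<le> (\<Sum>i<j. 2 ^ j)"
          proof (intro sum_norm_le)
            fix i assume "i \<in> {..<j}"
            then have "(2::real) ^ i \<le> 2 ^ j" by (intro power_increasing) auto
            then show "norm (z ^ i) \<le> 2 ^ j"
              using power_mono[OF z2 norm_ge_zero, of i] unfolding norm_power by linarith
          qed
          then show ?thesis unfolding power_diff_1_eq norm_mult norm_minus_commute[of 1 z]
            by (intro mult_left_mono) auto
        qed
        have high: "norm (z ^ j - 1) \<le> (exp (real j * a k) - 1) + 2" for j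
        proof -
          have "norm (z ^ j) \<le> exp (real j * a k)"
            using power_mono[OF z(1) norm_ge_zero, of j] by (simp add: norm_power exp_of_nat_mult)
          then show ?thesis using norm_triangle_ineq4[of "z ^ j" 1] by simp
        qed
        have "(\<Sum>j<k. r j * norm (z ^ j - 1))
            \<le> (\<Sum>j<k. r j * (exp (real j * a k) - 1)
                + ((if j < n then norm (1 - z) * (r j * (real j * 2 ^ j)) else 0)
                + (if n \<le> j then 2 * r j else 0)))"
        proof (intro sum_mono)
          fix j
          have nn: "0 \<le> r j * (exp (real j * a k) - 1)" using tail_norm_nonneg[of j] ak by simp
          show "r j * norm (z ^ j - 1) \<le> r j * (exp (real j * a k) - 1)
                + ((if j < n then norm (1 - z) * (r j * (real j * 2 ^ j)) else 0)
                + (if n \<le> j then 2 * r j else 0))"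
          proof (cases "j < n")
            case True
            have "r j * norm (z ^ j - 1) \<le> r j * (norm (1 - z) * (real j * 2 ^ j))"
              by (rule mult_left_mono[OF low tail_norm_nonneg])
            then show ?thesis using nn True by (simp add: mult_ac)
          next
            case False
            have "r j * norm (z ^ j - 1) \<le> r j * ((exp (real j * a k) - 1) + 2)"
              by (rule mult_left_mono[OF high tail_norm_nonneg])
            then show ?thesis using False by (simp add: algebra_simps)
          qed
        qed
        also have "\<dots> = (\<Sum>j<k. r j * (exp (real j * a k) - 1))
            + ((\<Sum>j<k. if j < n then norm (1 - z) * (r j * (real j * 2 ^ j)) else 0)
             + (\<Sum>j<k. if n \<le> j then 2 * r j else 0))"
          by (simp add: sum.distrib)
        also have "(\<Sum>j<k. r j * (exp (real j * a k) - 1)) \<le> \<epsilon>" by (rule elim)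
        also have "(\<Sum>j<k. if j < n then norm (1 - z) * (r j * (real j * 2 ^ j)) else 0) \<le> \<epsilon>"
        proof -
          have "(\<Sum>j<k. if j < n then norm (1 - z) * (r j * (real j * 2 ^ j)) else 0)
             = (\<Sum>j\<in>{j\<in>{..<k}. j < n}. norm (1 - z) * (r j * (real j * 2 ^ j)))"
            by (rule sum.inter_filter[symmetric]) simp
          also have "\<dots> \<le> (\<Sum>j<n. norm (1 - z) * (r j * (real j * 2 ^ j)))"
            using tail_norm_nonneg by (intro sum_mono2) auto
          also have "\<dots> \<le> norm (1 - z) * L" by (simp add: L_def sum_distrib_left algebra_simps)
          also have "\<dots> \<le> \<epsilon>" using z(2) L by (simp add: field_simps)
          finally show ?thesis .
        qed
        also have "(\<Sum>j<k. if n \<le> j then 2 * r j else 0) \<le> 2 * \<epsilon>"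
        proof -
          have "(\<Sum>j<k. if n \<le> j then 2 * r j else 0) = (\<Sum>j\<in>{j\<in>{..<k}. n \<le> j}. 2 * r j)"
            by (rule sum.inter_filter[symmetric]) simp
          also have "{j\<in>{..<k}. n \<le> j} = {n..<k}" by auto
          also have "(\<Sum>j\<in>{n..<k}. 2 * r j) = 2 * (\<Sum>j<k - n. r (j + n))"
            using sum.shift_bounds_nat_ivl[of r 0 n "k - n"]
            by (cases "n \<le> k") (simp_all add: atLeast0LessThan flip: sum_distrib_left)
          also have "\<dots> \<le> 2 * (\<Sum>j. r (j + n))"
            using tail_norm_nonneg summable_ignore_initial_segment[OF summable_tail_norm]
            by (intro mult_left_mono sum_le_suminf) auto
          finally show ?thesis using n by simp
        qed
        finally have "(\<Sum>j<k. r j * norm (z ^ j - 1)) \<le> 4 * \<epsilon>" by simp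
        then have "norm e * (\<Sum>j<k. r j * norm (z ^ j - 1)) \<le> norm e * (4 * \<epsilon>)"
          by (intro mult_left_mono) auto
        then show "norm (J (trD k z E) - mean_return k) \<le> 1/2"
          using pole_coefficient_diff_le[of k z] \<epsilon>(2) by linarith
      qed
    qed
  qed
qed

text \<open>Along a ray the coefficients change only by \<open>exp (j b) - 1\<close>. Together with \<open>exp_excess_le\<close> this
  transfers invertibility from the unit disc to the larger disc.\<close>

lemma trR_radial_diff_le:
  assumes z: "norm z \<le> exp b" "1 \<le> norm z" and b: "b \<ge> 0" and D: "norm (trD k z) \<le> d"
  shows "norm (trR k z - trR k (z / norm z))
     \<le> 2 * (exp b - 1) * d + 8 * (\<Sum>j<k. r j * (exp (real j * b) - 1))"
proof -
  define \<zeta> where "\<zeta> = z / norm z"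
  define \<rho> where "\<rho> = norm z"
  have \<rho>: "1 \<le> \<rho>" "\<rho> \<le> exp b" using z by (auto simp: \<rho>_def)
  have z\<zeta>: "z = \<rho> * \<zeta>" "norm \<zeta> = 1" using \<rho> by (auto simp: \<zeta>_def \<rho>_def norm_divide)
  have diff: "norm (z ^ j - \<zeta> ^ j) \<le> exp (real j * b) - 1" for j
  proof -
    have "z ^ j - \<zeta> ^ j = complex_of_real (\<rho> ^ j - 1) * \<zeta> ^ j"
      by (simp add: z\<zeta>(1) power_mult_distrib algebra_simps)
    then have "norm (z ^ j - \<zeta> ^ j) = \<bar>\<rho> ^ j - 1\<bar>" by (simp add: norm_mult norm_power z\<zeta> del: of_real_diff)
    also have "\<dots> = \<rho> ^ j - 1" using \<rho> by simp
    also have "\<rho> ^ j \<le> exp (real j * b)" using \<rho> power_mono[of \<rho> "exp b" j] by (simp add: exp_of_nat_mult)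
    finally show ?thesis by simp
  qed
  have DD: "norm (trD k z - trD k \<zeta>) \<le> 2 * (\<Sum>j<k. r j * (exp (real j * b) - 1))"
  proof -
    have "trD k z - trD k \<zeta> = (\<Sum>j<k. cscale (z ^ j - \<zeta> ^ j) o\<^sub>L complexify (Rt j))"
      by (intro blinfun_eqI)
         (simp add: blinfun.diff_left blinfun.sum_left trD_def cscale_diff_left sum_subtractf)
    also have "norm \<dots> \<le> (\<Sum>j<k. 2 * (r j * (exp (real j * b) - 1)))"
    proof (intro sum_norm_le)
      fix j
      have "norm (z ^ j - \<zeta> ^ j) * norm (Rt j) \<le> (exp (real j * b) - 1) * r j"
        using diff norm_tail_op_le b by (intro mult_mono) auto
      then show "norm (cscale (z ^ j - \<zeta> ^ j) o\<^sub>L complexify (Rt j)) \<le> 2 * (r j * (exp (real j * b) - 1))"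
        using norm_cscale_complexify_le[of "z ^ j - \<zeta> ^ j" "Rt j"] by (simp add: mult_ac)
    qed
    finally show ?thesis by (simp add: sum_distrib_left)
  qed
  show ?thesis
    unfolding \<zeta>_def[symmetric]
  proof (rule norm_blinfun_bound)
    fix x
    have "(trR k z - trR k \<zeta>) x = cscale (z - \<zeta>) (trD k z x) + cscale (\<zeta> - 1) ((trD k z - trD k \<zeta>) x)"
      by (simp add: trR_apply blinfun.diff_left blinfun.diff_right cscale_diff_left)
    moreover have "norm (cscale (z - \<zeta>) (trD k z x)) \<le> 2 * (exp b - 1) * d * norm x"
    proof -
      have "norm (z - \<zeta>) \<le> exp b - 1" using diff[of 1] by simp
      moreover have "d \<ge> 0" using D norm_ge_zero order.trans by blast
      ultimately have "norm (z - \<zeta>) * (d * norm x) \<le> (exp b - 1) * (d * norm x)"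
        by (intro mult_right_mono) auto
      then show ?thesis using norm_cscale_trD_le[OF D, of "z - \<zeta>" x] by (simp add: algebra_simps)
    qed
    moreover have "norm (cscale (\<zeta> - 1) ((trD k z - trD k \<zeta>) x))
        \<le> 8 * (\<Sum>j<k. r j * (exp (real j * b) - 1)) * norm x"
    proof -
      have "norm (\<zeta> - 1) \<le> 2" using norm_triangle_ineq4[of \<zeta> 1] z\<zeta> by simp
      moreover have "norm ((trD k z - trD k \<zeta>) x) \<le> 2 * (\<Sum>j<k. r j * (exp (real j * b) - 1)) * norm x"
        using norm_blinfun[of "trD k z - trD k \<zeta>" x] mult_right_mono[OF DD norm_ge_zero[of x]] by linarith
      ultimately have "norm (\<zeta> - 1) * norm ((trD k z - trD k \<zeta>) x)
          \<le> 2 * (2 * (\<Sum>j<k. r j * (exp (real j * b) - 1)) * norm x)"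
        by (intro mult_mono) auto
      then show ?thesis using norm_cscale_le[of "\<zeta> - 1" "(trD k z - trD k \<zeta>) x"] by simp
    qed
    ultimately show "norm ((trR k z - trR k \<zeta>) x)
        \<le> (2 * (exp b - 1) * d + 8 * (\<Sum>j<k. r j * (exp (real j * b) - 1))) * norm x"
      using norm_triangle_ineq[of "cscale (z - \<zeta>) (trD k z x)" "cscale (\<zeta> - 1) ((trD k z - trD k \<zeta>) x)"]
      by (simp add: algebra_simps)
  next
    have "d \<ge> 0" using D norm_ge_zero order.trans by blast
    then show "0 \<le> 2 * (exp b - 1) * d + 8 * (\<Sum>j<k. r j * (exp (real j * b) - 1))"
      using b tail_norm_nonneg by (intro add_nonneg_nonneg mult_nonneg_nonneg sum_nonneg) auto
  qed
qed

text \<open>The inverse of \<open>1 - R(z)\<close> is uniformly bounded on the closed unit disc without a ball around \<open>1\<close>, which is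
  compact; \<open>trR k z\<close> is a small perturbation of \<open>R\<close> at the nearest point of the closed unit disc.\<close>

lemma away_from_one:
  assumes "\<delta> > 0"
  obtains C where "C > 0"
    "\<forall>\<^sub>F k in sequentially. \<forall>z. norm z \<le> exp (a k) \<longrightarrow> \<delta> \<le> norm (1 - z) \<longrightarrow>
       invertible_within (id_blinfun - trR k z) C"
proof -
  let ?S = "cball 0 1 - ball (1::complex) (\<delta>/2)"
  have "compact ?S" by (intro compact_diff) auto
  moreover have "continuous_on ?S (\<lambda>z. id_blinfun - R_series Rn z)"
    by (intro continuous_intros continuous_on_subset[OF continuous_on_R_series]) auto
  moreover have "\<exists>c. invertible_within (id_blinfun - R_series Rn z) c" if "z \<in> ?S" for z
  proof -
    have "1 \<notin> spectrum (R_series Rn z)" using that assms by (intro resolvent) auto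
    moreover have "cscale 1 - R_series Rn z = id_blinfun - R_series Rn z"
      by (intro blinfun_eqI) (simp add: blinfun.diff_left)
    ultimately show ?thesis
      unfolding spectrum_def using invertible_within_left_right_inverse by auto
  qed
  ultimately obtain \<eta> C where \<eta>C: "\<eta> > 0" "C > 0"
      "\<And>z X. z \<in> ?S \<Longrightarrow> norm (X - (id_blinfun - R_series Rn z)) \<le> \<eta> \<Longrightarrow> invertible_within X C"
    by (rule invertible_within_compact) blast+
  define \<epsilon> where "\<epsilon> = min (\<delta>/2) (\<eta> / (8 * dbound))"
  have \<epsilon>: "\<epsilon> > 0" using assms \<eta>C dbound_ge_1 by (simp add: \<epsilon>_def)
  have "ln (1 + \<epsilon>) > 0" using \<epsilon> by simp
  have \<eta>32: "\<eta> / 32 > 0" using \<eta>C by simp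
  show ?thesis
  proof (rule that[OF \<eta>C(2)])
    have "(\<lambda>k. 4 * r (k - 1)) \<longlonglongrightarrow> 4 * 0"
      by (intro tendsto_mult_left filterlim_compose[OF tail_norm_tendsto_0] filterlim_minus_const_nat_at_top)
    then have "\<forall>\<^sub>F k in sequentially. 4 * r (k - 1) < \<eta> / 4"
      by (rule order_tendstoD(2)) (use \<eta>C in simp)
    then show "\<forall>\<^sub>F k in sequentially. \<forall>z. norm z \<le> exp (a k) \<longrightarrow> \<delta> \<le> norm (1 - z) \<longrightarrow>
       invertible_within (id_blinfun - trR k z) C"
      using eventually_a_le[OF \<open>ln (1 + \<epsilon>) > 0\<close>] eventually_exp_excess_le[OF \<eta>32]
        eventually_norm_trD_le eventually_ge_at_top[of 1]
    proof eventually_elim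
      case (elim k)
      show ?case
      proof (intro allI impI)
        fix z :: complex assume z: "norm z \<le> exp (a k)" "\<delta> \<le> norm (1 - z)"
        have ak: "a k > 0" using a_pos elim by simp
        have ea: "exp (a k) - 1 \<le> \<epsilon>"
        proof -
          have "exp (a k) \<le> exp (ln (1 + \<epsilon>))" using elim(2) by (simp only: exp_le_cancel_iff)
          then show ?thesis using \<epsilon> by simp
        qed
        \<comment> \<open>The nearest point of the closed unit disc.\<close>
        define \<zeta> where "\<zeta> = (if norm z \<le> 1 then z else z / norm z)"
        have "norm \<zeta> \<le> 1" by (auto simp: \<zeta>_def norm_divide)
        have dist: "norm (z - \<zeta>) \<le> \<epsilon>"
        proof (cases "norm z \<le> 1")
          case False
          then have z0: "z \<noteq> 0" by auto
          have "z - \<zeta> = complex_of_real (norm z - 1) * (z / norm z)"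
            using False z0 by (auto simp: \<zeta>_def field_simps)
          then have "norm (z - \<zeta>) = norm z - 1" using False z0 by (simp add: norm_mult norm_divide del: of_real_diff)
          then show ?thesis using z(1) ea by simp
        qed (use \<epsilon> in \<open>simp add: \<zeta>_def\<close>)
        have "\<zeta> \<in> ?S"
        proof -
          have "norm (1 - z) \<le> norm (1 - \<zeta>) + norm (\<zeta> - z)" by (rule norm_diff_triangle_le) auto
          then have "\<delta>/2 \<le> norm (1 - \<zeta>)" using dist z(2) by (simp add: \<epsilon>_def norm_minus_commute)
          then show ?thesis using \<open>norm \<zeta> \<le> 1\<close> by (simp add: dist_norm)
        qed
        moreover have "norm ((id_blinfun - trR k z) - (id_blinfun - R_series Rn \<zeta>)) \<le> \<eta>"
        proof -
          have 1: "norm (trR k \<zeta> - R_series Rn \<zeta>) \<le> \<eta> / 4"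
            using trR_near_R_series[OF \<open>norm \<zeta> \<le> 1\<close> elim(5)] elim(1) by simp
          have 2: "norm (trR k z - trR k \<zeta>) \<le> \<eta> / 2"
          proof (cases "norm z \<le> 1")
            case False
            have "norm (trR k z - trR k \<zeta>) \<le> 2 * (exp (a k) - 1) * dbound
                + 8 * (\<Sum>j<k. r j * (exp (real j * a k) - 1))"
              using trR_radial_diff_le[of z "a k" k dbound] False z elim(4) ak by (simp add: \<zeta>_def)
            also have "2 * (exp (a k) - 1) * dbound \<le> 2 * (\<eta> / (8 * dbound)) * dbound"
              using ea dbound_ge_1 by (intro mult_right_mono mult_left_mono) (auto simp: \<epsilon>_def)
            also have "\<dots> = \<eta> / 4" using dbound_ge_1 by simp
            finally show ?thesis using elim(3) by simp
          qed (use \<eta>C in \<open>simp add: \<zeta>_def\<close>)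
          have "(id_blinfun - trR k z) - (id_blinfun - R_series Rn \<zeta>)
              = - ((trR k z - trR k \<zeta>) + (trR k \<zeta> - R_series Rn \<zeta>))" by simp
          then have "norm ((id_blinfun - trR k z) - (id_blinfun - R_series Rn \<zeta>))
              = norm ((trR k z - trR k \<zeta>) + (trR k \<zeta> - R_series Rn \<zeta>))" by (simp only: norm_minus_cancel)
          also have "\<dots> \<le> norm (trR k z - trR k \<zeta>) + norm (trR k \<zeta> - R_series Rn \<zeta>)"
            by (rule norm_triangle_ineq)
          finally show ?thesis using 1 2 \<eta>C by linarith
        qed
        ultimately show "invertible_within (id_blinfun - trR k z) C" by (rule \<eta>C(3))
      qed
    qed
  qed
qed

definition resolvent_estimate :: "real \<Rightarrow> nat \<Rightarrow> bool" where
  "resolvent_estimate C k \<longleftrightarrow> (\<forall>z. norm z \<le> exp (a k) \<longrightarrow> z \<noteq> 1 \<longrightarrow>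
       (\<exists>c. invertible_within (id_blinfun - trR k z) c) \<and>
       (\<forall>q x. 0 < q \<longrightarrow> q \<le> 1 \<longrightarrow>
          norm (x - cscale (J (x - trR k z x) / ((1 - z) * mean_return k)) E)
            \<le> C * (norm (1 - z) powr (q - 1) * S_sum Rn q k (a k)) * norm (x - trR k z x)))"

theorem truncated_resolvent_expansion:
  obtains C where "C > 0"
    "\<forall>\<^sub>F k in sequentially. resolvent_estimate C k"
proof -
  obtain \<delta>1 where \<delta>1: "\<delta>1 > 0"
    "\<forall>\<^sub>F k in sequentially. \<forall>z. norm z \<le> exp (a k) \<longrightarrow> norm (1 - z) \<le> \<delta>1 \<longrightarrow>
       norm (J (trD k z E) - mean_return k) \<le> 1/2" by (rule pole_coefficient_near) blast
  define \<kappa> where "\<kappa> = norm e"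
  define d where "d = dbound"
  define b where "b = 32 * inverse_bound * d\<^sup>2 * \<kappa>"
  have pos: "\<kappa> \<ge> 1" "d \<ge> 1" "inverse_bound \<ge> 1" using norm_e_ge dbound_ge_1 inverse_bound by (auto simp: \<kappa>_def d_def)
  have b: "b > 0" using pos by (simp add: b_def)
  define \<delta> where "\<delta> = min \<delta>1 (1 / b)"
  have \<delta>: "\<delta> > 0" "\<delta> \<le> \<delta>1" "b * \<delta> \<le> 1"
    using \<delta>1 b mult_left_mono[of \<delta> "1 / b" b] by (auto simp: \<delta>_def)
  obtain C1 where C1: "C1 > 0"
    "\<forall>\<^sub>F k in sequentially. \<forall>z. norm z \<le> exp (a k) \<longrightarrow> \<delta> \<le> norm (1 - z) \<longrightarrow>
       invertible_within (id_blinfun - trR k z) C1"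
    by (rule away_from_one[OF \<delta>(1)]) blast
  define K where "K = 2 * inverse_bound + 48 * inverse_bound * d * \<kappa>"
  have K: "K > 0" unfolding K_def using pos by (intro add_pos_pos) auto
  define u where "u = 4 / r 1"
  have u: "u > 0" using tail_pos by (simp add: u_def)
  define C where "C = u * (C1 + 2 * \<kappa> / \<delta>) + (u * K + 2 * \<kappa> * (12 * \<kappa> + u * (d * K)))"
  have Cparts: "u * (C1 + 2 * \<kappa> / \<delta>) > 0" "u * K + 2 * \<kappa> * (12 * \<kappa> + u * (d * K)) > 0"
    using u C1 \<delta> pos K by (auto intro!: add_pos_pos mult_pos_pos)
  show ?thesis
  proof (rule that[of C])
    show "C > 0" using Cparts by (simp add: C_def)
    have "\<forall>\<^sub>F k in sequentially. a k \<le> ln 3" by (rule eventually_a_le) simp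
    then show "\<forall>\<^sub>F k in sequentially. resolvent_estimate C k"
      using \<delta>1(2) C1(2) eventually_norm_trD_le eventually_ge_at_top[of 1]
    proof eventually_elim
      case (elim k)
      have ak: "a k > 0" using a_pos elim by simp
      have mean_return: "mean_return k \<ge> 1" by (rule mean_return_ge_1[OF elim(5)])
      have e3: "exp (a k) \<le> 3" using elim(1) by (metis exp_le_cancel_iff exp_ln zero_less_numeral)
      show ?case
        unfolding resolvent_estimate_def
      proof (intro allI impI)
        fix z :: complex assume z: "norm z \<le> exp (a k)" "z \<noteq> 1"
        define m where "m = norm (1 - z)"
        have m: "m > 0" "m \<le> 4" using z e3 norm_triangle_ineq4[of 1 z] by (auto simp: m_def)
        define Q where "Q q = m powr (q - 1) * S_sum Rn q k (a k)" for q
        \<comment> \<open>Bounded terms are absorbed: \<open>\<bar>1 - z\<bar> \<le> 4\<close> and \<open>S\<^sub>q\<close> is at least its first tail.\<close>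
        have one_le: "1 \<le> u * Q q" if "0 < q" "q \<le> 1" for q
        proof -
          have "1/4 \<le> m powr (q - 1)"
          proof -
            have "(4::real) powr (-1) \<le> 4 powr (q - 1)" using that by (intro powr_mono) auto
            also have "\<dots> \<le> m powr (q - 1)" using that m by (intro powr_mono2') auto
            finally show ?thesis by (simp add: powr_minus)
          qed
          then have "1/4 * r 1 \<le> Q q"
            unfolding Q_def using tail_le_S_sum[OF elim(5)] tail_pos by (intro mult_mono) auto
          then have "u * (1/4 * r 1) \<le> u * Q q" using u by (intro mult_left_mono) auto
          moreover have "u * (1/4 * r 1) = 1" using tail_pos by (simp add: u_def)
          ultimately show ?thesis by simp
        qed
        show "(\<exists>c. invertible_within (id_blinfun - trR k z) c) \<and>
          (\<forall>q x. 0 < q \<longrightarrow> q \<le> 1 \<longrightarrow>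
          norm (x - cscale (J (x - trR k z x) / ((1 - z) * mean_return k)) E)
            \<le> C * (norm (1 - z) powr (q - 1) * S_sum Rn q k (a k)) * norm (x - trR k z x))"
        proof (cases "m \<le> \<delta>")
          case False
          then have inv: "invertible_within (id_blinfun - trR k z) C1"
            using elim(3) z by (simp add: m_def)
          have "norm (x - cscale (J (x - trR k z x) / ((1 - z) * mean_return k)) E)
            \<le> C * (norm (1 - z) powr (q - 1) * S_sum Rn q k (a k)) * norm (x - trR k z x)"
            if q: "0 < q" "q \<le> 1" for q x
          proof -
            define y where "y = x - trR k z x"
            have "norm x \<le> C1 * norm y" using inv
              unfolding invertible_within_def y_def blinfun.diff_left blinfun_apply_id_blinfun id_apply by blast
            moreover have "norm (cscale (J y / ((1 - z) * mean_return k)) E) \<le> 2 * \<kappa> / \<delta> * norm y"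
            proof -
              have "norm (J y / ((1 - z) * mean_return k)) = norm (J y) / (m * mean_return k)"
                using mean_return by (simp add: norm_divide norm_mult m_def)
              also have "\<dots> \<le> norm y / (\<delta> * 1)"
                using norm_J_le mean_return False \<delta> by (intro frac_le mult_mono mult_pos_pos) auto
              finally have "norm (J y / ((1 - z) * mean_return k)) * norm E \<le> norm y / \<delta> * norm E"
                by (intro mult_right_mono) auto
              moreover have "2 * \<kappa> / \<delta> * norm y = 2 * (norm y / \<delta> * norm E)"
                by (simp add: norm_E \<kappa>_def)
              ultimately show ?thesis using norm_cscale_le[of "J y / ((1 - z) * mean_return k)" E] by linarith
            qed
            ultimately have "norm (x - cscale (J y / ((1 - z) * mean_return k)) E) \<le> (C1 + 2 * \<kappa> / \<delta>) * norm y"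
              using norm_triangle_ineq4[of x "cscale (J y / ((1 - z) * mean_return k)) E"] by (simp add: algebra_simps)
            also have "\<dots> \<le> (C1 + 2 * \<kappa> / \<delta>) * norm y * (u * Q q)"
            proof -
              have "0 \<le> (C1 + 2 * \<kappa> / \<delta>) * norm y" using C1 \<delta> pos by simp
              from mult_left_mono[OF one_le[OF q] this] show ?thesis by simp
            qed
            also have "\<dots> = u * (C1 + 2 * \<kappa> / \<delta>) * (Q q * norm y)" by (simp add: mult_ac)
            also have "\<dots> \<le> C * (Q q * norm y)"
            proof (intro mult_right_mono)
              have "0 \<le> Q q" using one_le[OF q] u by (meson mult_pos_neg not_less order.trans zero_le_one linorder_not_le)
              then show "0 \<le> Q q * norm y" by simp
            qed (use Cparts in \<open>simp add: C_def\<close>)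
            finally show ?thesis by (simp add: Q_def m_def y_def mult.assoc)
          qed
          with inv show ?thesis by blast
        next
          case True
          have pole: "norm (J (trD k z E) - mean_return k) \<le> 1/2" using elim(2) z True \<delta> by (simp add: m_def)
          have D: "norm (trD k z) \<le> d" using elim(4) z by (simp add: d_def)
          have small: "32 * inverse_bound * d\<^sup>2 * norm e * norm (1 - z) \<le> 1"
            using mult_left_mono[OF True, of b] b \<delta>(3) by (simp add: b_def \<kappa>_def m_def)
          note est = near_one_estimate[OF elim(5) z(2) D pos(2) small pole refl]
          have surj: "surj (blinfun_apply (id_blinfun - trR k z))"
            by (rule near_one_surj[OF elim(5) z(2) D pos(2) small pole])
          have nE: "norm (cscale w E) \<le> 2 * \<kappa> * norm w" for w
            using norm_cscale_le[of w E] by (simp add: norm_E \<kappa>_def mult_ac)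
          have "norm x \<le> (K + 12 * \<kappa> / m) * norm (x - trR k z x)" for x
          proof -
            have "norm (J x) \<le> 6 * norm (x - trR k z x) / m"
              using est(1)[of x] m by (simp add: m_def field_simps)
            then have "2 * \<kappa> * norm (J x) \<le> 2 * \<kappa> * (6 * norm (x - trR k z x) / m)"
              using pos by (intro mult_left_mono) auto
            then show ?thesis
              using norm_triangle_ineq[of "x - cscale (J x) E" "cscale (J x) E"] est(2)[of x] nE[of "J x"]
              by (simp add: K_def \<kappa>_def algebra_simps)
          qed
          with surj have inv: "invertible_within (id_blinfun - trR k z) (K + 12 * \<kappa> / m)"
            by (simp add: invertible_within_def blinfun.diff_left)
          have "norm (x - cscale (J (x - trR k z x) / ((1 - z) * mean_return k)) E)
            \<le> C * (norm (1 - z) powr (q - 1) * S_sum Rn q k (a k)) * norm (x - trR k z x)"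
            if q: "0 < q" "q \<le> 1" for q x
          proof -
            define y where "y = x - trR k z x"
            define \<beta> where "\<beta> = J y / ((1 - z) * mean_return k)"
            have "norm (J (trD k z E) - mean_return k) / m \<le> 2 * \<kappa> * Q q"
            proof -
              have "norm (J (trD k z E) - mean_return k) / m \<le> 2 * \<kappa> * m powr q * S_sum Rn q k (a k) / m"
                using pole_coefficient_diff_powr_le[OF q z(1) elim(5)] m
                by (intro divide_right_mono) (auto simp: \<kappa>_def m_def norm_minus_commute)
              also have "\<dots> = 2 * \<kappa> * Q q" using m by (simp add: Q_def powr_diff)
              finally show ?thesis .
            qed
            then have "6 * norm y * (norm (J (trD k z E) - mean_return k) / m) \<le> 6 * norm y * (2 * \<kappa> * Q q)"
              by (intro mult_left_mono) auto
            then have "norm (J x - \<beta>) \<le> 6 * norm y * (2 * \<kappa> * Q q) + d * (K * norm y)"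
              using est(3)[of x] by (simp add: \<beta>_def y_def m_def K_def \<kappa>_def)
            then have "2 * \<kappa> * norm (J x - \<beta>) \<le> 2 * \<kappa> * (6 * norm y * (2 * \<kappa> * Q q) + d * (K * norm y))"
              using pos by (intro mult_left_mono) auto
            moreover have "norm (x - cscale \<beta> E) \<le> norm (x - cscale (J x) E) + norm (cscale (J x - \<beta>) E)"
              using norm_triangle_ineq[of "x - cscale (J x) E" "cscale (J x - \<beta>) E"]
              by (simp add: cscale_diff_left)
            moreover have "norm (x - cscale (J x) E) \<le> K * norm y"
              using est(2)[of x] by (simp only: K_def \<kappa>_def y_def)
            ultimately have "norm (x - cscale \<beta> E)
                \<le> K * norm y + 2 * \<kappa> * (6 * norm y * (2 * \<kappa> * Q q) + d * (K * norm y))"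
              using nE[of "J x - \<beta>"] by linarith
            also have "\<dots> = 2 * \<kappa> * (12 * \<kappa>) * (Q q * norm y) + (K + 2 * \<kappa> * (d * K)) * norm y * 1"
              by (simp add: algebra_simps)
            also have "\<dots> \<le> 2 * \<kappa> * (12 * \<kappa>) * (Q q * norm y) + (K + 2 * \<kappa> * (d * K)) * norm y * (u * Q q)"
              using one_le[OF q] K pos by (intro add_left_mono mult_left_mono) auto
            also have "\<dots> = (u * K + 2 * \<kappa> * (12 * \<kappa> + u * (d * K))) * (Q q * norm y)"
              by (simp add: algebra_simps)
            also have "\<dots> \<le> C * (Q q * norm y)"
            proof (intro mult_right_mono)
              have "0 \<le> Q q" using one_le[OF q] u by (meson mult_pos_neg not_less order.trans zero_le_one linorder_not_le)
              then show "0 \<le> Q q * norm y" by simp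
            qed (use Cparts in \<open>simp add: C_def\<close>)
            finally show ?thesis by (simp add: Q_def m_def y_def \<beta>_def mult.assoc)
          qed
          with inv show ?thesis by blast
        qed
      qed
    qed
  qed
qed

end

section \<open>Coefficients of a function with an integrable singularity\<close>

lemma sin_pi_ge_chord:
  assumes t: "0 \<le> t" "t \<le> (1::real)" shows "2 * min t (1 - t) \<le> sin (pi * t)"
proof -
  have "convex_on {0..pi} (\<lambda>x. - sin x)"
    by (rule f''_ge0_imp_convex[of _ _ "\<lambda>x. - cos x" "\<lambda>x. sin x"])
       (auto intro!: derivative_eq_intros sin_ge_zero)
  from convex_onD[OF this, of _ 0 "pi/2"]
  have chord: "u \<le> sin (u * (pi/2))" if "0 \<le> u" "u \<le> 1" for u
    using that by simp
  show ?thesis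
  proof (cases "t \<le> 1/2")
    case True
    then show ?thesis using chord[of "2 * t"] t by (simp add: mult.commute)
  next
    case False
    have "sin (pi * t) = sin (pi - pi * t)" by simp
    also have "pi - pi * t = 2 * (1 - t) * (pi/2)" by (simp add: algebra_simps)
    finally show ?thesis using chord[of "2 * (1 - t)"] t False by simp
  qed
qed

text \<open>On a circle of radius at least one, the distance to \<open>1\<close> is at least proportional to the angle,
  whatever the radius. Hence \<open>\<bar>1 - z\<bar>\<^bsup>q - 1\<^esup>\<close> is integrable uniformly over such circles.\<close>

lemma circle_distance_ge:
  fixes \<rho> :: real
  assumes "0 \<le> t" "t \<le> (1::real)" "1 \<le> \<rho>"
  shows "min t (1 - t) \<le> norm (1 - \<rho> * exp (2 * of_real pi * \<i> * of_real t))"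
proof -
  define u where "u = exp (2 * of_real pi * \<i> * of_real t)"
  have "u = exp (\<i> * of_real (2 * pi * t))" by (simp add: u_def mult_ac)
  then have u: "norm u = 1" "norm (u - 1) = 2 * \<bar>sin (pi * t)\<bar>"
    using dist_exp_i_1[of "2 * pi * t"] by simp_all
  \<comment> \<open>Moving radially from \<open>u\<close> to \<open>\<rho> u\<close> costs at most \<open>\<rho> - 1\<close>, which is also a lower bound.\<close>
  have "norm (\<rho> * u - u) = \<rho> - 1"
  proof -
    have "\<rho> * u - u = complex_of_real (\<rho> - 1) * u" by (simp add: algebra_simps)
    then show ?thesis using assms u by (simp add: norm_mult del: of_real_diff)
  qed
  moreover have "\<rho> - 1 \<le> norm (1 - \<rho> * u)"
    using norm_triangle_ineq2[of "\<rho> * u" 1] u assms by (simp add: norm_mult norm_minus_commute)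
  moreover have "norm (u - 1) \<le> norm (u - \<rho> * u) + norm (\<rho> * u - 1)"
    by (rule norm_diff_triangle_le) auto
  ultimately have "norm (u - 1) \<le> 2 * norm (1 - \<rho> * u)" by (simp add: norm_minus_commute)
  moreover have "0 \<le> min t (1 - t)" using assms by auto
  ultimately have "min t (1 - t) \<le> norm (1 - \<rho> * u)"
    using u(2) sin_pi_ge_chord[OF assms(1,2)] abs_ge_self[of "sin (pi * t)"]
    by argo
  then show ?thesis by (simp only: u_def)
qed

lemma integral_singular_weight:
  assumes "0 < q"
  shows "((\<lambda>t. t powr (q - 1) + (1 - t) powr (q - 1)) has_integral 2 / q) {0..1::real}"
proof -
  have 1: "((\<lambda>t. t powr (q - 1)) has_integral 1 / q) {0..1::real}"
    using has_integral_powr_from_0[of "q - 1" 1] assms by simp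
  have "((\<lambda>t. (- 1 *\<^sub>R t + 1) powr (q - 1)) has_integral (1 / \<bar>- 1\<bar> ^ DIM(real)) *\<^sub>R (1 / q))
      ((\<lambda>x. (1 / - 1) *\<^sub>R x + - ((1 / - 1) *\<^sub>R 1)) ` cbox 0 1)"
    using 1 by (intro has_integral_affinity) auto
  moreover have "(\<lambda>x. (1 / - 1) *\<^sub>R x + - ((1 / - 1) *\<^sub>R 1)) ` cbox 0 1 = {0..1::real}"
    using image_diff_atLeastAtMost[of 1 0 "1::real"] by simp
  ultimately have "((\<lambda>t. (1 - t) powr (q - 1)) has_integral 1 / q) {0..1::real}" by simp
  from has_integral_add[OF 1 this] show ?thesis by simp
qed

text \<open>The singularity is removable because \<open>(z - 1) g(z) \<rightarrow> 0\<close>. Cauchy's formula on circles of radius slightly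
  below \<open>\<rho>1\<close> then averages the bound, at the cost of the factor \<open>2 / q\<close> only.\<close>

lemma coefficient_bound_integrable_singularity:
  fixes g :: "complex \<Rightarrow> complex"
  assumes \<rho>1: "1 < \<rho>1" and q: "0 < q" "q \<le> 1"
    and holo: "g holomorphic_on ball 0 \<rho>1 - {1}"
    and bound: "\<And>z. norm z < \<rho>1 \<Longrightarrow> z \<noteq> 1 \<Longrightarrow> norm (g z) \<le> B * norm (1 - z) powr (q - 1)"
    and series: "\<And>z. norm z < 1 \<Longrightarrow> (\<lambda>n. c n * z ^ n) sums g z"
  shows "norm (c n) * \<rho>1 ^ n \<le> 2 / q * B"
proof -
  have B: "B \<ge> 0"
    using order.trans[OF norm_ge_zero bound[of 0]] \<rho>1 by simp
  have "((\<lambda>z. (z - 1) * g z) \<longlongrightarrow> 0) (at 1)"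
  proof (rule Lim_null_comparison)
    have "((\<lambda>z::complex. norm (1 - z)) \<longlongrightarrow> norm (1 - 1 :: complex)) (at 1)" by (intro tendsto_intros)
    then have "((\<lambda>z::complex. norm (1 - z)) \<longlongrightarrow> 0) (at 1)" by simp
    then have "((\<lambda>z::complex. norm (1 - z) powr q) \<longlongrightarrow> 0 powr q) (at 1)"
      using q by (intro tendsto_powr' tendsto_const) auto
    from tendsto_mult_left[OF this, of B] show "((\<lambda>z::complex. B * norm (1 - z) powr q) \<longlongrightarrow> 0) (at 1)" using q by simp
    have "\<forall>\<^sub>F z in at 1. z \<in> ball 0 \<rho>1 - {1::complex}"
      using \<rho>1 by (intro eventually_at_in_open) auto
    then show "\<forall>\<^sub>F z in at 1. norm ((z - 1) * g z) \<le> B * norm (1 - z) powr q"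
    proof eventually_elim
      case (elim z)
      then have "norm (z - 1) * norm (g z) \<le> norm (1 - z) * (B * norm (1 - z) powr (q - 1))"
        using bound[of z] by (intro mult_mono) (auto simp: norm_minus_commute)
      also have "\<dots> = B * norm (1 - z) powr q" using elim by (simp add: powr_diff)
      finally show ?case by (simp add: norm_mult)
    qed
  qed
  moreover have "1 \<in> interior (ball (0::complex) \<rho>1)" using \<rho>1 by simp
  ultimately obtain F where F: "F holomorphic_on ball 0 \<rho>1" "\<And>z. z \<in> ball 0 \<rho>1 - {1} \<Longrightarrow> F z = g z"
    using holomorphic_on_extend_lim[OF holo] by blast
  have "F has_fps_expansion Abs_fps c"
  proof (rule has_fps_expansionI)
    have "\<forall>\<^sub>F u in nhds 0. u \<in> ball (0::complex) 1" by (intro eventually_nhds_in_open) auto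
    then show "\<forall>\<^sub>F u in nhds 0. (\<lambda>n. fps_nth (Abs_fps c) n * u ^ n) sums F u"
    proof eventually_elim
      case (elim u)
      then have "F u = g u" using \<rho>1 by (intro F(2)) auto
      then show ?case using series[of u] elim by simp
    qed
  qed
  then have c: "c n = (deriv ^^ n) F 0 / fact n" using fps_nth_fps_expansion by fastforce
  have est: "norm (c n) * \<rho> ^ n \<le> 2 / q * B" if \<rho>: "1 < \<rho>" "\<rho> < \<rho>1" for \<rho>
  proof -
    let ?e = "\<lambda>x. exp (2 * of_real pi * \<i> * complex_of_real x)"
    have "continuous_on (cball 0 \<rho>) F" "F holomorphic_on ball 0 \<rho>"
      using \<rho> by (auto intro!: holomorphic_on_imp_continuous_on intro: holomorphic_on_subset[OF F(1)])
    then have "((\<lambda>u. F u / (u - 0) ^ Suc n) has_contour_integral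
        2 * pi * \<i> / fact n * (deriv ^^ n) F 0) (circlepath 0 \<rho>)"
      using \<rho> by (intro Cauchy_has_contour_integral_higher_derivative_circlepath) auto
    then have "((\<lambda>x. F (\<rho> * ?e x) / (\<rho> * ?e x) ^ Suc n * (2 * pi * \<i> * \<rho> * ?e x))
        has_integral 2 * pi * \<i> * c n) {0<..<1}"
      unfolding has_contour_integral vector_derivative_circlepath has_integral_Icc_iff_Ioo c
      by (simp add: circlepath)
    then have int: "((\<lambda>x. F (\<rho> * ?e x) / (\<rho> * ?e x) ^ Suc n * (2 * pi * \<i> * \<rho> * ?e x))
        has_integral 2 * pi * \<i> * c n) {0<..<1}" (is "(?h has_integral _) _") .
    have int2: "((\<lambda>t. 2 * pi * B / \<rho> ^ n * (t powr (q - 1) + (1 - t) powr (q - 1)))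
        has_integral 2 * pi * B / \<rho> ^ n * (2 / q)) {0<..<1::real}"
      using has_integral_mult_right[OF integral_singular_weight[OF q(1)]]
      unfolding has_integral_Icc_iff_Ioo by blast
    have "norm (2 * pi * \<i> * c n) \<le> 2 * pi * B / \<rho> ^ n * (2 / q)"
      unfolding integral_unique[OF int, symmetric] integral_unique[OF int2, symmetric]
    proof (rule integral_norm_bound_integral)
      fix x :: real assume x: "x \<in> {0<..<1}"
      define z where "z = \<rho> * ?e x"
      have nz: "norm z = \<rho>" using \<rho> by (simp add: z_def norm_mult)
      have d: "min x (1 - x) \<le> norm (1 - z)" unfolding z_def using x \<rho> by (intro circle_distance_ge) auto
      have "min x (1 - x) > 0" using x by auto
      then have z1: "z \<noteq> 1" using d by auto
      have "norm (1 - z) powr (q - 1) \<le> min x (1 - x) powr (q - 1)"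
        using d x q by (intro powr_mono2') auto
      also have "\<dots> \<le> x powr (q - 1) + (1 - x) powr (q - 1)" by (auto simp: min_def)
      finally have w: "norm (1 - z) powr (q - 1) \<le> x powr (q - 1) + (1 - x) powr (q - 1)" .
      have "norm (F z) = norm (g z)" using F(2)[of z] nz \<rho> z1 by simp
      also have "\<dots> \<le> B * norm (1 - z) powr (q - 1)" using bound nz \<rho> z1 by simp
      also have "\<dots> \<le> B * (x powr (q - 1) + (1 - x) powr (q - 1))" using w B by (rule mult_left_mono)
      finally have Fz: "norm (F z) \<le> B * (x powr (q - 1) + (1 - x) powr (q - 1))" .
      have "norm (?h x) = norm (F z) * (2 * pi / \<rho> ^ n)"
        unfolding z_def[symmetric] using \<rho> nz
        by (simp add: norm_mult norm_divide norm_power field_simps)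
      also have "\<dots> \<le> B * (x powr (q - 1) + (1 - x) powr (q - 1)) * (2 * pi / \<rho> ^ n)"
        using Fz \<rho> by (intro mult_right_mono) auto
      finally show "norm (?h x) \<le> 2 * pi * B / \<rho> ^ n * (x powr (q - 1) + (1 - x) powr (q - 1))"
        by (simp add: mult_ac)
    qed (use int int2 in \<open>auto simp: integrable_on_def\<close>)
    then have "2 * pi * norm (c n) \<le> 2 * pi * (B / \<rho> ^ n * (2 / q))"
      by (simp add: norm_mult mult_ac)
    then have "norm (c n) \<le> B / \<rho> ^ n * (2 / q)"
      by (subst (asm) mult_le_cancel_left_pos) auto
    then have "norm (c n) * \<rho> ^ n \<le> B / \<rho> ^ n * (2 / q) * \<rho> ^ n"
      using \<rho> by (intro mult_right_mono) auto
    also have "\<dots> = 2 / q * B" using \<rho> by simp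
    finally show ?thesis .
  qed
  show ?thesis
  proof (rule tendsto_upperbound)
    show "((\<lambda>\<rho>. norm (c n) * \<rho> ^ n) \<longlongrightarrow> norm (c n) * \<rho>1 ^ n) (at_left \<rho>1)"
      by (intro tendsto_intros)
    have "\<forall>\<^sub>F \<rho> in at_left \<rho>1. \<rho> \<in> {1<..<\<rho>1}" using \<rho>1 by (rule eventually_at_left_real)
    then show "\<forall>\<^sub>F \<rho> in at_left \<rho>1. norm (c n) * \<rho> ^ n \<le> 2 / q * B"
      by eventually_elim (use est in auto)
  qed simp
qed

section \<open>Holomorphy of the resolvent and the renewal equation\<close>

lemma tendsto_solution:
  fixes X :: "complex \<Rightarrow> 'a::banach \<Rightarrow>\<^sub>L 'a"
  assumes inv: "invertible_within (X z) c" and X: "(X \<longlongrightarrow> X z) (at z)"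
    and v: "(v \<longlongrightarrow> v z) (at z)"
    and u: "\<forall>\<^sub>F w in at z. X w (u w) = v w" and uz: "X z (u z) = v z"
  shows "(u \<longlongrightarrow> u z) (at z)"
proof -
  define c' where "c' = max c 1"
  have c': "c' > 0" by (simp add: c'_def)
  have inv': "invertible_within (X z) c'"
    using inv by (rule invertible_within_mono) (simp add: c'_def)
  have "((\<lambda>w. norm (X w - X z)) \<longlongrightarrow> 0) (at z)"
    by (rule tendsto_norm_zero[OF LIM_zero[OF X]])
  then have "\<forall>\<^sub>F w in at z. norm (X w - X z) < 1 / (2 * c')"
    using c' by (intro order_tendstoD(2)[of _ 0]) auto
  then have "\<forall>\<^sub>F w in at z. norm (u w - u z) \<le> 2 * c' * norm (v w - X w (u z))"
    using u
  proof eventually_elim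
    case (elim w)
    have "c' * norm (X w - X z) \<le> 1/2" using elim(1) c' by (simp add: field_simps)
    then have "invertible_within (X w) (2 * c')"
      using c' by (intro invertible_within_perturb[OF inv']) auto
    then have "norm (u w - u z) \<le> 2 * c' * norm (X w (u w - u z))" by (auto simp: invertible_within_def)
    then show ?case by (simp add: blinfun.diff_right elim(2))
  qed
  moreover have "((\<lambda>w. 2 * c' * norm (v w - X w (u z))) \<longlongrightarrow> 0) (at z)"
  proof -
    have "((\<lambda>w. X w (u z)) \<longlongrightarrow> X z (u z)) (at z)"
      by (rule bounded_linear.tendsto[OF blinfun.bounded_linear_left X])
    from tendsto_diff[OF v this] have "((\<lambda>w. v w - X w (u z)) \<longlongrightarrow> 0) (at z)" by (simp add: uz)
    then show ?thesis by (intro tendsto_mult_right_zero tendsto_norm_zero)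
  qed
  ultimately have "((\<lambda>w. u w - u z) \<longlongrightarrow> 0) (at z)" by (rule Lim_null_comparison)
  then show ?thesis by (rule LIM_zero_cancel)
qed

lemma sums_shift_if:
  fixes f :: "nat \<Rightarrow> 'a::real_normed_vector"
  assumes "f sums s" shows "(\<lambda>n. if j \<le> n then f (n - j) else 0) sums s"
proof -
  let ?g = "\<lambda>n. if j \<le> n then f (n - j) else 0"
  have "(\<lambda>n. ?g (n + j)) sums s" using assms by simp
  then have "?g sums (s + (\<Sum>i<j. ?g i))" by (rule iffD1[OF sums_iff_shift])
  moreover have "(\<Sum>i<j. ?g i) = 0" by (intro sum.neutral) auto
  ultimately show ?thesis by simp
qed

context summable_tails
begin

definition solve :: "nat \<Rightarrow> complex \<Rightarrow> 'b \<times> 'b \<Rightarrow> 'b \<times> 'b" where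
  "solve k z = inv (blinfun_apply (id_blinfun - trR k z))"

lemma solve_eq:
  assumes "invertible_within (id_blinfun - trR k z) c"
  shows "solve k z x - trR k z (solve k z x) = x"
proof -
  have "surj (blinfun_apply (id_blinfun - trR k z))"
    using assms unfolding invertible_within_def by blast
  then have "(id_blinfun - trR k z) (solve k z x) = x"
    unfolding solve_def by (rule surj_f_inv_f)
  then show ?thesis unfolding blinfun.diff_left by simp
qed

lemma solve_unique:
  assumes "invertible_within (id_blinfun - trR k z) c" "y - trR k z y = x"
  shows "solve k z x = y"
proof (rule injD[OF invertible_within_inj[OF assms(1)]])
  show "(id_blinfun - trR k z) (solve k z x) = (id_blinfun - trR k z) y"
    unfolding blinfun.diff_left blinfun_apply_id_blinfun id_apply solve_eq[OF assms(1)] assms(2) ..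
qed

lemma solve_cscale:
  assumes "invertible_within (id_blinfun - trR k z) c"
  shows "solve k z (cscale w x) = cscale w (solve k z x)"
  by (rule solve_unique[OF assms])
     (simp only: trR_cscale blinfun.diff_right[symmetric] solve_eq[OF assms])

lemma solve_sum:
  assumes "invertible_within (id_blinfun - trR k z) c"
  shows "solve k z (\<Sum>j\<in>A. x j) = (\<Sum>j\<in>A. solve k z (x j))"
  by (rule solve_unique[OF assms])
     (simp only: blinfun.sum_right sum_subtractf[symmetric] solve_eq[OF assms])

lemma isCont_trR: "isCont (trR k) z"
  using continuous_on_trR[of UNIV k] by (simp add: continuous_on_eq_continuous_at)

lemma trR_diff:
  obtains Q where "\<And>w. trR k w y - trR k z y = cscale (w - z) (Q w)" "continuous_on UNIV Q"
proof
  let ?h = "\<lambda>j w. w ^ j + (z - 1) * (\<Sum>i<j. z ^ (j - Suc i) * w ^ i)"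
  have h: "(w - 1) * w ^ j - (z - 1) * z ^ j = (w - z) * ?h j w" for j and w :: complex
  proof -
    have "(w - 1) * w ^ j - (z - 1) * z ^ j = (w - z) * w ^ j + (z - 1) * (w ^ j - z ^ j)"
      by (simp add: algebra_simps)
    also have "w ^ j - z ^ j = (w - z) * (\<Sum>i<j. z ^ (j - Suc i) * w ^ i)" by (rule power_diff_sumr2)
    finally show ?thesis by (simp add: algebra_simps)
  qed
  show "trR k w y - trR k z y = cscale (w - z) (\<Sum>j<k. cscale (?h j w) (complexify (Rt j) y))" for w
  proof -
    have "trR k w y - trR k z y = (\<Sum>j<k. cscale ((w - 1) * w ^ j) (complexify (Rt j) y)
        - cscale ((z - 1) * z ^ j) (complexify (Rt j) y))"
      by (simp add: trR_apply trD_apply blinfun.sum_right cscale_mult sum_subtractf)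
    also have "\<dots> = (\<Sum>j<k. cscale (w - z) (cscale (?h j w) (complexify (Rt j) y)))"
      by (simp only: cscale_mult cscale_diff_left[symmetric] h)
    finally show ?thesis by (simp only: blinfun.sum_right)
  qed
  show "continuous_on UNIV (\<lambda>w. \<Sum>j<k. cscale (?h j w) (complexify (Rt j) y))"
    by (intro continuous_intros bounded_linear.continuous_on[OF bounded_linear_cscale])
qed

text \<open>The complexification is a real Banach space with a separate action of the complex numbers, so
  holomorphy is established after applying a functional, from the resolvent identity.\<close>

lemma solve_holomorphic:
  assumes "open U" and inv: "\<And>z. z \<in> U \<Longrightarrow> \<exists>c. invertible_within (id_blinfun - trR k z) c"
    and l: "bounded_linear l"
  shows "(\<lambda>z. complex_functional l (solve k z x)) holomorphic_on U"
proof -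
  have "\<exists>d. ((\<lambda>z. complex_functional l (solve k z x)) has_field_derivative d) (at z)" if z: "z \<in> U" for z
  proof -
    let ?S = "\<lambda>w. solve k w x"
    obtain Q where Q: "\<And>w. trR k w (?S z) - trR k z (?S z) = cscale (w - z) (Q w)" "continuous_on UNIV Q"
      by (rule trR_diff[of k "?S z" z]) blast
    \<comment> \<open>The resolvent identity turns the difference quotient into a continuous function.\<close>
    define u where "u w = solve k w (Q w)" for w
    have ev: "\<forall>\<^sub>F w in at z. w \<in> U" using assms(1) z by (intro eventually_at_in_open') auto
    have quot: "?S w - ?S z = cscale (w - z) (u w)" if w: "w \<in> U" for w
    proof -
      obtain c where c: "invertible_within (id_blinfun - trR k w) c" using inv[OF w] by blast
      obtain d where d: "invertible_within (id_blinfun - trR k z) d" using inv[OF z] by blast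
      have "solve k w (cscale (w - z) (Q w)) = ?S w - ?S z"
      proof (rule solve_unique[OF c])
        have "?S w - ?S z - trR k w (?S w - ?S z)
            = (?S w - trR k w (?S w)) - (?S z - trR k z (?S z)) + (trR k w (?S z) - trR k z (?S z))"
          by (simp add: blinfun.diff_right algebra_simps)
        also have "\<dots> = cscale (w - z) (Q w)" by (simp only: solve_eq[OF c] solve_eq[OF d] Q) simp
        finally show "?S w - ?S z - trR k w (?S w - ?S z) = cscale (w - z) (Q w)" .
      qed
      then show ?thesis by (simp add: u_def solve_cscale[OF c])
    qed
    obtain c where c: "invertible_within (id_blinfun - trR k z) c" using inv[OF z] by blast
    have sol: "(id_blinfun - trR k w) (u w) = Q w" if w: "w \<in> U" for w
    proof -
      obtain d where d: "invertible_within (id_blinfun - trR k w) d" using inv[OF w] by blast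
      show ?thesis unfolding u_def blinfun.diff_left blinfun_apply_id_blinfun id_apply by (rule solve_eq[OF d])
    qed
    have "(u \<longlongrightarrow> u z) (at z)"
    proof (rule tendsto_solution[where X = "\<lambda>w. id_blinfun - trR k w" and v = Q, OF c])
      show "((\<lambda>w. id_blinfun - trR k w) \<longlongrightarrow> id_blinfun - trR k z) (at z)"
        using isCont_trR[of z k] by (intro tendsto_intros) (simp add: isCont_def)
      show "(Q \<longlongrightarrow> Q z) (at z)"
        using Q(2) by (simp add: continuous_on_eq_continuous_at isCont_def)
      show "\<forall>\<^sub>F w in at z. (id_blinfun - trR k w) (u w) = Q w"
        using ev by eventually_elim (rule sol)
    qed (rule sol[OF z])
    then have lim: "((\<lambda>w. complex_functional l (u w)) \<longlongrightarrow> complex_functional l (u z)) (at z)"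
      by (rule bounded_linear.tendsto[OF bounded_linear_complex_functional[OF l]])
    have "((\<lambda>w. complex_functional l (?S w)) has_field_derivative complex_functional l (u z)) (at z)"
      unfolding has_field_derivative_iff
    proof (rule Lim_transform_eventually[OF lim])
      have "\<forall>\<^sub>F w in at z. w \<noteq> z" by (simp add: eventually_at_filter)
      with ev show "\<forall>\<^sub>F w in at z. complex_functional l (u w)
          = (complex_functional l (?S w) - complex_functional l (?S z)) / (w - z)"
      proof eventually_elim
        case (elim w)
        have "complex_functional l (?S w) - complex_functional l (?S z) = complex_functional l (?S w - ?S z)"
          by (simp add: linear_simps[OF bounded_linear_complex_functional[OF l]])
        also have "\<dots> = (w - z) * complex_functional l (u w)"
          by (simp add: quot[OF elim(1)] complex_functional_cscale[OF l])
        finally show ?case using elim(2) by simp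
      qed
    qed
    then show ?thesis by blast
  qed
  then show ?thesis
    using assms(1) by (auto simp: holomorphic_on_open)
qed

text \<open>The coefficients of \<open>trR\<close>: all returns at time \<open>k\<close> or later count as returns at time \<open>k\<close>.\<close>

definition trRn :: "nat \<Rightarrow> nat \<Rightarrow> 'b \<Rightarrow>\<^sub>L 'b" where
  "trRn k j = (if j < k then Rn j else Rt (k - 1))"

lemma trR_eq_sum_trRn:
  assumes "k \<ge> 1"
  shows "trR k z x = (\<Sum>j=1..k. cscale (z ^ j) (complexify (trRn k j) x))"
proof -
  have "{1..k} = insert k {1..<k}" using assms by auto
  moreover have "(\<Sum>j=1..<k. cscale (z ^ j) (complexify (trRn k j) x))
      = (\<Sum>j=1..<k. cscale (z ^ j) (complexify (Rn j) x))" by (intro sum.cong) (auto simp: trRn_def)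
  ultimately show ?thesis
    by (simp add: trR_eq_sum[OF assms] blinfun.add_left blinfun.sum_left trRn_def)
qed

text \<open>In terms of generating functions the renewal equation reads \<open>C(z) = W(z) + C(z) R\<^sub>k(z)\<close>. Boundedness of
  \<open>c\<close> makes the series converge in the unit disc.\<close>

lemma renewal_generating_function:
  assumes k: "k \<ge> 1" and z: "norm z < 1"
    and c: "\<And>n. bounded_linear (c n)" and cK: "\<And>n b. \<bar>c n b\<bar> \<le> K * norm b"
    and W: "\<And>n. bounded_linear (W n)"
    and renewal: "\<And>n b. c n b = (if n < k then W n b else 0) + (\<Sum>j=1..min n k. c (n - j) (trRn k j b))"
  shows "summable (\<lambda>n. z ^ n * complex_functional (c n) y)"
    and "(\<Sum>n. z ^ n * complex_functional (c n) (y - trR k z y)) = (\<Sum>l<k. z ^ l * complex_functional (W l) y)"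
proof -
  have summ: "summable (\<lambda>n. z ^ n * complex_functional (c n) y)" for y
  proof (rule summable_comparison_test)
    show "\<exists>N. \<forall>n\<ge>N. norm (z ^ n * complex_functional (c n) y) \<le> norm z ^ n * (K * norm y)"
      using norm_complex_functional_le[of "c _" K y] cK
      by (auto simp: norm_mult norm_power intro!: mult_left_mono)
    show "summable (\<lambda>n. norm z ^ n * (K * norm y))"
      using z by (intro summable_mult2 summable_geometric) auto
  qed
  then show "summable (\<lambda>n. z ^ n * complex_functional (c n) y)" .
  let ?C = "\<lambda>y. \<Sum>n. z ^ n * complex_functional (c n) y"
  note bl = bounded_linear_complex_functional[OF c]
  have sh: "(\<lambda>n. \<Sum>j=1..k. if j \<le> n then z ^ n * complex_functional (c (n - j)) (complexify (trRn k j) y) else 0)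
      sums (\<Sum>j=1..k. z ^ j * ?C (complexify (trRn k j) y))"
  proof (rule sums_sum)
    fix j
    have "(\<lambda>n. z ^ j * (z ^ n * complex_functional (c n) (complexify (trRn k j) y)))
        sums (z ^ j * ?C (complexify (trRn k j) y))"
      by (intro sums_mult summable_sums summ)
    from sums_shift_if[OF this, of j]
    show "(\<lambda>n. if j \<le> n then z ^ n * complex_functional (c (n - j)) (complexify (trRn k j) y) else 0)
        sums (z ^ j * ?C (complexify (trRn k j) y))"
      by (rule sums_cong[THEN iffD1, rotated]) (auto simp: mult.assoc[symmetric] simp flip: power_add)
  qed
  have "(\<lambda>n. if n < k then z ^ n * complex_functional (W n) y else 0) sums
      (\<Sum>n<k. if n < k then z ^ n * complex_functional (W n) y else 0)"
    by (rule sums_finite) auto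
  then have "(\<lambda>n. if n < k then z ^ n * complex_functional (W n) y else 0) sums
      (\<Sum>l<k. z ^ l * complex_functional (W l) y)" by simp
  from sums_add[OF this sh]
  have "(\<lambda>n. z ^ n * complex_functional (c n) y) sums
      ((\<Sum>l<k. z ^ l * complex_functional (W l) y) + (\<Sum>j=1..k. z ^ j * ?C (complexify (trRn k j) y)))"
  proof (rule sums_cong[THEN iffD1, rotated])
    fix n
    have "(\<Sum>j=1..k. if j \<le> n then z ^ n * complex_functional (c (n - j)) (complexify (trRn k j) y) else 0)
        = (\<Sum>j\<in>{j\<in>{1..k}. j \<le> n}. z ^ n * complex_functional (c (n - j)) (complexify (trRn k j) y))"
      by (rule sum.inter_filter[symmetric]) simp
    also have "{j\<in>{1..k}. j \<le> n} = {1..min n k}" by auto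
    finally show "(if n < k then z ^ n * complex_functional (W n) y else 0) +
        (\<Sum>j=1..k. if j \<le> n then z ^ n * complex_functional (c (n - j)) (complexify (trRn k j) y) else 0)
        = z ^ n * complex_functional (c n) y"
      by (simp add: complex_functional_def[of "c n"] renewal[of n "fst y"] renewal[of n "snd y"]
          complex_functional_def complexify.rep_eq complex_eq_iff sum_distrib_left algebra_simps)
         (simp add: sum.distrib sum_subtractf)
  qed
  from sums_unique[OF this, symmetric] have 1: "?C y = (\<Sum>l<k. z ^ l * complex_functional (W l) y)
      + (\<Sum>j=1..k. z ^ j * ?C (complexify (trRn k j) y))" .
  have C: "?C (u + v) = ?C u + ?C v" "?C (cscale w u) = w * ?C u" for u v w
  proof -
    show "?C (u + v) = ?C u + ?C v"
      unfolding suminf_add[OF summ summ] by (simp add: linear_simps[OF bl] algebra_simps)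
    show "?C (cscale w u) = w * ?C u"
      unfolding suminf_mult[OF summ, symmetric] by (simp add: complex_functional_cscale[OF c] mult_ac)
  qed
  have C0: "?C 0 = 0" using C(2)[of 0 0] by simp
  have Csum: "?C (\<Sum>j\<in>A. f j) = (\<Sum>j\<in>A. ?C (f j))" if "finite A" for A :: "nat set" and f
    using that by (induction A rule: finite_induct) (simp_all add: C C0 del: suminf_zero)
  have "?C (trR k z y) = (\<Sum>j=1..k. z ^ j * ?C (complexify (trRn k j) y))"
    unfolding trR_eq_sum_trRn[OF k] by (subst Csum) (simp_all only: C finite_atLeastAtMost)
  moreover have "?C y = ?C (y - trR k z y) + ?C (trR k z y)" using C(1)[of "y - trR k z y" "trR k z y"] by simp
  ultimately show "?C (y - trR k z y) = (\<Sum>l<k. z ^ l * complex_functional (W l) y)" using 1 by simp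
qed

end

context truncation_rate
begin

section \<open>Decay of renewal coefficients\<close>

text \<open>Why \<open>c\<close> and \<open>W\<close> are arbitrary: they depend on the observable \<open>w\<close>, and the constant must not. The bounds
  \<open>\<omega>0\<close> and \<open>\<omega>1\<close> are the only information on \<open>W\<close> that differs between the two cases of the main
  theorem. The sum over \<open>j\<close> is the coefficient of \<open>z\<^sup>n\<close> in \<open>C(z) V(z)\<close>.\<close>

definition renewal_estimate :: "real \<Rightarrow> real \<Rightarrow> nat \<Rightarrow> bool" where
  "renewal_estimate q C k \<longleftrightarrow> (\<forall>(W :: nat \<Rightarrow> 'b \<Rightarrow> real) b c K V \<omega>0 \<omega>1 n.
       (\<forall>l. bounded_linear (W l)) \<longrightarrow> (\<forall>n. bounded_linear (c n)) \<longrightarrow> (\<forall>n x. \<bar>c n x\<bar> \<le> K * norm x) \<longrightarrow>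
       (\<forall>n x. c n x = (if n < k then W n x else 0) + (\<Sum>j=1..min n k. c (n - j) (trRn k j x))) \<longrightarrow>
       (\<forall>x. (\<Sum>l<k. exp (real l * a k) * \<bar>W l x\<bar>) \<le> \<omega>0 * norm x) \<longrightarrow>
       (\<Sum>l<k. real l powr q * exp (real l * a k) * \<bar>W l e\<bar>) \<le> \<omega>1 \<longrightarrow>
       (\<forall>j<k. norm (b j) \<le> V * r j) \<longrightarrow> V \<ge> 0 \<longrightarrow> k \<le> Suc n \<longrightarrow>
       \<bar>(\<Sum>j<k. c (n - j) (b j)) - (\<Sum>j<k. I (b j)) * (\<Sum>l<k. W l e) / mean_return k\<bar>
         \<le> C * V * (\<omega>0 * S_sum Rn q k (a k) + \<omega>1) * exp (- real n * a k))"

text \<open>Inside the unit disc the generating function equals \<open>W(z) (1 - R\<^sub>k(z))\<inverse> V(z)\<close>, which continues to the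
  larger disc. Subtracting the pole leaves three errors: the remainder of the resolvent, and the
  differences \<open>V(z) - V(1)\<close> and \<open>W(z) - W(1)\<close> divided by \<open>1 - z\<close>.\<close>

theorem renewal_coefficient_decay:
  assumes q: "0 < q" "q \<le> 1"
  obtains C where "C > 0" "\<forall>\<^sub>F k in sequentially. renewal_estimate q C k"
proof -
  obtain C where C: "C > 0"
    "\<forall>\<^sub>F k in sequentially. resolvent_estimate C k"
    by (rule truncated_resolvent_expansion) blast
  define \<kappa> where "\<kappa> = norm e"
  have \<kappa>: "\<kappa> \<ge> 1" using norm_e_ge by (simp add: \<kappa>_def)
  define d where "d = dbound"
  have d: "d \<ge> 1" using dbound_ge_1 by (simp add: d_def)
  define C' where "C' = 2 * C * d + 2 * \<kappa> + 2 * d"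
  have C': "C' > 0" using C d \<kappa> by (simp add: C'_def add_nonneg_pos)
  show ?thesis
  proof (rule that[of "2 / q * C'"])
    show "2 / q * C' > 0" using q C' by simp
    show "\<forall>\<^sub>F k in sequentially. renewal_estimate q (2 / q * C') k"
      using C(2) eventually_weighted_tail_le eventually_ge_at_top[of 1]
    proof eventually_elim
      case (elim k)
      note res = elim(1)[unfolded resolvent_estimate_def] and wt = elim(2) and k = elim(3)
      have ak: "a k > 0" using a_pos k by simp
      define S where "S = S_sum Rn q k (a k)"
      have mean_return: "mean_return k \<ge> 1" by (rule mean_return_ge_1[OF k])
      show ?case
        unfolding renewal_estimate_def
      proof (intro allI impI)
        fix W c :: "nat \<Rightarrow> 'b \<Rightarrow> real" and b :: "nat \<Rightarrow> 'b" and K V \<omega>0 \<omega>1 n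
        assume W: "\<forall>l. bounded_linear (W l)" and cl: "\<forall>n. bounded_linear (c n)"
          and cK: "\<forall>n x. \<bar>c n x\<bar> \<le> K * norm x"
          and ren: "\<forall>n x. c n x = (if n < k then W n x else 0) + (\<Sum>j=1..min n k. c (n - j) (trRn k j x))"
          and \<omega>0: "\<forall>x. (\<Sum>l<k. exp (real l * a k) * \<bar>W l x\<bar>) \<le> \<omega>0 * norm x"
          and \<omega>1: "(\<Sum>l<k. real l powr q * exp (real l * a k) * \<bar>W l e\<bar>) \<le> \<omega>1"
          and b: "\<forall>j<k. norm (b j) \<le> V * r j" and V: "V \<ge> 0" and n: "k \<le> Suc n"
        let ?b = "\<lambda>j. (b j, 0 :: 'b)"
        let ?W = "\<lambda>l. complex_functional (W l)"
        let ?c = "\<lambda>n. complex_functional (c n)"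
        define Vz where "Vz z = (\<Sum>j<k. cscale (z ^ j) (?b j))" for z :: complex
        define Wz where "Wz z x = (\<Sum>l<k. z ^ l * ?W l x)" for z :: complex and x
        define V1 where "V1 = (\<Sum>j<k. I (b j))"
        define W1 where "W1 = (\<Sum>l<k. W l e)"
        have powz: "norm (z ^ j) \<le> exp (real j * a k)" if "norm z \<le> exp (a k)" for z :: complex and j
          using power_mono[OF that norm_ge_zero, of j] by (simp add: norm_power exp_of_nat_mult)
        have \<omega>0_nonneg: "\<omega>0 \<ge> 0"
        proof -
          have "0 \<le> (\<Sum>l<k. exp (real l * a k) * \<bar>W l e\<bar>)" by (intro sum_nonneg) auto
          also have "\<dots> \<le> \<omega>0 * norm e" using \<omega>0 by blast
          finally show ?thesis using norm_e_ge by (auto simp: zero_le_mult_iff)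
        qed
        have \<omega>1_nonneg: "\<omega>1 \<ge> 0" by (rule order.trans[OF _ \<omega>1]) (auto intro!: sum_nonneg)
        have S_nonneg: "S \<ge> 0"
          unfolding S_def S_sum_eq using tail_norm_nonneg by (intro sum_nonneg) auto
        have Wz_sum_le: "(\<Sum>l<k. exp (real l * a k) * norm (?W l x)) \<le> 2 * \<omega>0 * norm x" for x
        proof -
          have "(\<Sum>l<k. exp (real l * a k) * norm (?W l x))
              \<le> (\<Sum>l<k. exp (real l * a k) * \<bar>W l (fst x)\<bar> + exp (real l * a k) * \<bar>W l (snd x)\<bar>)"
            unfolding complex_functional_def distrib_left[symmetric]
            by (intro sum_mono mult_left_mono) (auto intro: order.trans[OF cmod_le])
          also have "\<dots> \<le> \<omega>0 * norm (fst x) + \<omega>0 * norm (snd x)"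
            unfolding sum.distrib using \<omega>0 by (intro add_mono) auto
          also have "\<dots> \<le> \<omega>0 * norm x + \<omega>0 * norm x"
            using \<omega>0_nonneg norm_fst_le[of "fst x" "snd x"] norm_snd_le[of "snd x" "fst x"]
            by (intro add_mono mult_left_mono) auto
          finally show ?thesis by simp
        qed
        have Wz_le: "norm (Wz z x) \<le> 2 * \<omega>0 * norm x" if "norm z \<le> exp (a k)" for z :: complex and x
        proof -
          have "norm (Wz z x) \<le> (\<Sum>l<k. exp (real l * a k) * norm (?W l x))"
            unfolding Wz_def by (intro sum_norm_le) (auto simp: norm_mult intro!: mult_right_mono powz[OF that])
          also have "\<dots> \<le> 2 * \<omega>0 * norm x" by (rule Wz_sum_le)
          finally show ?thesis .
        qed
        have WE: "?W l E = W l e" for l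
          using W by (simp add: complex_functional_def linear_simps complex_of_real_def)
        have Wz_E: "norm (Wz z E) \<le> \<omega>0 * \<kappa>" if "norm z \<le> exp (a k)" for z :: complex
        proof -
          have "norm (Wz z E) \<le> (\<Sum>l<k. exp (real l * a k) * \<bar>W l e\<bar>)"
            unfolding Wz_def WE by (intro sum_norm_le) (auto simp: norm_mult intro!: mult_right_mono powz[OF that])
          then show ?thesis using \<omega>0 unfolding \<kappa>_def by (meson order.trans)
        qed
        have Wz_diff: "norm (Wz z E - W1) \<le> 2 * norm (1 - z) powr q * \<omega>1" if "norm z \<le> exp (a k)" for z :: complex
        proof -
          have "Wz z E - W1 = (\<Sum>l<k. (z ^ l - 1) * complex_of_real (W l e))"
            by (simp add: Wz_def W1_def WE sum_subtractf left_diff_distrib)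
          also have "norm \<dots> \<le> (\<Sum>l<k. 2 * norm (1 - z) powr q * (real l powr q * exp (real l * a k) * \<bar>W l e\<bar>))"
          proof (intro sum_norm_le)
            fix l
            have "norm (z ^ l - 1) * \<bar>W l e\<bar>
                \<le> 2 * (norm (1 - z) powr q * (real l powr q * exp (real l * a k))) * \<bar>W l e\<bar>"
              using norm_power_diff_one_le[OF q that, of l] ak
              by (intro mult_right_mono) (auto simp: norm_minus_commute)
            then show "norm ((z ^ l - 1) * complex_of_real (W l e))
                \<le> 2 * norm (1 - z) powr q * (real l powr q * exp (real l * a k) * \<bar>W l e\<bar>)"
              by (simp add: norm_mult mult_ac)
          qed
          also have "\<dots> \<le> 2 * norm (1 - z) powr q * \<omega>1"
            unfolding sum_distrib_left[symmetric] using \<omega>1 by (intro mult_left_mono) auto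
          finally show ?thesis .
        qed
        have nb: "norm (?b j) \<le> V * r j" if "j < k" for j using b that by (simp add: norm_Pair)
        have Vz_le: "norm (Vz z) \<le> V * d" if "norm z \<le> exp (a k)" for z :: complex
        proof -
          have "norm (Vz z) \<le> (\<Sum>j<k. V * (2 * (r j * exp (real j * a k))))"
            unfolding Vz_def
          proof (intro sum_norm_le)
            fix j assume j: "j \<in> {..<k}"
            have "norm (z ^ j) * norm (?b j) \<le> exp (real j * a k) * (V * r j)"
              using j by (intro mult_mono powz[OF that] nb) auto
            then show "norm (cscale (z ^ j) (?b j)) \<le> V * (2 * (r j * exp (real j * a k)))"
              using norm_cscale_le[of "z ^ j" "?b j"] by (simp add: mult_ac)
          qed
          also have "\<dots> = V * (2 * (\<Sum>j<k. r j * exp (real j * a k)))" by (simp add: sum_distrib_left)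
          also have "\<dots> \<le> V * d" unfolding d_def using wt V by (rule mult_left_mono)
          finally show ?thesis .
        qed
        have Jb: "J (?b j) = I (b j)" for j
          by (simp add: complex_functional_def linear_simps[OF I_linear] complex_of_real_def)
        have JV: "J (Vz z) = (\<Sum>j<k. z ^ j * I (b j))" for z :: complex
          by (simp add: Vz_def linear_sum[OF bounded_linear.linear[OF J_linear]] J_cscale Jb)
        have Ib: "\<bar>I (b j)\<bar> \<le> V * r j" if "j < k" for j using I_le[of "b j"] b that by (meson order.trans)
        have V1_le: "\<bar>V1\<bar> \<le> V * d"
        proof -
          have "norm (J (Vz 1)) \<le> V * d" using norm_J_le[of "Vz 1"] Vz_le[of 1] ak by simp
          then show ?thesis unfolding JV V1_def by (simp flip: of_real_sum)
        qed
        have V_diff: "norm (J (Vz z) - V1) \<le> 2 * norm (1 - z) powr q * (V * S)" if "norm z \<le> exp (a k)" for z :: complex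
        proof -
          have "J (Vz z) - V1 = (\<Sum>j<k. (z ^ j - 1) * complex_of_real (I (b j)))"
            by (simp add: JV V1_def sum_subtractf left_diff_distrib)
          also have "norm \<dots> \<le> (\<Sum>j<k. 2 * norm (1 - z) powr q * (V * (r j * (real j powr q * exp (real j * a k)))))"
          proof (intro sum_norm_le)
            fix j assume j: "j \<in> {..<k}"
            have "norm (z ^ j - 1) * \<bar>I (b j)\<bar>
                \<le> 2 * (norm (1 - z) powr q * (real j powr q * exp (real j * a k))) * (V * r j)"
              using norm_power_diff_one_le[OF q that, of j] ak Ib[of j] j
              by (intro mult_mono) (auto simp: norm_minus_commute)
            then show "norm ((z ^ j - 1) * complex_of_real (I (b j)))
                \<le> 2 * norm (1 - z) powr q * (V * (r j * (real j powr q * exp (real j * a k))))"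
              by (simp add: norm_mult mult_ac)
          qed
          also have "\<dots> \<le> 2 * norm (1 - z) powr q * (V * S)"
            unfolding sum_distrib_left[symmetric] S_def using weighted_tail_le_S_sum[OF q(1)] V
            by (intro mult_left_mono) auto
          finally show ?thesis .
        qed

        define g where "g z = Wz z (solve k z (Vz z)) - complex_of_real (V1 * W1) / ((1 - z) * mean_return k)" for z :: complex
        define B where "B = C' * V * (\<omega>0 * S + \<omega>1)"
        have inv: "\<exists>c. invertible_within (id_blinfun - trR k z) c" if "norm z \<le> exp (a k)" "z \<noteq> 1" for z :: complex
          using res that by blast
        \<comment> \<open>The two poles at \<open>1\<close> cancel up to an integrable singularity.\<close>
        have g_le: "norm (g z) \<le> B * norm (1 - z) powr (q - 1)" if z: "norm z \<le> exp (a k)" "z \<noteq> 1" for z :: complex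
        proof -
          define m where "m = norm (1 - z)"
          have m: "m > 0" using z by (simp add: m_def)
          define x where "x = solve k z (Vz z)"
          obtain c0 where c0: "invertible_within (id_blinfun - trR k z) c0" using inv[OF z] by blast
          have x: "x - trR k z x = Vz z" unfolding x_def by (rule solve_eq[OF c0])
          define \<beta> where "\<beta> = J (Vz z) / ((1 - z) * mean_return k)"
          have "norm (x - cscale \<beta> E) \<le> C * (m powr (q - 1) * S) * norm (Vz z)"
            using res z q unfolding m_def S_def \<beta>_def x[symmetric] by blast
          also have "\<dots> \<le> C * (m powr (q - 1) * S) * (V * d)"
            using C S_nonneg by (intro mult_left_mono Vz_le[OF z(1)]) auto
          finally have H: "norm (x - cscale \<beta> E) \<le> C * (m powr (q - 1) * S) * (V * d)" .
          have Wz_lin: "Wz z x = Wz z (x - cscale \<beta> E) + \<beta> * Wz z E"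
          proof -
            have split: "?W l x = ?W l (x - cscale \<beta> E) + \<beta> * ?W l E" for l
              using W by (simp add: linear_simps[OF bounded_linear_complex_functional] complex_functional_cscale)
            show ?thesis
              unfolding Wz_def sum_distrib_left sum.distrib[symmetric]
            proof (rule sum.cong)
              fix l
              show "z ^ l * ?W l x = z ^ l * ?W l (x - cscale \<beta> E) + \<beta> * (z ^ l * ?W l E)"
                unfolding split[of l] by (simp only: distrib_left mult_ac)
            qed simp
          qed
          have "norm (Wz z (x - cscale \<beta> E)) \<le> 2 * \<omega>0 * norm (x - cscale \<beta> E)" by (rule Wz_le[OF z(1)])
          also have "\<dots> \<le> 2 * \<omega>0 * (C * (m powr (q - 1) * S) * (V * d))"
            using H \<omega>0_nonneg by (intro mult_left_mono) auto
          also have "\<dots> = (2 * C * d) * (V * (\<omega>0 * S)) * m powr (q - 1)" by (simp add: mult_ac)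
          finally have t1: "norm (Wz z (x - cscale \<beta> E)) \<le> (2 * C * d) * (V * (\<omega>0 * S)) * m powr (q - 1)" .
          have "norm (\<beta> * Wz z E - complex_of_real (V1 * W1) / ((1 - z) * mean_return k))
              = norm ((J (Vz z) - V1) * Wz z E + V1 * (Wz z E - W1)) / (m * mean_return k)"
          proof -
            have "\<beta> * Wz z E - complex_of_real (V1 * W1) / ((1 - z) * mean_return k)
                = ((J (Vz z) - V1) * Wz z E + V1 * (Wz z E - W1)) / ((1 - z) * mean_return k)"
              unfolding \<beta>_def by (simp add: algebra_simps diff_divide_distrib add_divide_distrib)
            then show ?thesis using mean_return by (simp add: norm_divide norm_mult m_def)
          qed
          also have "\<dots> \<le> ((2 * m powr q * (V * S)) * (\<omega>0 * \<kappa>) + (V * d) * (2 * m powr q * \<omega>1)) / (m * 1)"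
          proof (rule frac_le)
            have "norm ((J (Vz z) - V1) * Wz z E) \<le> (2 * m powr q * (V * S)) * (\<omega>0 * \<kappa>)"
              unfolding norm_mult m_def using V_diff[OF z(1)] Wz_E[OF z(1)] V S_nonneg
              by (intro mult_mono) auto
            moreover have "norm (V1 * (Wz z E - W1)) \<le> (V * d) * (2 * m powr q * \<omega>1)"
              unfolding norm_mult m_def using V1_le Wz_diff[OF z(1)] V d
              by (intro mult_mono) auto
            ultimately show "norm ((J (Vz z) - V1) * Wz z E + V1 * (Wz z E - W1))
                \<le> (2 * m powr q * (V * S)) * (\<omega>0 * \<kappa>) + (V * d) * (2 * m powr q * \<omega>1)"
              by (rule order.trans[OF norm_triangle_ineq add_mono])
            show "0 \<le> (2 * m powr q * (V * S)) * (\<omega>0 * \<kappa>) + (V * d) * (2 * m powr q * \<omega>1)"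
              using V S_nonneg \<omega>0_nonneg \<omega>1_nonneg \<kappa> d by (intro add_nonneg_nonneg mult_nonneg_nonneg) auto
          qed (use m mean_return in auto)
          also have "\<dots> = (2 * \<kappa> * (V * (\<omega>0 * S)) + 2 * d * (V * \<omega>1)) * (m powr q / m)"
            by (simp add: algebra_simps add_divide_distrib)
          also have "m powr q / m = m powr (q - 1)" using m by (simp add: powr_diff)
          finally have t2: "norm (\<beta> * Wz z E - complex_of_real (V1 * W1) / ((1 - z) * mean_return k))
              \<le> (2 * \<kappa> * (V * (\<omega>0 * S)) + 2 * d * (V * \<omega>1)) * m powr (q - 1)" .
          have "g z = Wz z (x - cscale \<beta> E) + (\<beta> * Wz z E - complex_of_real (V1 * W1) / ((1 - z) * mean_return k))"
            unfolding g_def x_def[symmetric] Wz_lin by simp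
          then have "norm (g z) \<le> norm (Wz z (x - cscale \<beta> E)) + norm (\<beta> * Wz z E - complex_of_real (V1 * W1) / ((1 - z) * mean_return k))"
            by (simp add: norm_triangle_ineq)
          also have "\<dots> \<le> (2 * C * d) * (V * (\<omega>0 * S)) * m powr (q - 1)
              + (2 * \<kappa> * (V * (\<omega>0 * S)) + 2 * d * (V * \<omega>1)) * m powr (q - 1)"
            by (rule add_mono[OF t1 t2])
          also have "\<dots> = ((2 * C * d + 2 * \<kappa>) * (V * (\<omega>0 * S)) + 2 * d * (V * \<omega>1)) * m powr (q - 1)"
            by (simp add: algebra_simps)
          also have "\<dots> \<le> (C' * (V * (\<omega>0 * S)) + C' * (V * \<omega>1)) * m powr (q - 1)"
          proof (intro mult_right_mono add_mono)
            have "0 \<le> C * d" "0 \<le> \<kappa>" "0 \<le> d" using C d \<kappa> by auto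
            then show "2 * C * d + 2 * \<kappa> \<le> C'" "2 * d \<le> C'" by (simp_all add: C'_def)
          qed (use V \<omega>0_nonneg \<omega>1_nonneg S_nonneg in auto)
          also have "\<dots> = B * norm (1 - z) powr (q - 1)" by (simp add: B_def m_def algebra_simps)
          finally show ?thesis .
        qed

        define G where "G N = (\<Sum>j<k. if j \<le> N then ?c (N - j) (?b j) else 0)" for N
        have holo: "g holomorphic_on ball 0 (exp (a k)) - {1}"
        proof -
          have "(\<lambda>z. Wz z (solve k z (Vz z))) holomorphic_on ball 0 (exp (a k)) - {1}"
          proof (rule holomorphic_transform)
            show "(\<lambda>z. \<Sum>l<k. z ^ l * (\<Sum>j<k. z ^ j * ?W l (solve k z (?b j)))) holomorphic_on ball 0 (exp (a k)) - {1}"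
            proof (intro holomorphic_intros solve_holomorphic)
              show "open (ball 0 (exp (a k)) - {1::complex})" by auto
            qed (use W inv in auto)
            fix z assume "z \<in> ball 0 (exp (a k)) - {1::complex}"
            then obtain c0 where c0: "invertible_within (id_blinfun - trR k z) c0" using inv[of z] by auto
            have "?W l (solve k z (Vz z)) = (\<Sum>j<k. z ^ j * ?W l (solve k z (?b j)))" for l
              using W unfolding Vz_def solve_sum[OF c0] solve_cscale[OF c0]
              by (simp add: linear_sum[OF bounded_linear.linear[OF bounded_linear_complex_functional]]
                  complex_functional_cscale)
            then show "(\<Sum>l<k. z ^ l * (\<Sum>j<k. z ^ j * ?W l (solve k z (?b j)))) = Wz z (solve k z (Vz z))"
              by (simp add: Wz_def)
          qed
          then show ?thesis unfolding g_def using mean_return by (intro holomorphic_intros) auto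
        qed
        have series: "(\<lambda>N. (G N - complex_of_real (V1 * W1) / mean_return k) * z ^ N) sums g z" if z: "norm z < 1" for z :: complex
        proof -
          have ze: "norm z \<le> exp (a k)" "z \<noteq> 1" using z one_le_exp_iff[of "a k"] ak
            by (linarith, auto)
          obtain c0 where c0: "invertible_within (id_blinfun - trR k z) c0" using inv[OF ze] by blast
          note gen = renewal_generating_function[OF k z cl[rule_format] cK[rule_format] W[rule_format] ren[rule_format]]
          have Cz: "(\<Sum>n. z ^ n * ?c n (Vz z)) = Wz z (solve k z (Vz z))"
            using gen(2)[of "solve k z (Vz z)"] unfolding solve_eq[OF c0] Wz_def .
          have "(\<lambda>N. \<Sum>j<k. if j \<le> N then z ^ N * ?c (N - j) (?b j) else 0)
              sums (\<Sum>j<k. z ^ j * (\<Sum>n. z ^ n * ?c n (?b j)))"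
          proof (rule sums_sum)
            fix j
            have "(\<lambda>n. z ^ j * (z ^ n * ?c n (?b j))) sums (z ^ j * (\<Sum>n. z ^ n * ?c n (?b j)))"
              by (intro sums_mult summable_sums gen(1))
            from sums_shift_if[OF this, of j]
            show "(\<lambda>N. if j \<le> N then z ^ N * ?c (N - j) (?b j) else 0) sums (z ^ j * (\<Sum>n. z ^ n * ?c n (?b j)))"
              by (rule sums_cong[THEN iffD1, rotated]) (auto simp: mult.assoc[symmetric] simp flip: power_add)
          qed
          moreover have "(\<Sum>j<k. z ^ j * (\<Sum>n. z ^ n * ?c n (?b j))) = (\<Sum>n. z ^ n * ?c n (Vz z))"
          proof -
            have "?c n (Vz z) = (\<Sum>j<k. z ^ j * ?c n (?b j))" for n
              using cl unfolding Vz_def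
              by (simp add: linear_sum[OF bounded_linear.linear[OF bounded_linear_complex_functional]]
                  complex_functional_cscale)
            then have "(\<Sum>n. z ^ n * ?c n (Vz z)) = (\<Sum>n. \<Sum>j<k. z ^ j * (z ^ n * ?c n (?b j)))"
              by (simp add: sum_distrib_left mult_ac)
            also have "\<dots> = (\<Sum>j<k. \<Sum>n. z ^ j * (z ^ n * ?c n (?b j)))"
              by (intro suminf_sum summable_mult gen(1))
            finally show ?thesis by (simp add: suminf_mult[OF gen(1)])
          qed
          moreover have "(\<Sum>j<k. if j \<le> N then z ^ N * ?c (N - j) (?b j) else 0) = G N * z ^ N" for N
            unfolding G_def sum_distrib_right by (intro sum.cong) auto
          ultimately have 1: "(\<lambda>N. G N * z ^ N) sums Wz z (solve k z (Vz z))" by (simp add: Cz)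
          have "(\<lambda>N. complex_of_real (V1 * W1) / mean_return k * z ^ N) sums (complex_of_real (V1 * W1) / mean_return k * (1 / (1 - z)))"
            using z by (intro sums_mult geometric_sums) auto
          moreover have "g z = Wz z (solve k z (Vz z)) - complex_of_real (V1 * W1) / mean_return k * (1 / (1 - z))"
            by (simp add: g_def mult.commute)
          ultimately show ?thesis using sums_diff[OF 1] by (simp only: left_diff_distrib)
        qed
        have "norm (G n - complex_of_real (V1 * W1) / mean_return k) * exp (a k) ^ n \<le> 2 / q * B"
          using ak q holo g_le series
          by (intro coefficient_bound_integrable_singularity[of "exp (a k)" q g]) auto
        moreover have "G n - complex_of_real (V1 * W1) / mean_return k
            = complex_of_real ((\<Sum>j<k. c (n - j) (b j)) - V1 * W1 / mean_return k)"
        proof -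
          have "?c m (?b j) = c m (b j)" for m j
            using cl by (simp add: complex_functional_def linear_simps complex_of_real_def)
          moreover have "j \<le> n" if "j < k" for j using that n by simp
          ultimately have "G n = (\<Sum>j<k. complex_of_real (c (n - j) (b j)))"
            unfolding G_def by (intro sum.cong) auto
          then show ?thesis by simp
        qed
        ultimately have "\<bar>(\<Sum>j<k. c (n - j) (b j)) - V1 * W1 / mean_return k\<bar> * exp (a k) ^ n \<le> 2 / q * B"
          by (simp only: norm_of_real)
        then have "\<bar>(\<Sum>j<k. c (n - j) (b j)) - V1 * W1 / mean_return k\<bar> \<le> 2 / q * B / exp (a k) ^ n"
          by (simp only: pos_le_divide_eq zero_less_power exp_gt_zero)
        also have "\<dots> = 2 / q * C' * V * (\<omega>0 * S + \<omega>1) * exp (- real n * a k)"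
          by (simp add: B_def exp_minus exp_of_nat_mult field_simps)
        finally show "\<bar>(\<Sum>j<k. c (n - j) (b j)) - (\<Sum>j<k. I (b j)) * (\<Sum>l<k. W l e) / mean_return k\<bar>
         \<le> 2 / q * C' * V * (\<omega>0 * S_sum Rn q k (a k) + \<omega>1) * exp (- real n * a k)"
          unfolding V1_def W1_def S_def .
      qed
    qed
  qed
qed

end

section \<open>The transfer operator as a renewal operator\<close>

context good_inducing_scheme
begin

abbreviation "F \<equiv> return_map T \<phi>"

sublocale prob_space \<mu> by (rule prob_\<mu>)

sublocale summable_tails Rn
  by standard (use Rn_tail_summable Rn_summable in auto)

lemma F_measurable [measurable]: "F \<in> measurable \<mu> \<mu>"
  using F_ergodic by (simp add: ergodic_invariant_def)

lemma distr_F: "distr \<mu> \<mu> F = \<mu>"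
  using F_ergodic by (simp add: ergodic_invariant_def)

lemmas phi_meas [measurable] = \<phi>_measurable

lemma emb_measurable [measurable]: "emb b \<in> borel_measurable \<mu>"
  using emb_integrable by (rule borel_measurable_integrable)

lemma phi_ge: "y \<in> space \<mu> \<Longrightarrow> 1 \<le> \<phi> y"
  using \<phi>_pos by (simp add: space_\<mu>)

definition bounded_measurable :: "real \<Rightarrow> ('a \<Rightarrow> real) \<Rightarrow> bool" where
  "bounded_measurable c h \<longleftrightarrow> h \<in> borel_measurable \<mu> \<and> (\<forall>y. \<bar>h y\<bar> \<le> c)"

lemma bounded_measurable_Linf:
  assumes "bounded_measurable c h" shows "h \<in> Linf \<mu>"
proof -
  have "Linf_norm \<mu> h \<le> ennreal c"
    unfolding Linf_norm_def using assms
    by (intro esssup_I) (auto simp: bounded_measurable_def intro!: ennreal_leI)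
  also have "\<dots> < \<infinity>" by simp
  finally show ?thesis using assms by (simp add: Linf_def bounded_measurable_def)
qed

lemma integrable_mult_bounded:
  assumes "integrable \<mu> f" "bounded_measurable c h" shows "integrable \<mu> (\<lambda>y. f y * h y)"
proof (rule Bochner_Integration.integrable_bound)
  show "integrable \<mu> (\<lambda>y. c * f y)" using assms(1) by simp
  show "(\<lambda>y. f y * h y) \<in> borel_measurable \<mu>"
    using assms by (auto simp: bounded_measurable_def)
  have "c \<ge> 0" using assms(2) unfolding bounded_measurable_def by (meson abs_ge_zero order.trans)
  then show "AE y in \<mu>. norm (f y * h y) \<le> norm (c * f y)"
    using assms(2) by (intro AE_I2) (auto simp: bounded_measurable_def abs_mult mult.commute[of c] intro!: mult_left_mono)
qed

text \<open>Operators on \<open>L\<^sup>1\<close> act on representatives, so elements of \<open>\<B>(Y)\<close> are handled through their integrals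
  against bounded functions.\<close>

definition pairing :: "('a \<Rightarrow> real) \<Rightarrow> 'b \<Rightarrow> real" where
  "pairing h b = (\<integral>y. emb b y * h y \<partial>\<mu>)"

lemma pairing_le:
  assumes "bounded_measurable c h" shows "\<bar>pairing h b\<bar> \<le> c * norm b"
proof -
  have c: "c \<ge> 0" using assms unfolding bounded_measurable_def by (meson abs_ge_zero order.trans)
  have "\<bar>pairing h b\<bar> \<le> (\<integral>y. c * \<bar>emb b y\<bar> \<partial>\<mu>)"
    unfolding pairing_def real_norm_def[symmetric]
  proof (rule order.trans[OF integral_norm_bound integral_mono])
    show "integrable \<mu> (\<lambda>y. norm (emb b y * h y))"
      by (intro integrable_norm integrable_mult_bounded[OF emb_integrable assms])
    show "integrable \<mu> (\<lambda>y. c * norm (emb b y))" using emb_integrable by (intro integrable_mult_right integrable_norm)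
    show "norm (emb b y * h y) \<le> c * norm (emb b y)" for y
      using assms by (simp add: bounded_measurable_def abs_mult mult.commute[of c] mult_left_mono)
  qed
  also have "\<dots> = c * (\<integral>y. \<bar>emb b y\<bar> \<partial>\<mu>)" by simp
  also have "\<dots> \<le> c * norm b" using emb_L1 c by (rule mult_left_mono)
  finally show ?thesis .
qed

lemma pairing_linear:
  assumes "bounded_measurable c h" shows "bounded_linear (pairing h)"
proof (rule bounded_linear_intro)
  have hm: "h \<in> borel_measurable \<mu>" using assms by (simp add: bounded_measurable_def)
  note [measurable] = hm
  note int = integrable_mult_bounded[OF emb_integrable assms]
  show "pairing h (x + y) = pairing h x + pairing h y" for x y
    unfolding pairing_def Bochner_Integration.integral_add[OF int int, symmetric]
    using emb_add[of x y] by (intro integral_cong_AE) (auto simp: distrib_right)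
  show "pairing h (s *\<^sub>R x) = s *\<^sub>R pairing h x" for s x
    unfolding pairing_def real_scaleR_def integral_mult_right_zero[symmetric]
    using emb_scale[of s x] by (intro integral_cong_AE) (auto simp: mult.assoc)
  show "norm (pairing h x) \<le> norm x * c" for x
    using pairing_le[OF assms, of x] by (simp add: mult.commute)
qed

lemma bounded_measurable_comp_F:
  "bounded_measurable c h \<Longrightarrow> bounded_measurable c (\<lambda>y. h (F y))"
  by (auto simp: bounded_measurable_def intro: measurable_compose[OF F_measurable])

lemma bounded_measurable_indicator:
  assumes "bounded_measurable c h" "Measurable.pred \<mu> P"
  shows "bounded_measurable c (\<lambda>y. (if P y then h y else 0))"
proof -
  have "c \<ge> 0" using assms(1) unfolding bounded_measurable_def by (meson abs_ge_zero order.trans)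
  moreover have "(\<lambda>y. (if P y then h y else 0)) \<in> borel_measurable \<mu>"
    using assms by (intro measurable_If) (auto simp: bounded_measurable_def pred_def)
  ultimately show ?thesis using assms by (auto simp: bounded_measurable_def)
qed

lemma pairing_Rn:
  assumes h: "bounded_measurable c h" and n: "n \<ge> 1"
  shows "pairing h (Rn n b) = pairing (\<lambda>y. if \<phi> y = n then h (F y) else 0) b"
proof -
  have hm[measurable]: "h \<in> borel_measurable \<mu>" using h by (simp add: bounded_measurable_def)
  define f where "f y = indicator {y. \<phi> y = n} y * emb b y" for y
  have fm: "f \<in> borel_measurable \<mu>"
  proof -
    have "(\<lambda>y. (if \<phi> y = n then emb b y else 0)) \<in> borel_measurable \<mu>" by measurable
    then show ?thesis by (rule measurable_cong[THEN iffD1, rotated]) (simp add: f_def indicator_def)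
  qed
  have fi: "integrable \<mu> f"
    by (rule Bochner_Integration.integrable_bound[OF emb_integrable[of b] fm]) (auto simp: f_def indicator_def)
  have R: "integrable \<mu> (R f)" "(\<integral>y. R f y * h y \<partial>\<mu>) = (\<integral>y. f y * h (F y) \<partial>\<mu>)"
    using R_transfer fi bounded_measurable_Linf[OF h] unfolding transfer_operator_def by auto
  have Rm[measurable]: "R f \<in> borel_measurable \<mu>" using R(1) by (rule borel_measurable_integrable)
  have "AE y in \<mu>. emb (Rn n b) y = R f y"
    using Rn_bounded[OF n, of b] by (simp add: R_part_def f_def[abs_def])
  then have "pairing h (Rn n b) = (\<integral>y. R f y * h y \<partial>\<mu>)"
    unfolding pairing_def by (intro integral_cong_AE) auto
  also have "\<dots> = (\<integral>y. f y * h (F y) \<partial>\<mu>)" by (rule R)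
  also have "\<dots> = pairing (\<lambda>y. if \<phi> y = n then h (F y) else 0) b"
    unfolding pairing_def f_def by (intro Bochner_Integration.integral_cong) (auto simp: indicator_def)
  finally show ?thesis .
qed

text \<open>Both sides lose the same term \<open>pairing h (Rn (Suc j) b)\<close> when \<open>j\<close> increases, and both tend to zero.\<close>

lemma pairing_tail_op:
  assumes h: "bounded_measurable c h"
  shows "pairing h (Rt j b) = pairing (\<lambda>y. if j < \<phi> y then h (F y) else 0) b"
proof -
  have hm[measurable]: "h \<in> borel_measurable \<mu>" using h by (simp add: bounded_measurable_def)
  define X where "X n = pairing (\<lambda>y. if n < \<phi> y then h (F y) else 0) b" for n
  note hF = bounded_measurable_comp_F[OF h]
  have Xrec: "X n = pairing h (Rn (Suc n) b) + X (Suc n)" for n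
  proof -
    have "X n = (\<integral>y. emb b y * (if \<phi> y = Suc n then h (F y) else 0) + emb b y * (if Suc n < \<phi> y then h (F y) else 0) \<partial>\<mu>)"
      unfolding X_def pairing_def by (intro Bochner_Integration.integral_cong) auto
    also have "\<dots> = pairing (\<lambda>y. if \<phi> y = Suc n then h (F y) else 0) b + X (Suc n)"
      unfolding X_def pairing_def
      by (intro Bochner_Integration.integral_add integrable_mult_bounded[of _ c] emb_integrable
            bounded_measurable_indicator hF) measurable
    finally show ?thesis using pairing_Rn[OF h, of "Suc n" b] by simp
  qed
  have Lrec: "pairing h (Rt n b) = pairing h (Rn (Suc n) b) + pairing h (Rt (Suc n) b)" for n
    by (subst tail_op_Suc) (simp add: blinfun.add_left linear_simps[OF pairing_linear[OF h]])
  have const: "pairing h (Rt n b) - X n = pairing h (Rt j b) - X j" if "j \<le> n" for n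
    using that by (induction n rule: dec_induct) (use Xrec Lrec in \<open>metis add_diff_cancel_left\<close>)+
  have "X \<longlonglongrightarrow> (\<integral>y. 0 \<partial>\<mu>)"
    unfolding X_def pairing_def
  proof (rule integral_dominated_convergence[where w = "\<lambda>y. c * \<bar>emb b y\<bar>"])
    show "integrable \<mu> (\<lambda>y. c * \<bar>emb b y\<bar>)" using emb_integrable by simp
    show "AE y in \<mu>. (\<lambda>n. emb b y * (if n < \<phi> y then h (F y) else 0)) \<longlonglongrightarrow> 0"
    proof (rule AE_I2)
      fix y
      have "\<forall>\<^sub>F n in sequentially. emb b y * (if n < \<phi> y then h (F y) else 0) = 0"
        using eventually_ge_at_top[of "\<phi> y"] by eventually_elim auto
      then show "(\<lambda>n. emb b y * (if n < \<phi> y then h (F y) else 0)) \<longlonglongrightarrow> 0" by (rule tendsto_eventually)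
    qed
    fix n
    show "AE y in \<mu>. norm (emb b y * (if n < \<phi> y then h (F y) else 0)) \<le> c * \<bar>emb b y\<bar>"
    proof (rule AE_I2)
      fix y
      have "\<bar>if n < \<phi> y then h (F y) else 0\<bar> \<le> c"
        using h unfolding bounded_measurable_def by (auto intro: order.trans[OF abs_ge_zero])
      then show "norm (emb b y * (if n < \<phi> y then h (F y) else 0)) \<le> c * \<bar>emb b y\<bar>"
        by (simp only: real_norm_def abs_mult mult.commute[of c] mult_left_mono abs_ge_zero)
    qed
  qed measurable
  moreover have "(\<lambda>n. pairing h (Rt n b)) \<longlonglongrightarrow> 0"
  proof (rule Lim_null_comparison)
    have "(\<lambda>n. c * (r n * norm b)) \<longlonglongrightarrow> c * (0 * norm b)"
      by (intro tendsto_intros tail_norm_tendsto_0)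
    then show "(\<lambda>n. c * (r n * norm b)) \<longlonglongrightarrow> 0" by simp
    have c: "c \<ge> 0" using h unfolding bounded_measurable_def by (meson abs_ge_zero order.trans)
    have "norm (pairing h (Rt n b)) \<le> c * (r n * norm b)" for n
    proof -
      have "norm (Rt n b) \<le> r n * norm b"
        using norm_blinfun[of "Rt n" b] mult_right_mono[OF norm_tail_op_le[of n] norm_ge_zero[of b]] by linarith
      then show ?thesis using pairing_le[OF h, of "Rt n b"] c
        by (simp add: order.trans[OF _ mult_left_mono])
    qed
    then show "\<forall>\<^sub>F n in sequentially. norm (pairing h (Rt n b)) \<le> c * (r n * norm b)" by simp
  qed
  ultimately have "(\<lambda>n. pairing h (Rt n b) - X n) \<longlonglongrightarrow> 0 - (\<integral>y. 0 \<partial>\<mu>)" by (intro tendsto_diff)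
  moreover have "(\<lambda>n. pairing h (Rt n b) - X n) \<longlonglongrightarrow> pairing h (Rt j b) - X j"
    by (intro tendsto_eventually eventually_sequentiallyI[of j] const)
  ultimately have "pairing h (Rt j b) - X j = 0" using LIMSEQ_unique by fastforce
  then show ?thesis by (simp add: X_def)
qed

definition const_one :: 'b where "const_one = (SOME b. AE y in \<mu>. emb b y = 1)"

lemma emb_one: "AE y in \<mu>. emb const_one y = 1"
  unfolding const_one_def by (rule someI_ex[OF emb_const])

abbreviation "mean \<equiv> pairing (\<lambda>_. 1)"

lemma bounded_measurable_1: "bounded_measurable 1 (\<lambda>_. 1)"
  by (simp add: bounded_measurable_def)

lemma pairing_one:
  assumes "h \<in> borel_measurable \<mu>" shows "pairing h const_one = (\<integral>y. h y \<partial>\<mu>)"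
  unfolding pairing_def using emb_one assms by (intro integral_cong_AE) auto

text \<open>Invariance of \<open>\<mu>\<close>, tested against the sign of the difference.\<close>

lemma tail_op_one_fixed: "Rt 0 const_one = const_one"
proof -
  define u where "u y = emb (Rt 0 const_one) y - 1" for y
  have um[measurable]: "u \<in> borel_measurable \<mu>" unfolding u_def by measurable
  have ui: "integrable \<mu> u" unfolding u_def using emb_integrable by simp
  have h: "bounded_measurable 1 (\<lambda>y. sgn (u y))"
    unfolding bounded_measurable_def by (auto simp: abs_sgn_eq)
  note [measurable] = h[unfolded bounded_measurable_def, THEN conjunct1]
  have "pairing (\<lambda>y. sgn (u y)) (Rt 0 const_one) = (\<integral>y. sgn (u (F y)) \<partial>\<mu>)"
  proof -
    have "pairing (\<lambda>y. sgn (u y)) (Rt 0 const_one) = pairing (\<lambda>y. if 0 < \<phi> y then sgn (u (F y)) else 0) const_one"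
      by (rule pairing_tail_op[OF h])
    also have "\<dots> = (\<integral>y. (if 0 < \<phi> y then sgn (u (F y)) else 0) \<partial>\<mu>)" by (rule pairing_one) measurable
    also have "\<dots> = (\<integral>y. sgn (u (F y)) \<partial>\<mu>)"
      using phi_ge by (intro Bochner_Integration.integral_cong) force+
    finally show ?thesis .
  qed
  also have "\<dots> = (\<integral>y. sgn (u y) \<partial>distr \<mu> \<mu> F)" by (rule integral_distr[symmetric]) measurable
  also have "\<dots> = (\<integral>y. sgn (u y) \<partial>\<mu>)" by (simp only: distr_F)
  finally have eq: "(\<integral>y. emb (Rt 0 const_one) y * sgn (u y) \<partial>\<mu>) = (\<integral>y. sgn (u y) \<partial>\<mu>)"
    by (simp add: pairing_def)
  have "(\<integral>y. \<bar>u y\<bar> \<partial>\<mu>) = (\<integral>y. emb (Rt 0 const_one) y * sgn (u y) - 1 * sgn (u y) \<partial>\<mu>)"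
    by (intro Bochner_Integration.integral_cong refl) (simp add: u_def abs_sgn left_diff_distrib)
  also have "\<dots> = (\<integral>y. emb (Rt 0 const_one) y * sgn (u y) \<partial>\<mu>) - (\<integral>y. 1 * sgn (u y) \<partial>\<mu>)"
    by (intro Bochner_Integration.integral_diff integrable_mult_bounded[OF _ h] emb_integrable) simp
  finally have "(\<integral>y. \<bar>u y\<bar> \<partial>\<mu>) = 0" using eq by simp
  then have "AE y in \<mu>. \<bar>u y\<bar> = 0"
    using ui by (subst (asm) integral_nonneg_eq_0_iff_AE) auto
  then have "AE y in \<mu>. emb (Rt 0 const_one - const_one) y = 0"
    using emb_add[of "Rt 0 const_one" "- const_one"] emb_scale[of "- 1" const_one] emb_one
    by eventually_elim (simp add: u_def)
  then show ?thesis using emb_inj by force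
qed

lemma mean_tail_op:
  "mean (Rt j b) = (\<integral>y. emb b y * (if j < \<phi> y then 1 else 0) \<partial>\<mu>)"
  using pairing_tail_op[OF bounded_measurable_1] by (simp add: pairing_def)

lemma mean_tail_op_one: "mean (Rt j const_one) = measure \<mu> {y \<in> space \<mu>. j < \<phi> y}"
proof -
  have "mean (Rt j const_one) = (\<integral>y. (if j < \<phi> y then 1 else 0) \<partial>\<mu>)"
    unfolding pairing_tail_op[OF bounded_measurable_1] by (rule pairing_one) measurable
  also have "\<dots> = (\<integral>y. indicator {y \<in> space \<mu>. j < \<phi> y} y \<partial>\<mu>)"
    by (intro Bochner_Integration.integral_cong) auto
  finally show ?thesis by simp
qed

sublocale renewal_operators Rn mean const_one
proof (rule renewal_operators.intro[OF summable_tails_axioms renewal_operators_axioms.intro])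
  show "bounded_linear mean" by (rule pairing_linear[OF bounded_measurable_1])
  show "\<bar>mean b\<bar> \<le> norm b" for b using pairing_le[OF bounded_measurable_1, of b] by simp
  show "mean (Rt 0 b) = mean b" for b
    unfolding mean_tail_op unfolding pairing_def using phi_ge
    by (intro Bochner_Integration.integral_cong) force+
  show "Rt 0 const_one = const_one" by (rule tail_op_one_fixed)
  show "mean const_one = 1" by (simp add: pairing_one prob_space)
  show "0 \<le> mean (Rt j const_one)" for j by (simp add: mean_tail_op_one)
  show "simple_eigenvalue (R_series Rn 1) 1" by (rule R1_simple)
  show "1 \<notin> spectrum (R_series Rn z)" if "norm z \<le> 1" "z \<noteq> 1" for z using Rz_spectrum that by blast
qed

lemma measure_tail_le: "measure \<mu> {y \<in> space \<mu>. j < \<phi> y} \<le> norm const_one * r j"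
proof -
  have "measure \<mu> {y \<in> space \<mu>. j < \<phi> y} \<le> norm (Rt j const_one)"
    using I_le[of "Rt j const_one"] by (simp add: mean_tail_op_one)
  also have "\<dots> \<le> r j * norm const_one"
    using norm_blinfun[of "Rt j" const_one] mult_right_mono[OF norm_tail_op_le[of j] norm_ge_zero[of const_one]] by linarith
  finally show ?thesis by (simp add: mult.commute)
qed

end

context good_inducing_scheme
begin

section \<open>Towers and the projected measure\<close>

text \<open>The tower map for an arbitrary roof \<open>\<psi>\<close>, so that the tower and its truncation share their theory. Measures on
  towers are represented by integrals over the base of sums over the column.\<close>

definition tower_step :: "('a \<Rightarrow> nat) \<Rightarrow> 'a \<times> nat \<Rightarrow> 'a \<times> nat" where
  "tower_step \<psi> p = (if Suc (snd p) < \<psi> (fst p) then (fst p, Suc (snd p)) else (F (fst p), 0))"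

definition level_measurable :: "'c measure \<Rightarrow> ('a \<times> nat \<Rightarrow> 'c) \<Rightarrow> bool" where
  "level_measurable N h \<longleftrightarrow> (\<forall>l. (\<lambda>y. h (y, l)) \<in> measurable \<mu> N)"

lemma level_measurableD: "level_measurable N h \<Longrightarrow> (\<lambda>y. h (y, l)) \<in> measurable \<mu> N"
  by (simp add: level_measurable_def)

lemma level_measurable_step:
  assumes h: "level_measurable N h" and [measurable]: "\<psi> \<in> measurable \<mu> (count_space UNIV)"
  shows "level_measurable N (\<lambda>p. h (tower_step \<psi> p))"
proof -
  have "(\<lambda>y. if Suc l < \<psi> y then h (y, Suc l) else h (F y, 0)) \<in> measurable \<mu> N" for l
  proof (rule measurable_If)
    show "(\<lambda>y. h (F y, 0)) \<in> measurable \<mu> N"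
      by (rule measurable_compose[OF F_measurable level_measurableD[OF h]])
    show "(\<lambda>y. h (y, Suc l)) \<in> measurable \<mu> N" by (rule level_measurableD[OF h])
    show "{y \<in> space \<mu>. Suc l < \<psi> y} \<in> sets \<mu>" by measurable
  qed
  moreover have "h (tower_step \<psi> (y, l)) = (if Suc l < \<psi> y then h (y, Suc l) else h (F y, 0))" for y l
    by (simp add: tower_step_def)
  ultimately show ?thesis by (simp add: level_measurable_def)
qed

lemma level_measurable_iterate:
  assumes "level_measurable N h" and "\<psi> \<in> measurable \<mu> (count_space UNIV)"
  shows "level_measurable N (\<lambda>p. h ((tower_step \<psi> ^^ n) p))"
proof (induction n)
  case (Suc n)
  from level_measurable_step[OF this assms(2)] show ?case by (simp add: funpow_Suc_right del: funpow.simps)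
qed (use assms in simp)

lemma column_sum_measurable:
  fixes h :: "'a \<times> nat \<Rightarrow> 'c::{second_countable_topology, topological_comm_monoid_add}"
  assumes h: "level_measurable borel h" and \<psi>: "\<psi> \<in> measurable \<mu> (count_space UNIV)"
  shows "(\<lambda>y. \<Sum>l<\<psi> y. h (y, l)) \<in> borel_measurable \<mu>"
  by (rule measurable_compose_countable[of "\<lambda>n y. \<Sum>l<n. h (y, l)", OF _ \<psi>])
     (intro borel_measurable_sum level_measurableD[OF h])

text \<open>Moving up shifts each column by one; the top level goes to the base by \<open>F\<close>, which preserves
  \<open>\<mu>\<close>.\<close>

lemma nn_integral_tower_step:
  fixes h :: "'a \<times> nat \<Rightarrow> ennreal"
  assumes h: "level_measurable borel h" and \<psi>: "\<psi> \<in> measurable \<mu> (count_space UNIV)"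
    and pos: "\<And>y. y \<in> space \<mu> \<Longrightarrow> 1 \<le> \<psi> y"
  shows "(\<integral>\<^sup>+y. (\<Sum>l<\<psi> y. h (tower_step \<psi> (y, l))) \<partial>\<mu>) = (\<integral>\<^sup>+y. (\<Sum>l<\<psi> y. h (y, l)) \<partial>\<mu>)"
proof -
  note [measurable] = \<psi>
  have h': "level_measurable borel (\<lambda>p. h (fst p, Suc (snd p)))"
    using h by (simp add: level_measurable_def)
  have m: "(\<lambda>y. \<Sum>l<\<psi> y - 1. h (y, Suc l)) \<in> borel_measurable \<mu>"
    using column_sum_measurable[OF h', of "\<lambda>y. \<psi> y - 1"] by simp
  have h0[measurable]: "(\<lambda>y. h (y, 0)) \<in> borel_measurable \<mu>" by (rule level_measurableD[OF h])
  have hF: "(\<lambda>y. h (F y, 0)) \<in> borel_measurable \<mu>" by (rule measurable_compose[OF F_measurable h0])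
  have "(\<integral>\<^sup>+y. (\<Sum>l<\<psi> y. h (tower_step \<psi> (y, l))) \<partial>\<mu>)
      = (\<integral>\<^sup>+y. ((\<Sum>l<\<psi> y - 1. h (y, Suc l)) + h (F y, 0)) \<partial>\<mu>)"
  proof (rule nn_integral_cong)
    fix y assume "y \<in> space \<mu>"
    then have s: "\<psi> y = Suc (\<psi> y - 1)" using pos by fastforce
    have "(\<Sum>l<\<psi> y. h (tower_step \<psi> (y, l)))
        = (\<Sum>l<\<psi> y - 1. h (tower_step \<psi> (y, l))) + h (tower_step \<psi> (y, \<psi> y - 1))"
      by (subst s) (rule sum.lessThan_Suc)
    also have "(\<Sum>l<\<psi> y - 1. h (tower_step \<psi> (y, l))) = (\<Sum>l<\<psi> y - 1. h (y, Suc l))"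
      by (intro sum.cong) (auto simp: tower_step_def)
    also have "tower_step \<psi> (y, \<psi> y - 1) = (F y, 0)" using s by (simp add: tower_step_def)
    finally show "(\<Sum>l<\<psi> y. h (tower_step \<psi> (y, l))) = (\<Sum>l<\<psi> y - 1. h (y, Suc l)) + h (F y, 0)" .
  qed
  also have "\<dots> = (\<integral>\<^sup>+y. (\<Sum>l<\<psi> y - 1. h (y, Suc l)) \<partial>\<mu>) + (\<integral>\<^sup>+y. h (F y, 0) \<partial>\<mu>)"
    by (rule nn_integral_add[OF m hF])
  also have "(\<integral>\<^sup>+y. h (F y, 0) \<partial>\<mu>) = (\<integral>\<^sup>+y. h (y, 0) \<partial>distr \<mu> \<mu> F)"
    by (rule nn_integral_distr[symmetric]) measurable
  also have "\<dots> = (\<integral>\<^sup>+y. h (y, 0) \<partial>\<mu>)" by (simp only: distr_F)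
  also have "(\<integral>\<^sup>+y. (\<Sum>l<\<psi> y - 1. h (y, Suc l)) \<partial>\<mu>) + (\<integral>\<^sup>+y. h (y, 0) \<partial>\<mu>)
      = (\<integral>\<^sup>+y. ((\<Sum>l<\<psi> y - 1. h (y, Suc l)) + h (y, 0)) \<partial>\<mu>)"
    by (rule nn_integral_add[OF m h0, symmetric])
  also have "\<dots> = (\<integral>\<^sup>+y. (\<Sum>l<\<psi> y. h (y, l)) \<partial>\<mu>)"
  proof (rule nn_integral_cong)
    fix y assume "y \<in> space \<mu>"
    then have s: "\<psi> y = Suc (\<psi> y - 1)" using pos by fastforce
    show "(\<Sum>l<\<psi> y - 1. h (y, Suc l)) + h (y, 0) = (\<Sum>l<\<psi> y. h (y, l))"
      by (subst (2) s) (simp only: sum.lessThan_Suc_shift add.commute)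
  qed
  finally show ?thesis .
qed

lemma nn_integral_tower_iterate:
  fixes h :: "'a \<times> nat \<Rightarrow> ennreal"
  assumes h: "level_measurable borel h" and \<psi>: "\<psi> \<in> measurable \<mu> (count_space UNIV)"
    and pos: "\<And>y. y \<in> space \<mu> \<Longrightarrow> 1 \<le> \<psi> y"
  shows "(\<integral>\<^sup>+y. (\<Sum>l<\<psi> y. h ((tower_step \<psi> ^^ n) (y, l))) \<partial>\<mu>) = (\<integral>\<^sup>+y. (\<Sum>l<\<psi> y. h (y, l)) \<partial>\<mu>)"
proof (induction n)
  case (Suc n)
  have "(\<integral>\<^sup>+y. (\<Sum>l<\<psi> y. h ((tower_step \<psi> ^^ Suc n) (y, l))) \<partial>\<mu>)
      = (\<integral>\<^sup>+y. (\<Sum>l<\<psi> y. h ((tower_step \<psi> ^^ n) (tower_step \<psi> (y, l)))) \<partial>\<mu>)"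
    by (simp add: funpow_Suc_right del: funpow.simps)
  also have "\<dots> = (\<integral>\<^sup>+y. (\<Sum>l<\<psi> y. h ((tower_step \<psi> ^^ n) (y, l))) \<partial>\<mu>)"
    by (rule nn_integral_tower_step[OF level_measurable_iterate[OF h \<psi>] \<psi> pos])
  finally show ?case using Suc by simp
qed simp

abbreviation "\<mu>X \<equiv> mu_X M T \<phi> \<mu>"
definition "mean_height = (\<integral>y. real (\<phi> y) \<partial>\<mu>)"

lemma mean_height_ge_1: "mean_height \<ge> 1"
proof -
  have "(\<integral>y. 1 \<partial>\<mu>) \<le> mean_height" unfolding mean_height_def
    using \<phi>_integrable phi_ge by (intro integral_mono) (auto simp: real_of_nat_ge_one_iff)
  then show ?thesis by (simp add: prob_space)
qed

lemma sets_\<mu>X [simp, measurable_cong]: "sets \<mu>X = sets M" by (simp add: mu_X_def)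
lemma space_\<mu>X [simp]: "space \<mu>X = space M" by (simp add: mu_X_def)

lemma T_iterate_measurable: "T ^^ l \<in> measurable M M"
  using T_measurable by (induction l) (auto intro: measurable_comp)

lemma inclusion_measurable: "(\<lambda>y. y) \<in> measurable \<mu> M"
  using measurable_restrict_space1[OF measurable_ident, of M Y]
  by (simp add: id_def measurable_cong_sets[OF sets_\<mu> refl])

lemma orbit_measurable: "(\<lambda>y. (T ^^ l) y) \<in> measurable \<mu> M"
  by (rule measurable_compose[OF inclusion_measurable T_iterate_measurable])

definition proj :: "'a \<times> nat \<Rightarrow> 'a" where "proj p = (T ^^ snd p) (fst p)"

lemma level_measurable_proj: "g \<in> measurable M N \<Longrightarrow> level_measurable N (\<lambda>p. g (proj p))"
  unfolding level_measurable_def proj_def by (auto intro: measurable_compose[OF orbit_measurable])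

lemma nn_integral_mu_X:
  assumes g: "g \<in> borel_measurable M"
  shows "(\<integral>\<^sup>+x. g x \<partial>\<mu>X) = ennreal (1 / mean_height) * (\<integral>\<^sup>+y. (\<Sum>l<\<phi> y. g (proj (y, l))) \<partial>\<mu>)"
proof -
  let ?P = "\<mu> \<Otimes>\<^sub>M count_space (UNIV :: nat set)"
  let ?D = "{(y, l). y \<in> space \<mu> \<and> l < \<phi> y}"
  interpret C: sigma_finite_measure "count_space (UNIV :: nat set)"
    by (rule sigma_finite_measure_count_space_countable) simp
  have \<pi>: "(\<lambda>p. proj p) \<in> measurable ?P M"
    unfolding proj_def
    by (rule measurable_compose_countable[of "\<lambda>l p. (T ^^ l) (fst p)"])
       (auto intro!: measurable_compose[OF measurable_fst orbit_measurable])
  have \<pi>': "(\<lambda>(y, l). (T ^^ l) y) = proj" by (auto simp: proj_def)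
  have D: "?D \<in> sets ?P"
  proof -
    have \<phi>': "(\<lambda>p. \<phi> (fst p)) \<in> measurable ?P (count_space UNIV)"
      by (rule measurable_compose[OF measurable_fst phi_meas])
    have "Measurable.pred ?P (\<lambda>p. snd p < \<phi> (fst p))"
      by (rule measurable_compose_countable[of "\<lambda>n p. snd p < n", OF _ \<phi>'])
         (rule measurable_compose[OF measurable_snd], simp)
    then have "{p \<in> space ?P. snd p < \<phi> (fst p)} \<in> sets ?P" by (simp add: pred_def)
    also have "{p \<in> space ?P. snd p < \<phi> (fst p)} = ?D" by (auto simp: space_pair_measure)
    finally show ?thesis .
  qed
  have gm: "(\<lambda>p. g (proj p)) \<in> borel_measurable ?P" by (rule measurable_compose[OF \<pi> g])
  then have gm': "(\<lambda>p. g (proj p) * indicator ?D p) \<in> borel_measurable ?P" using D by simp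
  have "(\<integral>\<^sup>+x. g x \<partial>\<mu>X) = (\<integral>\<^sup>+p. g (proj p) \<partial>tower_measure \<phi> \<mu>)"
    unfolding mu_X_def \<pi>'
  proof (rule nn_integral_distr)
    show "proj \<in> measurable (tower_measure \<phi> \<mu>) M"
      unfolding tower_measure_def measurable_cong_sets[OF sets_scale_measure refl]
      by (rule measurable_restrict_space1[OF \<pi>])
  qed (use g in simp)
  also have "\<dots> = ennreal (1 / mean_height) * (\<integral>\<^sup>+p. g (proj p) \<partial>restrict_space ?P ?D)"
    unfolding tower_measure_def mean_height_def using gm
    by (intro nn_integral_scale_measure) (auto intro: measurable_restrict_space1)
  also have "(\<integral>\<^sup>+p. g (proj p) \<partial>restrict_space ?P ?D) = (\<integral>\<^sup>+p. g (proj p) * indicator ?D p \<partial>?P)"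
    using D by (intro nn_integral_restrict_space) auto
  also have "\<dots> = (\<integral>\<^sup>+y. \<integral>\<^sup>+l. g (proj (y, l)) * indicator ?D (y, l) \<partial>count_space UNIV \<partial>\<mu>)"
    by (rule C.nn_integral_fst[OF gm', symmetric])
  also have "\<dots> = (\<integral>\<^sup>+y. (\<Sum>l<\<phi> y. g (proj (y, l))) \<partial>\<mu>)"
  proof (rule nn_integral_cong)
    fix y assume y: "y \<in> space \<mu>"
    have "(\<integral>\<^sup>+l. g (proj (y, l)) * indicator ?D (y, l) \<partial>count_space UNIV)
        = (\<Sum>l. g (proj (y, l)) * indicator ?D (y, l))" by (rule nn_integral_count_space_nat)
    also have "\<dots> = (\<Sum>l<\<phi> y. g (proj (y, l)) * indicator ?D (y, l))"
      by (rule suminf_finite) (auto simp: indicator_def)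
    also have "\<dots> = (\<Sum>l<\<phi> y. g (proj (y, l)))" using y by (intro sum.cong) auto
    finally show "(\<integral>\<^sup>+l. g (proj (y, l)) * indicator ?D (y, l) \<partial>count_space UNIV)
        = (\<Sum>l<\<phi> y. g (proj (y, l)))" .
  qed
  finally show ?thesis .
qed

lemma nonneg_integral_mu_X:
  fixes g :: "'a \<Rightarrow> real"
  assumes g: "integrable \<mu>X g" and pos: "\<And>x. g x \<ge> 0"
  shows "integrable \<mu> (\<lambda>y. \<Sum>l<\<phi> y. g (proj (y, l)))"
    and "(\<integral>y. (\<Sum>l<\<phi> y. g (proj (y, l))) \<partial>\<mu>) = mean_height * (\<integral>x. g x \<partial>\<mu>X)"
proof -
  have gm: "g \<in> borel_measurable M" using borel_measurable_integrable[OF g] by simp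
  have sm: "(\<lambda>y. \<Sum>l<\<phi> y. g (proj (y, l))) \<in> borel_measurable \<mu>"
    by (rule column_sum_measurable[OF level_measurable_proj[OF gm] phi_meas])
  have spos: "0 \<le> (\<Sum>l<\<phi> y. g (proj (y, l)))" for y using pos by (intro sum_nonneg) auto
  have "(\<integral>\<^sup>+x. ennreal (g x) \<partial>\<mu>X) = ennreal (1 / mean_height) * (\<integral>\<^sup>+y. (\<Sum>l<\<phi> y. ennreal (g (proj (y, l)))) \<partial>\<mu>)"
    using gm by (intro nn_integral_mu_X) auto
  also have "(\<lambda>y. \<Sum>l<\<phi> y. ennreal (g (proj (y, l)))) = (\<lambda>y. ennreal (\<Sum>l<\<phi> y. g (proj (y, l))))"
    using pos by (simp add: sum_ennreal)
  finally have eq: "(\<integral>\<^sup>+x. ennreal (g x) \<partial>\<mu>X)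
      = ennreal (1 / mean_height) * (\<integral>\<^sup>+y. ennreal (\<Sum>l<\<phi> y. g (proj (y, l))) \<partial>\<mu>)" .
  have gi: "(\<integral>\<^sup>+x. ennreal (g x) \<partial>\<mu>X) = ennreal (\<integral>x. g x \<partial>\<mu>X)"
    using g pos by (intro nn_integral_eq_integral) auto
  have "ennreal mean_height * (ennreal (1 / mean_height) * X) = X" for X
    using mean_height_ge_1 by (simp add: mult.assoc[symmetric] ennreal_mult[symmetric])
  then have eq2: "(\<integral>\<^sup>+y. ennreal (\<Sum>l<\<phi> y. g (proj (y, l))) \<partial>\<mu>) = ennreal (mean_height * (\<integral>x. g x \<partial>\<mu>X))"
    using eq gi mean_height_ge_1 pos by (simp add: ennreal_mult)
  show int: "integrable \<mu> (\<lambda>y. \<Sum>l<\<phi> y. g (proj (y, l)))"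
    by (intro integrableI_nonneg sm) (use spos eq2 in auto)
  show "(\<integral>y. (\<Sum>l<\<phi> y. g (proj (y, l))) \<partial>\<mu>) = mean_height * (\<integral>x. g x \<partial>\<mu>X)"
    using mean_height_ge_1 pos spos by (intro integral_eq_nn_integral[THEN trans] ) (auto simp: eq2 sm)
qed

lemma integral_mu_X:
  fixes g :: "'a \<Rightarrow> real"
  assumes g: "integrable \<mu>X g"
  shows "integrable \<mu> (\<lambda>y. \<Sum>l<\<phi> y. g (proj (y, l)))"
    and "(\<integral>y. (\<Sum>l<\<phi> y. g (proj (y, l))) \<partial>\<mu>) = mean_height * (\<integral>x. g x \<partial>\<mu>X)"
proof -
  let ?p = "\<lambda>x. max (g x) 0" and ?n = "\<lambda>x. max (- g x) 0"
  have i: "integrable \<mu>X ?p" "integrable \<mu>X ?n" using g by auto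
  note p = nonneg_integral_mu_X[OF i(1)] and n = nonneg_integral_mu_X[OF i(2)]
  have split: "(\<Sum>l<\<phi> y. g (proj (y, l))) = (\<Sum>l<\<phi> y. ?p (proj (y, l))) - (\<Sum>l<\<phi> y. ?n (proj (y, l)))" for y
    unfolding sum_subtractf[symmetric] by (intro sum.cong) auto
  have gx: "g x = ?p x - ?n x" for x by auto
  show "integrable \<mu> (\<lambda>y. \<Sum>l<\<phi> y. g (proj (y, l)))"
    unfolding split using p n by (intro Bochner_Integration.integrable_diff) auto
  have "(\<integral>x. g x \<partial>\<mu>X) = (\<integral>x. ?p x \<partial>\<mu>X) - (\<integral>x. ?n x \<partial>\<mu>X)"
    by (subst gx) (rule Bochner_Integration.integral_diff[OF i])
  then show "(\<integral>y. (\<Sum>l<\<phi> y. g (proj (y, l))) \<partial>\<mu>) = mean_height * (\<integral>x. g x \<partial>\<mu>X)"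
    unfolding split using p n by (subst Bochner_Integration.integral_diff) (auto simp: right_diff_distrib)
qed

lemma AE_mu_X_tower:
  assumes "AE x in \<mu>X. Q x"
  shows "AE y in \<mu>. \<forall>l<\<phi> y. Q (proj (y, l))"
proof -
  obtain N where N: "{x \<in> space M. \<not> Q x} \<subseteq> N" "emeasure \<mu>X N = 0" "N \<in> sets M"
    using assms by (auto elim!: AE_E)
  have im: "(indicator N :: 'a \<Rightarrow> ennreal) \<in> borel_measurable M" using N by simp
  have "(\<integral>\<^sup>+x. indicator N x \<partial>\<mu>X) = 0" using N by simp
  then have "(\<integral>\<^sup>+y. (\<Sum>l<\<phi> y. indicator N (proj (y, l)) :: ennreal) \<partial>\<mu>) = 0"
    using nn_integral_mu_X[OF im] mean_height_ge_1 by simp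
  then have "AE y in \<mu>. (\<Sum>l<\<phi> y. indicator N (proj (y, l)) :: ennreal) = 0"
    by (subst (asm) nn_integral_0_iff_AE)
       (auto intro!: column_sum_measurable[OF level_measurable_proj[OF im] phi_meas])
  then show ?thesis using AE_space
  proof eventually_elim
    case (elim y)
    have "proj (y, l) \<in> space M" for l
      using measurable_space[OF orbit_measurable elim(2)] by (simp add: proj_def)
    with elim N(1) show ?case by (auto simp: sum_eq_0_iff indicator_eq_0_iff)
  qed
qed

lemma proj_tower_step: "l < \<phi> y \<Longrightarrow> proj (tower_step \<phi> (y, l)) = T (proj (y, l))"
proof (cases "Suc l < \<phi> y")
  case False
  moreover assume "l < \<phi> y"
  ultimately have "\<phi> y = Suc l" by simp
  then show ?thesis by (simp add: proj_def tower_step_def return_map_def)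
qed (simp add: proj_def tower_step_def)

text \<open>The projected measure is invariant because projection intertwines the tower map with \<open>T\<close>.\<close>

lemma AE_mu_X_T:
  assumes "AE x in \<mu>X. Q x" shows "AE x in \<mu>X. Q (T x)"
proof -
  obtain N where N: "{x \<in> space M. \<not> Q x} \<subseteq> N" "emeasure \<mu>X N = 0" "N \<in> sets M"
    using assms by (auto elim!: AE_E)
  have im: "(indicator N :: 'a \<Rightarrow> ennreal) \<in> borel_measurable M" using N by simp
  have imT: "(\<lambda>x. indicator N (T x) :: ennreal) \<in> borel_measurable M"
    by (rule measurable_compose[OF T_measurable im])
  have "(\<integral>\<^sup>+y. (\<Sum>l<\<phi> y. indicator N (T (proj (y, l))) :: ennreal) \<partial>\<mu>)
      = (\<integral>\<^sup>+y. (\<Sum>l<\<phi> y. indicator N (proj (tower_step \<phi> (y, l)))) \<partial>\<mu>)"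
    by (intro nn_integral_cong sum.cong) (auto simp: proj_tower_step)
  also have "\<dots> = (\<integral>\<^sup>+y. (\<Sum>l<\<phi> y. indicator N (proj (y, l))) \<partial>\<mu>)"
    by (rule nn_integral_tower_step[OF level_measurable_proj[OF im] phi_meas phi_ge])
  finally have "(\<integral>\<^sup>+x. indicator N (T x) \<partial>\<mu>X) = (\<integral>\<^sup>+x. indicator N x \<partial>\<mu>X)"
    by (simp add: nn_integral_mu_X[OF im] nn_integral_mu_X[OF imT])
  also have "\<dots> = 0" using N by simp
  finally have "AE x in \<mu>X. (indicator N (T x) :: ennreal) = 0"
    using imT by (subst (asm) nn_integral_0_iff_AE) auto
  then show ?thesis using AE_space
  proof eventually_elim
    case (elim x)
    have "T x \<in> space M" using elim(2) measurable_space[OF T_measurable] by simp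
    with elim N(1) show ?case by (auto simp: indicator_eq_0_iff)
  qed
qed

lemma AE_mu_X_T_iterate:
  assumes "AE x in \<mu>X. Q x" shows "AE x in \<mu>X. Q ((T ^^ n) x)"
proof (induction n)
  case (Suc n)
  from AE_mu_X_T[OF Suc] show ?case by (simp add: funpow_swap1)
qed (use assms in simp)

end

locale rate_scheme = good_inducing_scheme M T Y \<phi> \<mu> emb R Rn
  for M :: "'a measure" and T :: "'a \<Rightarrow> 'a" and Y :: "'a set"
    and \<phi> :: "'a \<Rightarrow> nat" and \<mu> :: "'a measure" and emb :: "'b::banach \<Rightarrow> 'a \<Rightarrow> real"
    and R :: "('a \<Rightarrow> real) \<Rightarrow> 'a \<Rightarrow> real" and Rn :: "nat \<Rightarrow> 'b \<Rightarrow>\<^sub>L 'b" +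
  fixes a :: "nat \<Rightarrow> real" and p :: real
  assumes nontrivial: "measure \<mu> {y \<in> Y. 1 < \<phi> y} > 0"
    and a_pos': "\<And>k. 1 \<le> k \<Longrightarrow> 0 < a k"
    and p': "0 < p" "p \<le> 1"
    and a_lim': "(\<lambda>k. a k powr p * S_sum Rn p k (a k)) \<longlonglongrightarrow> 0"
begin

sublocale truncation_rate Rn mean const_one a p
proof (rule truncation_rate.intro[OF renewal_operators_axioms truncation_rate_axioms.intro])
  have "0 < norm const_one * r 1"
    using measure_tail_le[of 1] nontrivial by (simp add: space_\<mu>)
  then show "0 < r 1" by (simp add: zero_less_mult_iff)
qed (use a_pos' p' a_lim' in auto)

end

context good_inducing_scheme
begin

section \<open>Renewal in the truncated tower\<close>

lemma tower_step_up: "l + m < \<psi> y \<Longrightarrow> (tower_step \<psi> ^^ m) (y, l) = (y, l + m)"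
  by (induction m) (auto simp: tower_step_def)

lemma tower_step_return:
  assumes "l < \<psi> y" "\<psi> y - l \<le> n"
  shows "(tower_step \<psi> ^^ n) (y, l) = (tower_step \<psi> ^^ (n - (\<psi> y - l))) (F y, 0)"
proof -
  define m where "m = \<psi> y - l - 1"
  have m: "\<psi> y - l = Suc m" "l + m < \<psi> y" "Suc (l + m) = \<psi> y" using assms by (auto simp: m_def)
  have "(tower_step \<psi> ^^ (\<psi> y - l)) (y, l) = (F y, 0)"
    unfolding m(1) using tower_step_up[of l m \<psi> y] m(2,3) by (simp add: tower_step_def)
  moreover have "n = (n - (\<psi> y - l)) + (\<psi> y - l)" using assms by simp
  ultimately show ?thesis by (metis comp_apply funpow_add)
qed

definition trunc :: "nat \<Rightarrow> 'a \<Rightarrow> nat" where "trunc k y = min (\<phi> y) k"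

lemma trunc_measurable [measurable]: "trunc k \<in> measurable \<mu> (count_space UNIV)"
  unfolding trunc_def by measurable

lemma trunc_pos: "k \<ge> 1 \<Longrightarrow> y \<in> space \<mu> \<Longrightarrow> 1 \<le> trunc k y"
  using phi_ge by (simp add: trunc_def)

abbreviation "trstep k \<equiv> tower_step (trunc k)"

text \<open>The two ways in which \<open>w\<close> is seen from the base: after \<open>n\<close> steps of the truncated tower, and at a fixed
  level of the current column.\<close>

definition base_obs :: "nat \<Rightarrow> ('a \<Rightarrow> real) \<Rightarrow> nat \<Rightarrow> 'a \<Rightarrow> real" where
  "base_obs k w n y = w (proj ((trstep k ^^ n) (y, 0)))"

definition level_obs :: "nat \<Rightarrow> ('a \<Rightarrow> real) \<Rightarrow> nat \<Rightarrow> 'a \<Rightarrow> real" where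
  "level_obs k w l y = (if l < trunc k y then w (proj (y, l)) else 0)"

lemma base_obs_bounded:
  assumes "w \<in> borel_measurable M" "\<And>x. \<bar>w x\<bar> \<le> c"
  shows "bounded_measurable c (base_obs k w n)"
proof -
  have "level_measurable borel (\<lambda>p. w (proj ((trstep k ^^ n) p)))"
    by (rule level_measurable_iterate[OF level_measurable_proj[OF assms(1)] trunc_measurable])
  from level_measurableD[OF this, of 0] show ?thesis
    using assms(2) by (simp add: bounded_measurable_def base_obs_def[abs_def])
qed

lemma level_obs_bounded:
  assumes "w \<in> borel_measurable M" "\<And>x. \<bar>w x\<bar> \<le> c"
  shows "bounded_measurable c (level_obs k w l)"
  unfolding level_obs_def
proof (rule bounded_measurable_indicator)
  show "bounded_measurable c (\<lambda>y. w (proj (y, l)))"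
    using level_measurableD[OF level_measurable_proj[OF assms(1)], of l] assms(2)
    by (simp add: bounded_measurable_def)
qed measurable

lemma pairing_add:
  assumes "bounded_measurable c h" "bounded_measurable c' h'"
  shows "pairing (\<lambda>y. h y + h' y) b = pairing h b + pairing h' b"
  unfolding pairing_def distrib_left
  by (intro Bochner_Integration.integral_add integrable_mult_bounded[OF emb_integrable assms(1)]
        integrable_mult_bounded[OF emb_integrable assms(2)])

lemma pairing_sum:
  assumes "\<And>j. j \<in> Z \<Longrightarrow> bounded_measurable c (h j)"
  shows "pairing (\<lambda>y. \<Sum>j\<in>Z. h j y) b = (\<Sum>j\<in>Z. pairing (h j) b)"
  unfolding pairing_def sum_distrib_left
  by (intro Bochner_Integration.integral_sum integrable_mult_bounded[OF emb_integrable assms])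

lemma pairing_cong:
  assumes "\<And>y. y \<in> space \<mu> \<Longrightarrow> h y = h' y" shows "pairing h b = pairing h' b"
  unfolding pairing_def using assms by (intro Bochner_Integration.integral_cong) auto

lemma bounded_measurable_sum:
  assumes "\<And>j. j \<in> Z \<Longrightarrow> bounded_measurable c (h j)"
  shows "bounded_measurable (real (card Z) * c) (\<lambda>y. \<Sum>j\<in>Z. h j y)"
  unfolding bounded_measurable_def
proof (intro conjI allI)
  show "(\<lambda>y. \<Sum>j\<in>Z. h j y) \<in> borel_measurable \<mu>"
    using assms by (intro borel_measurable_sum) (auto simp: bounded_measurable_def)
  show "\<bar>\<Sum>j\<in>Z. h j y\<bar> \<le> real (card Z) * c" for y
    using assms by (intro order.trans[OF sum_abs sum_bounded_above]) (auto simp: bounded_measurable_def)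
qed

lemma pairing_return:
  assumes h: "bounded_measurable c h" and j: "1 \<le> j" "j \<le> k"
  shows "pairing (\<lambda>y. if trunc k y = j then h (F y) else 0) b = pairing h (trRn k j b)"
proof (cases "j < k")
  case True
  have "pairing (\<lambda>y. if trunc k y = j then h (F y) else 0) b = pairing (\<lambda>y. if \<phi> y = j then h (F y) else 0) b"
    using True by (intro pairing_cong) (auto simp: trunc_def)
  also have "\<dots> = pairing h (Rn j b)" by (rule pairing_Rn[OF h j(1), symmetric])
  finally show ?thesis using True by (simp add: trRn_def)
next
  case False
  have "pairing (\<lambda>y. if trunc k y = j then h (F y) else 0) b = pairing (\<lambda>y. if k - 1 < \<phi> y then h (F y) else 0) b"
    using False j by (intro pairing_cong) (auto simp: trunc_def)
  also have "\<dots> = pairing h (Rt (k - 1) b)" by (rule pairing_tail_op[OF h, symmetric])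
  finally show ?thesis using False by (simp add: trRn_def)
qed

text \<open>Either the column is still being climbed at time \<open>n\<close>, or the first return happened at some
  time \<open>j \<le> n\<close>, and the path restarts there.\<close>

lemma base_obs_renewal:
  assumes w: "w \<in> borel_measurable M" "\<And>x. \<bar>w x\<bar> \<le> c" and k: "k \<ge> 1"
  shows "pairing (base_obs k w n) b = (if n < k then pairing (level_obs k w n) b else 0)
     + (\<Sum>j=1..min n k. pairing (base_obs k w (n - j)) (trRn k j b))"
proof -
  have pt: "base_obs k w n y = level_obs k w n y
      + (\<Sum>j=1..min n k. if trunc k y = j then base_obs k w (n - j) (F y) else 0)"
    if y: "y \<in> space \<mu>" for y
  proof (cases "n < trunc k y")
    case True
    then have "(trstep k ^^ n) (y, 0) = (y, n)" using tower_step_up[of 0 n "trunc k" y] by simp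
    then show ?thesis using True by (simp add: base_obs_def level_obs_def)
  next
    case False
    have t: "1 \<le> trunc k y" "trunc k y \<le> k" using trunc_pos[OF k y] by (auto simp: trunc_def)
    have "(trstep k ^^ n) (y, 0) = (trstep k ^^ (n - trunc k y)) (F y, 0)"
      using tower_step_return[of 0 "trunc k" y n] t False by simp
    then have "base_obs k w n y = base_obs k w (n - trunc k y) (F y)" by (simp add: base_obs_def)
    moreover have "(\<Sum>j=1..min n k. if trunc k y = j then base_obs k w (n - j) (F y) else 0)
        = base_obs k w (n - trunc k y) (F y)"
      using t False by (subst sum.delta') auto
    ultimately show ?thesis using False by (simp add: level_obs_def)
  qed
  have bm: "bounded_measurable c (\<lambda>y. if trunc k y = j then base_obs k w (n - j) (F y) else 0)" for j
    by (intro bounded_measurable_indicator bounded_measurable_comp_F base_obs_bounded w) measurable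
  have "pairing (base_obs k w n) b = pairing (level_obs k w n) b
      + (\<Sum>j=1..min n k. pairing (\<lambda>y. if trunc k y = j then base_obs k w (n - j) (F y) else 0) b)"
    unfolding pairing_sum[OF bm, symmetric]
      pairing_add[OF level_obs_bounded[OF w] bounded_measurable_sum[OF bm], symmetric]
    by (rule pairing_cong) (rule pt)
  also have "(\<Sum>j=1..min n k. pairing (\<lambda>y. if trunc k y = j then base_obs k w (n - j) (F y) else 0) b)
      = (\<Sum>j=1..min n k. pairing (base_obs k w (n - j)) (trRn k j b))"
    by (intro sum.cong refl pairing_return[OF base_obs_bounded[OF w]]) auto
  also have "pairing (level_obs k w n) b = (if n < k then pairing (level_obs k w n) b else 0)"
    by (auto simp: pairing_def level_obs_def trunc_def)
  finally show ?thesis .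
qed

text \<open>The value of \<open>v\<close> at \<open>Suc j\<close> steps before the truncated return. Columns too low for this get the value at the
  base, so that the function is derived from \<open>v\<close>; the operator \<open>Rt j\<close> does not see them.\<close>

definition derived_obs :: "nat \<Rightarrow> ('a \<Rightarrow> real) \<Rightarrow> nat \<Rightarrow> 'a \<Rightarrow> real" where
  "derived_obs k v j y = v (proj (y, if j < trunc k y then trunc k y - Suc j else 0))"

lemma derived_obs_derived: "derived_from T Y \<phi> v (derived_obs k v j)"
  unfolding derived_from_def
proof (intro allI impI)
  fix n :: nat assume "1 \<le> n"
  then show "\<exists>i\<in>{0..n - 1}. \<forall>y\<in>Y. \<phi> y = n \<longrightarrow> derived_obs k v j y = v ((T ^^ i) y)"
    by (intro bexI[of _ "if j < min n k then min n k - Suc j else 0"])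
       (auto simp: derived_obs_def proj_def trunc_def)
qed

lemma derived_obs_in_space:
  assumes v: "v \<in> B_X M T Y \<phi> \<mu> emb"
  obtains b where "\<And>j. AE y in \<mu>. emb (b j) y = derived_obs k v j y"
    "\<And>j. norm (b j) \<le> exch_norm T Y \<phi> \<mu> emb v"
proof -
  have ex: "exchangeable T Y \<phi> \<mu> emb v" using v by (simp add: B_X_def)
  then have "\<exists>b. AE y in \<mu>. emb b y = derived_obs k v j y" for j
    using derived_obs_derived unfolding exchangeable_def by blast
  then obtain b where b: "\<And>j. AE y in \<mu>. emb (b j) y = derived_obs k v j y" by metis
  have "b j \<in> derived_set T Y \<phi> \<mu> emb v" for j
    using b derived_obs_derived unfolding derived_set_def by blast
  moreover have "bdd_above (norm ` derived_set T Y \<phi> \<mu> emb v)"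
    using ex unfolding exchangeable_def bounded_iff bdd_above_def by auto
  ultimately have "norm (b j) \<le> exch_norm T Y \<phi> \<mu> emb v" for j
    unfolding exch_norm_def by (intro cSUP_upper)
  with b show ?thesis by (rule that)
qed

text \<open>As \<open>n \<ge> k\<close>, every point of the truncated tower has returned by time \<open>n\<close>. Sorting the points by the
  time \<open>Suc j\<close> of the first return gives one term per \<open>j\<close>.\<close>

lemma truncated_correlation_eq:
  assumes v: "v \<in> borel_measurable M" and w: "w \<in> borel_measurable M" "\<And>x. \<bar>w x\<bar> \<le> c"
    and k: "k \<ge> 1" "k \<le> n" and b: "\<And>j. AE y in \<mu>. emb (b j) y = derived_obs k v j y"
  shows "(\<integral>y. (\<Sum>l<trunc k y. v (proj (y, l)) * w (proj ((trstep k ^^ n) (y, l)))) \<partial>\<mu>)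
       = (\<Sum>j<k. pairing (base_obs k w (n - 1 - j)) (Rt j (b j)))"
proof -
  let ?h = "\<lambda>j y. if j < \<phi> y then base_obs k w (n - Suc j) (F y) else 0"
  have bm: "bounded_measurable c (?h j)" for j
    by (intro bounded_measurable_indicator bounded_measurable_comp_F base_obs_bounded w) measurable
  have pt: "(\<Sum>l<trunc k y. v (proj (y, l)) * w (proj ((trstep k ^^ n) (y, l))))
      = (\<Sum>j<k. derived_obs k v j y * ?h j y)" if y: "y \<in> space \<mu>" for y
  proof -
    have "(\<Sum>l<trunc k y. v (proj (y, l)) * w (proj ((trstep k ^^ n) (y, l))))
        = (\<Sum>j<trunc k y. v (proj (y, trunc k y - Suc j)) * w (proj ((trstep k ^^ n) (y, trunc k y - Suc j))))"
      by (rule sum.nat_diff_reindex[symmetric])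
    also have "\<dots> = (\<Sum>j<trunc k y. derived_obs k v j y * ?h j y)"
    proof (rule sum.cong[OF refl])
      fix j assume j: "j \<in> {..<trunc k y}"
      then have j': "j < \<phi> y" "j < k" by (auto simp: trunc_def)
      have "(trstep k ^^ n) (y, trunc k y - Suc j) = (trstep k ^^ (n - Suc j)) (F y, 0)"
        using tower_step_return[of "trunc k y - Suc j" "trunc k" y n] j j' k by simp
      then show "v (proj (y, trunc k y - Suc j)) * w (proj ((trstep k ^^ n) (y, trunc k y - Suc j)))
          = derived_obs k v j y * ?h j y"
        using j j' by (simp add: derived_obs_def base_obs_def)
    qed
    also have "\<dots> = (\<Sum>j<k. derived_obs k v j y * ?h j y)"
      by (rule sum.mono_neutral_left) (auto simp: trunc_def)
    finally show ?thesis .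
  qed
  have "level_measurable borel (\<lambda>p. v (proj p) * w (proj ((trstep k ^^ n) p)))"
    using level_measurableD[OF level_measurable_proj[OF v]]
      level_measurableD[OF level_measurable_iterate[OF level_measurable_proj[OF w(1)] trunc_measurable]]
    by (simp add: level_measurable_def)
  from column_sum_measurable[OF this trunc_measurable]
  have m1: "(\<lambda>y. \<Sum>l<trunc k y. v (proj (y, l)) * w (proj ((trstep k ^^ n) (y, l)))) \<in> borel_measurable \<mu>" .
  have m2: "(\<lambda>y. \<Sum>j<k. emb (b j) y * ?h j y) \<in> borel_measurable \<mu>"
    using bm by (intro borel_measurable_sum borel_measurable_times) (auto simp: bounded_measurable_def)
  have "AE y in \<mu>. \<forall>j. emb (b j) y = derived_obs k v j y" using b by (simp add: AE_all_countable)
  then have "AE y in \<mu>. (\<Sum>l<trunc k y. v (proj (y, l)) * w (proj ((trstep k ^^ n) (y, l))))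
      = (\<Sum>j<k. emb (b j) y * ?h j y)"
    using AE_space by eventually_elim (simp add: pt)
  then have "(\<integral>y. (\<Sum>l<trunc k y. v (proj (y, l)) * w (proj ((trstep k ^^ n) (y, l)))) \<partial>\<mu>)
      = (\<integral>y. (\<Sum>j<k. emb (b j) y * ?h j y) \<partial>\<mu>)"
    by (rule integral_cong_AE[OF m1 m2])
  also have "\<dots> = (\<Sum>j<k. pairing (?h j) (b j))"
    unfolding pairing_def
    by (intro Bochner_Integration.integral_sum integrable_mult_bounded[OF emb_integrable bm])
  also have "\<dots> = (\<Sum>j<k. pairing (base_obs k w (n - 1 - j)) (Rt j (b j)))"
    by (intro sum.cong refl) (simp add: pairing_tail_op[OF base_obs_bounded[OF w]])
  finally show ?thesis .
qed

lemma truncated_integral_eq: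
  assumes v: "v \<in> borel_measurable M"
    and k: "k \<ge> 1" and b: "\<And>j. AE y in \<mu>. emb (b j) y = derived_obs k v j y"
  shows "(\<integral>y. (\<Sum>l<trunc k y. v (proj (y, l))) \<partial>\<mu>) = (\<Sum>j<k. mean (Rt j (b j)))"
  using truncated_correlation_eq[OF v, of "\<lambda>_. 1" 1 k k b] k b by (simp add: base_obs_def[abs_def])

lemma level_obs_integral_sum:
  assumes w: "w \<in> borel_measurable M" "\<And>x. \<bar>w x\<bar> \<le> c"
  shows "(\<integral>y. (\<Sum>l<trunc k y. w (proj (y, l))) \<partial>\<mu>) = (\<Sum>l<k. pairing (level_obs k w l) const_one)"
proof -
  have bm: "bounded_measurable c (level_obs k w l)" for l by (rule level_obs_bounded[OF w])
  have int: "integrable \<mu> (level_obs k w l)" for l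
    using integrable_mult_bounded[of "\<lambda>_. 1", OF _ bm] by simp
  have "(\<Sum>l<trunc k y. w (proj (y, l))) = (\<Sum>l<k. level_obs k w l y)" for y
  proof -
    have "(\<Sum>l<trunc k y. w (proj (y, l))) = (\<Sum>l<trunc k y. level_obs k w l y)"
      by (intro sum.cong) (auto simp: level_obs_def)
    also have "\<dots> = (\<Sum>l<k. level_obs k w l y)"
      by (rule sum.mono_neutral_left) (auto simp: level_obs_def trunc_def)
    finally show ?thesis .
  qed
  then show ?thesis
    using bm int by (simp add: Bochner_Integration.integral_sum pairing_one bounded_measurable_def)
qed

lemma mean_return_eq_integral: "mean_return k = (\<integral>y. real (trunc k y) \<partial>\<mu>)"
proof -
  have "(\<integral>y. (\<Sum>l<trunc k y. 1) \<partial>\<mu>) = (\<Sum>l<k. pairing (level_obs k (\<lambda>_. 1) l) const_one)"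
    by (rule level_obs_integral_sum[of "\<lambda>_. 1" 1]) auto
  also have "pairing (level_obs k (\<lambda>_. 1) l) const_one = mean (Rt l const_one)" if "l < k" for l
  proof -
    have "pairing (level_obs k (\<lambda>_. 1) l) const_one = pairing (\<lambda>y. if l < \<phi> y then 1 else 0) const_one"
      using that by (intro pairing_cong) (auto simp: level_obs_def trunc_def)
    then show ?thesis by (simp add: pairing_tail_op[OF bounded_measurable_1])
  qed
  then have "(\<Sum>l<k. pairing (level_obs k (\<lambda>_. 1) l) const_one) = mean_return k"
    unfolding mean_return_def by (intro sum.cong) auto
  finally show ?thesis by simp
qed

lemma level_obs_const_le:
  assumes w: "w \<in> borel_measurable M" "\<And>x. \<bar>w x\<bar> \<le> c"
  shows "\<bar>pairing (level_obs k w l) const_one\<bar> \<le> c * measure \<mu> {y \<in> space \<mu>. l < \<phi> y}"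
proof -
  have c: "c \<ge> 0" using w(2) by (meson abs_ge_zero order.trans)
  have bm: "bounded_measurable c (level_obs k w l)" by (rule level_obs_bounded[OF w])
  have S: "{y \<in> space \<mu>. l < \<phi> y} \<in> sets \<mu>" by measurable
  have "\<bar>pairing (level_obs k w l) const_one\<bar> \<le> (\<integral>y. c * indicator {y \<in> space \<mu>. l < \<phi> y} y \<partial>\<mu>)"
    unfolding pairing_one[OF bm[unfolded bounded_measurable_def, THEN conjunct1]] real_norm_def[symmetric]
  proof (rule order.trans[OF integral_norm_bound integral_mono])
    show "integrable \<mu> (\<lambda>y. norm (level_obs k w l y))"
      using integrable_mult_bounded[of "\<lambda>_. 1", OF _ bm] by simp
    show "integrable \<mu> (\<lambda>y. c * indicat_real {y \<in> space \<mu>. l < \<phi> y} y)"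
      using S by (intro integrable_mult_right integrable_real_indicator) (auto simp: emeasure_eq_measure)
    show "norm (level_obs k w l y) \<le> c * indicat_real {y \<in> space \<mu>. l < \<phi> y} y" if "y \<in> space \<mu>" for y
      using that w(2) c by (auto simp: level_obs_def trunc_def indicator_def)
  qed
  then show ?thesis using S by simp
qed

lemma level_obs_Linf_le:
  assumes w: "w \<in> borel_measurable M" "\<And>x. \<bar>w x\<bar> \<le> c"
    and K: "AE y in \<mu>. \<bar>emb b y\<bar> \<le> B" "B \<ge> 0"
  shows "\<bar>pairing (level_obs k w l) b\<bar> \<le> B * c * measure \<mu> {y \<in> space \<mu>. l < \<phi> y}"
proof -
  have c: "c \<ge> 0" using w(2) by (meson abs_ge_zero order.trans)
  have bm: "bounded_measurable c (level_obs k w l)" by (rule level_obs_bounded[OF w])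
  have S: "{y \<in> space \<mu>. l < \<phi> y} \<in> sets \<mu>" by measurable
  have "\<bar>pairing (level_obs k w l) b\<bar> \<le> (\<integral>y. B * c * indicator {y \<in> space \<mu>. l < \<phi> y} y \<partial>\<mu>)"
    unfolding pairing_def real_norm_def[symmetric]
  proof (rule order.trans[OF integral_norm_bound integral_mono_AE])
    show "integrable \<mu> (\<lambda>y. norm (emb b y * level_obs k w l y))"
      by (intro integrable_norm integrable_mult_bounded[OF emb_integrable bm])
    show "integrable \<mu> (\<lambda>y. B * c * indicat_real {y \<in> space \<mu>. l < \<phi> y} y)"
      using S by (intro integrable_mult_right integrable_real_indicator) (auto simp: emeasure_eq_measure)
    show "AE y in \<mu>. norm (emb b y * level_obs k w l y) \<le> B * c * indicat_real {y \<in> space \<mu>. l < \<phi> y} y"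
      using K(1) AE_space
    proof eventually_elim
      case (elim y)
      have "\<bar>emb b y\<bar> * \<bar>level_obs k w l y\<bar> \<le> B * (c * indicat_real {y \<in> space \<mu>. l < \<phi> y} y)"
        using elim w(2) c K(2) by (intro mult_mono) (auto simp: level_obs_def trunc_def indicator_def)
      then show ?case by (simp add: abs_mult mult.assoc)
    qed
  qed
  then show ?thesis using S by simp
qed

text \<open>The correlation on the truncated tower, with unnormalised measure.\<close>

definition truncated_corr :: "nat \<Rightarrow> ('a \<Rightarrow> real) \<Rightarrow> ('a \<Rightarrow> real) \<Rightarrow> nat \<Rightarrow> real" where
  "truncated_corr k v w n =
     (\<integral>y. (\<Sum>l<trunc k y. v (proj (y, l)) * w (proj ((trstep k ^^ n) (y, l)))) \<partial>\<mu>)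
     - (\<integral>y. (\<Sum>l<trunc k y. v (proj (y, l))) \<partial>\<mu>) * (\<integral>y. (\<Sum>l<trunc k y. w (proj (y, l))) \<partial>\<mu>) / mean_return k"

end

context rate_scheme
begin

definition truncated_estimate :: "real \<Rightarrow> real \<Rightarrow> nat \<Rightarrow> bool" where
  "truncated_estimate q C k \<longleftrightarrow> (\<forall>v w c n \<omega>0 \<omega>1. v \<in> B_X M T Y \<phi> \<mu> emb \<longrightarrow>
       w \<in> borel_measurable M \<longrightarrow> (\<forall>x. \<bar>w x\<bar> \<le> c) \<longrightarrow> k \<le> n \<longrightarrow>
       (\<forall>x. (\<Sum>l<k. exp (real l * a k) * \<bar>pairing (level_obs k w l) x\<bar>) \<le> \<omega>0 * norm x) \<longrightarrow>
       (\<Sum>l<k. real l powr q * exp (real l * a k) * \<bar>pairing (level_obs k w l) const_one\<bar>) \<le> \<omega>1 \<longrightarrow>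
       \<bar>truncated_corr k v w n\<bar> \<le> C * exch_norm T Y \<phi> \<mu> emb v
          * (\<omega>0 * S_sum Rn q k (a k) + \<omega>1) * exp (- real n * a k))"

text \<open>The coefficient in question has index \<open>n - 1\<close>, since the first return takes at least one step; the lost factor
  \<open>exp (a k)\<close> is at most \<open>2\<close>.\<close>

theorem truncated_corr_decay:
  assumes q: "0 < q" "q \<le> 1"
  obtains C where "C > 0" "\<forall>\<^sub>F k in sequentially. truncated_estimate q C k"
proof -
  obtain C where C: "C > 0" "\<forall>\<^sub>F k in sequentially. renewal_estimate q C k"
    by (rule renewal_coefficient_decay[OF q])
  show ?thesis
  proof (rule that[of "2 * C"])
    show "2 * C > 0" using C(1) by simp
    have "\<forall>\<^sub>F k in sequentially. a k \<le> ln 2" by (rule eventually_a_le) simp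
    then show "\<forall>\<^sub>F k in sequentially. truncated_estimate q (2 * C) k"
      using C(2) eventually_ge_at_top[of 1]
    proof eventually_elim
      case (elim k)
      show ?case
        unfolding truncated_estimate_def
      proof (intro allI impI)
        fix v w c n \<omega>0 \<omega>1
        assume v: "v \<in> B_X M T Y \<phi> \<mu> emb" and w: "w \<in> borel_measurable M" "\<forall>x. \<bar>w x\<bar> \<le> c"
          and n: "k \<le> n"
          and \<omega>0: "\<forall>x. (\<Sum>l<k. exp (real l * a k) * \<bar>pairing (level_obs k w l) x\<bar>) \<le> \<omega>0 * norm x"
          and \<omega>1: "(\<Sum>l<k. real l powr q * exp (real l * a k) * \<bar>pairing (level_obs k w l) const_one\<bar>) \<le> \<omega>1"
        have w2: "\<And>x. \<bar>w x\<bar> \<le> c" using w by blast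
        define V where "V = exch_norm T Y \<phi> \<mu> emb v"
        obtain b where b: "\<And>j. AE y in \<mu>. emb (b j) y = derived_obs k v j y" "\<And>j. norm (b j) \<le> V"
          unfolding V_def by (rule derived_obs_in_space[OF v]) blast
        have V: "V \<ge> 0" using b(2)[of 0] norm_ge_zero order.trans by blast
        have vm: "v \<in> borel_measurable M"
          using v borel_measurable_integrable[of \<mu>X v] by (auto simp: B_X_def)
        note bm = base_obs_bounded[OF w(1) w2, of k] and lm = level_obs_bounded[OF w(1) w2, of k]
        have nb: "norm (Rt j (b j)) \<le> V * r j" for j
          using norm_blinfun[of "Rt j" "b j"] mult_mono[OF norm_tail_op_le[of j] b(2)[of j] tail_norm_nonneg norm_ge_zero]
          by (simp add: mult.commute)
        have "\<bar>(\<Sum>j<k. pairing (base_obs k w (n - 1 - j)) (Rt j (b j)))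
            - (\<Sum>j<k. mean (Rt j (b j))) * (\<Sum>l<k. pairing (level_obs k w l) const_one) / mean_return k\<bar>
          \<le> C * V * (\<omega>0 * S_sum Rn q k (a k) + \<omega>1) * exp (- real (n - 1) * a k)"
        proof (rule elim(2)[unfolded renewal_estimate_def, rule_format, where W = "\<lambda>l. pairing (level_obs k w l)"
              and c = "\<lambda>m. pairing (base_obs k w m)" and b = "\<lambda>j. Rt j (b j)"
              and n = "n - 1" and K = c and V = V])
          show "bounded_linear (pairing (level_obs k w l))" for l by (rule pairing_linear[OF lm])
          show "bounded_linear (pairing (base_obs k w m))" for m by (rule pairing_linear[OF bm])
          show "\<bar>pairing (base_obs k w m) x\<bar> \<le> c * norm x" for m x by (rule pairing_le[OF bm])
          show "pairing (base_obs k w m) x = (if m < k then pairing (level_obs k w m) x else 0)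
              + (\<Sum>j=1..min m k. pairing (base_obs k w (m - j)) (trRn k j x))" for m x
            by (rule base_obs_renewal[OF w(1) w2 elim(3)])
          show "(\<Sum>l<k. exp (real l * a k) * \<bar>pairing (level_obs k w l) x\<bar>) \<le> \<omega>0 * norm x" for x
            using \<omega>0 by blast
          show "norm (Rt j (b j)) \<le> V * r j" for j by (rule nb)
        qed (use \<omega>1 V n in auto)
        also have "(\<Sum>j<k. pairing (base_obs k w (n - 1 - j)) (Rt j (b j)))
            - (\<Sum>j<k. mean (Rt j (b j))) * (\<Sum>l<k. pairing (level_obs k w l) const_one) / mean_return k = truncated_corr k v w n"
          unfolding truncated_corr_def truncated_correlation_eq[OF vm w(1) w2 elim(3) n b(1)]
            truncated_integral_eq[OF vm elim(3) b(1)] level_obs_integral_sum[OF w(1) w2] ..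
        also have "exp (- real (n - 1) * a k) = exp (a k) * exp (- real n * a k)"
          using n elim(3) by (simp add: of_nat_diff algebra_simps flip: exp_add)
        also have "C * V * (\<omega>0 * S_sum Rn q k (a k) + \<omega>1) * (exp (a k) * exp (- real n * a k))
            \<le> C * V * (\<omega>0 * S_sum Rn q k (a k) + \<omega>1) * (2 * exp (- real n * a k))"
        proof (intro mult_left_mono mult_right_mono mult_nonneg_nonneg add_nonneg_nonneg)
          show "exp (a k) \<le> 2" using elim(1) by (metis exp_le_cancel_iff exp_ln zero_less_numeral)
          have "0 \<le> \<omega>0 * norm const_one"
            by (rule order.trans[OF _ \<omega>0[rule_format]]) (auto intro!: sum_nonneg)
          then show "0 \<le> \<omega>0" using norm_e_ge by (auto simp: zero_le_mult_iff)
          show "0 \<le> \<omega>1" by (rule order.trans[OF _ \<omega>1]) (auto intro!: sum_nonneg)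
          show "0 \<le> S_sum Rn q k (a k)" using tail_le_S_sum[OF elim(3)] tail_pos by (meson less_imp_le order.trans)
        qed (use C(1) V in auto)
        finally show "\<bar>truncated_corr k v w n\<bar> \<le> 2 * C * exch_norm T Y \<phi> \<mu> emb v
          * (\<omega>0 * S_sum Rn q k (a k) + \<omega>1) * exp (- real n * a k)"
          by (simp add: V_def mult_ac)
      qed
    qed
  qed
qed

end

context good_inducing_scheme
begin

section \<open>The cost of truncation\<close>

definition entered :: "nat \<Rightarrow> 'a \<times> nat \<Rightarrow> bool" where
  "entered k q \<longleftrightarrow> snd q = 0 \<and> k < \<phi> (fst q)"

text \<open>The starting points whose path meets a column higher than \<open>k\<close> within \<open>n\<close> steps.\<close>

definition bad :: "nat \<Rightarrow> nat \<Rightarrow> 'a \<times> nat \<Rightarrow> bool" where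
  "bad k n q \<longleftrightarrow> k < \<phi> (fst q) \<or> (\<exists>i\<in>{1..n}. entered k ((trstep k ^^ i) q))"

lemma entered_level_measurable: "level_measurable (count_space UNIV) (entered k)"
  unfolding level_measurable_def entered_def by simp

lemma bad_level_pred: "Measurable.pred \<mu> (\<lambda>y. bad k n (y, l))"
proof -
  have [measurable]: "Measurable.pred \<mu> (\<lambda>y. entered k ((trstep k ^^ i) (y, l)))" for i
    by (rule level_measurableD[OF level_measurable_iterate[OF entered_level_measurable trunc_measurable]])
  show ?thesis unfolding bad_def fst_conv by measurable
qed

text \<open>As long as only columns of height at most \<open>k\<close> are met, the two tower maps agree, and the tower map
  projects to \<open>T\<close>.\<close>

lemma good_path:
  assumes y: "y \<in> space \<mu>" "l < \<phi> y" and good: "\<not> bad k n (y, l)"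
  shows "proj ((trstep k ^^ n) (y, l)) = (T ^^ n) (proj (y, l))"
proof -
  let ?q = "\<lambda>i. (trstep k ^^ i) (y, l)"
  have "fst (?q i) \<in> space \<mu> \<and> snd (?q i) < \<phi> (fst (?q i)) \<and> \<phi> (fst (?q i)) \<le> k
      \<and> proj (?q i) = (T ^^ i) (proj (y, l))" if "i \<le> n" for i
    using that
  proof (induction i)
    case 0
    then show ?case using y good by (simp add: bad_def)
  next
    case (Suc i)
    then have IH: "fst (?q i) \<in> space \<mu>" "snd (?q i) < \<phi> (fst (?q i))" "\<phi> (fst (?q i)) \<le> k"
      "proj (?q i) = (T ^^ i) (proj (y, l))" by auto
    have step: "?q (Suc i) = tower_step \<phi> (?q i)"
      using IH(3) by (simp add: tower_step_def trunc_def)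
    have "proj (?q (Suc i)) = T (proj (?q i))"
      unfolding step using proj_tower_step[of "snd (?q i)" "fst (?q i)"] IH(2) by simp
    moreover have "fst (?q (Suc i)) \<in> space \<mu> \<and> snd (?q (Suc i)) < \<phi> (fst (?q (Suc i))) \<and> \<phi> (fst (?q (Suc i))) \<le> k"
    proof (cases "Suc (snd (?q i)) < \<phi> (fst (?q i))")
      case True
      then show ?thesis unfolding step using IH by (simp add: tower_step_def)
    next
      case False
      then have q: "?q (Suc i) = (F (fst (?q i)), 0)" unfolding step by (simp add: tower_step_def)
      have sp: "F (fst (?q i)) \<in> space \<mu>" using F_into IH(1) by (simp add: space_\<mu>)
      have "\<not> entered k (?q (Suc i))" using good Suc.prems unfolding bad_def by fastforce
      then show ?thesis using sp phi_ge[OF sp] unfolding q by (auto simp: entered_def)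
    qed
    ultimately show ?case using IH(4) by simp
  qed
  from this[of n] show ?thesis by simp
qed

abbreviation "tailm k \<equiv> measure \<mu> {y \<in> space \<mu>. k < \<phi> y}"

lemma tailm_tail_sum:
  "summable (\<lambda>j. tailm (j + Suc k))"
  "(\<Sum>\<^sub>\<infinity>j\<in>{k<..}. tailm j) = (\<Sum>j. tailm (j + Suc k))"
proof -
  have "summable tailm"
    using measure_tail_le summable_mult[OF summable_tail_norm, of "norm const_one"]
    by (intro summable_comparison_test[of tailm "\<lambda>j. norm const_one * r j"]) auto
  then show s: "summable (\<lambda>j. tailm (j + Suc k))" by (rule summable_ignore_initial_segment)
  have "inj_on (\<lambda>j. j + Suc k) UNIV" by (auto simp: inj_on_def)
  moreover have "{k<..} = range (\<lambda>j. j + Suc k)"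
  proof (intro equalityI subsetI)
    fix x assume "x \<in> {k<..}"
    then have "x = (x - Suc k) + Suc k" by auto
    then show "x \<in> range (\<lambda>j. j + Suc k)" by blast
  qed auto
  ultimately have "(\<Sum>\<^sub>\<infinity>j\<in>{k<..}. tailm j) = (\<Sum>\<^sub>\<infinity>j. tailm (j + Suc k))"
    using infsum_reindex[of "\<lambda>j. j + Suc k" UNIV tailm] by (simp add: o_def)
  also have "\<dots> = (\<Sum>j. tailm (j + Suc k))"
    using s by (intro infsumI norm_summable_imp_has_sum summable_sums) auto
  finally show "(\<Sum>\<^sub>\<infinity>j\<in>{k<..}. tailm j) = (\<Sum>j. tailm (j + Suc k))" .
qed

lemma tail_error_nonneg: "tail_error \<phi> \<mu> n k \<ge> 0"
  unfolding tail_error_def by (intro add_nonneg_nonneg infsum_nonneg) auto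

lemma high_column_measure:
  "(\<integral>\<^sup>+y. (if k < \<phi> y then of_nat (\<phi> y) else 0) \<partial>\<mu>)
     = ennreal (real (Suc k) * tailm k + (\<Sum>\<^sub>\<infinity>j\<in>{k<..}. tailm j))"
proof -
  \<comment> \<open>On \<open>{\<phi> > k}\<close>, write \<open>\<phi>\<close> as \<open>Suc k\<close> plus the number of \<open>j > k\<close> with \<open>j < \<phi>\<close>.\<close>
  define Z where "Z j = {y \<in> space \<mu>. j < \<phi> y}" for j
  have Z: "Z j \<in> sets \<mu>" for j unfolding Z_def by measurable
  have im: "(indicator (Z j) :: 'a \<Rightarrow> ennreal) \<in> borel_measurable \<mu>" for j
    using Z by (rule borel_measurable_indicator)
  have sm: "(\<lambda>y. \<Sum>j. indicator (Z (j + Suc k)) y :: ennreal) \<in> borel_measurable \<mu>"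
    by (rule borel_measurable_suminf_order) (rule im)
  have cm: "(\<lambda>y. ennreal (real (Suc k)) * indicator (Z k) y) \<in> borel_measurable \<mu>"
    using im[of k] by simp
  have "(\<integral>\<^sup>+y. (if k < \<phi> y then of_nat (\<phi> y) else 0) \<partial>\<mu>)
      = (\<integral>\<^sup>+y. ennreal (real (Suc k)) * indicator (Z k) y + (\<Sum>j. indicator (Z (j + Suc k)) y) \<partial>\<mu>)"
  proof (rule nn_integral_cong)
    fix y assume y: "y \<in> space \<mu>"
    have ind: "indicator (Z j) y = (if j < \<phi> y then 1 else 0 :: ennreal)" for j
      using y by (simp add: Z_def)
    have "(\<Sum>j. indicator (Z (j + Suc k)) y :: ennreal) = (\<Sum>j<\<phi> y - Suc k. indicator (Z (j + Suc k)) y)"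
      by (rule suminf_finite) (auto simp: ind)
    also have "\<dots> = (\<Sum>j<\<phi> y - Suc k. 1)" by (intro sum.cong) (auto simp: ind)
    finally have *: "(\<Sum>j. indicator (Z (j + Suc k)) y :: ennreal) = of_nat (\<phi> y - Suc k)" by simp
    show "(if k < \<phi> y then of_nat (\<phi> y) else 0 :: ennreal)
        = ennreal (real (Suc k)) * indicator (Z k) y + (\<Sum>j. indicator (Z (j + Suc k)) y)"
    proof (cases "k < \<phi> y")
      case True
      then have "\<phi> y = Suc k + (\<phi> y - Suc k)" by simp
      then have "of_nat (\<phi> y) = (of_nat (Suc k) + of_nat (\<phi> y - Suc k) :: ennreal)" by (metis of_nat_add)
      also have "of_nat (Suc k) = ennreal (real (Suc k))" by (rule ennreal_of_nat_eq_real_of_nat)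
      finally show ?thesis unfolding * unfolding ind using True by (simp only: if_True mult_1_right)
    next
      case False
      then show ?thesis unfolding * unfolding ind by simp
    qed
  qed
  also have "\<dots> = (\<integral>\<^sup>+y. ennreal (real (Suc k)) * indicator (Z k) y \<partial>\<mu>)
      + (\<integral>\<^sup>+y. (\<Sum>j. indicator (Z (j + Suc k)) y) \<partial>\<mu>)"
    by (rule nn_integral_add[OF cm sm])
  also have "(\<integral>\<^sup>+y. ennreal (real (Suc k)) * indicator (Z k) y \<partial>\<mu>) = ennreal (real (Suc k)) * emeasure \<mu> (Z k)"
    using Z by (rule nn_integral_cmult_indicator)
  also have "\<dots> = ennreal (real (Suc k) * tailm k)"
    unfolding emeasure_eq_measure Z_def by (rule ennreal_mult[symmetric]) auto
  also have "(\<integral>\<^sup>+y. (\<Sum>j. indicator (Z (j + Suc k)) y) \<partial>\<mu>) = (\<Sum>j. \<integral>\<^sup>+y. indicator (Z (j + Suc k)) y \<partial>\<mu>)"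
    by (rule nn_integral_suminf) (rule im)
  also have "\<dots> = (\<Sum>j. ennreal (tailm (j + Suc k)))"
  proof -
    have "(\<integral>\<^sup>+y. indicator (Z j) y \<partial>\<mu>) = ennreal (tailm j)" for j
      using nn_integral_indicator[OF Z, of j] by (simp add: emeasure_eq_measure Z_def)
    then show ?thesis by simp
  qed
  also have "\<dots> = ennreal (\<Sum>\<^sub>\<infinity>j\<in>{k<..}. tailm j)"
    unfolding tailm_tail_sum(2) by (rule suminf_ennreal2[OF _ tailm_tail_sum(1)]) simp
  finally show ?thesis
    by (subst ennreal_plus) (auto intro!: infsum_nonneg)
qed

text \<open>Points in high columns are counted by \<open>high_column_measure\<close>. Every other bad point enters
  \<open>{\<phi> > k} \<times> {0}\<close> at one of \<open>n\<close> times, and by invariance each of these times costs \<open>\<mu>(\<phi> > k)\<close>. The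
  constant \<open>3\<close> comes from \<open>Suc k + n \<le> 3 n\<close>.\<close>

lemma bad_measure_le:
  assumes k: "1 \<le> k" "k \<le> n"
  shows "(\<integral>\<^sup>+y. (\<Sum>l<\<phi> y. if bad k n (y, l) then 1 else 0) \<partial>\<mu>) \<le> ennreal (3 * tail_error \<phi> \<mu> n k)"
proof -
  let ?H = "\<lambda>q. if entered k q then 1 else 0 :: ennreal"
  have H: "level_measurable borel ?H"
    unfolding level_measurable_def entered_def by simp
  have It: "(\<integral>\<^sup>+y. (\<Sum>l<trunc k y. ?H ((trstep k ^^ i) (y, l))) \<partial>\<mu>) = ennreal (tailm k)" for i
  proof -
    have "(\<integral>\<^sup>+y. (\<Sum>l<trunc k y. ?H ((trstep k ^^ i) (y, l))) \<partial>\<mu>) = (\<integral>\<^sup>+y. (\<Sum>l<trunc k y. ?H (y, l)) \<partial>\<mu>)"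
      by (rule nn_integral_tower_iterate[OF H trunc_measurable trunc_pos[OF k(1)]])
    also have "\<dots> = (\<integral>\<^sup>+y. indicator {y \<in> space \<mu>. k < \<phi> y} y \<partial>\<mu>)"
    proof (rule nn_integral_cong)
      fix y assume y: "y \<in> space \<mu>"
      have "(\<Sum>l<trunc k y. ?H (y, l)) = (\<Sum>l\<in>{0}. ?H (y, l))"
        using trunc_pos[OF k(1) y] by (intro sum.mono_neutral_right) (auto simp: entered_def)
      then show "(\<Sum>l<trunc k y. ?H (y, l)) = indicator {y \<in> space \<mu>. k < \<phi> y} y"
        using y by (simp add: entered_def)
    qed
    finally show ?thesis by (simp add: emeasure_eq_measure)
  qed
  have Hm: "(\<lambda>y. \<Sum>l<trunc k y. ?H ((trstep k ^^ i) (y, l))) \<in> borel_measurable \<mu>" for i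
    by (rule column_sum_measurable[OF level_measurable_iterate[OF H trunc_measurable] trunc_measurable])
  have "(\<integral>\<^sup>+y. (\<Sum>l<\<phi> y. if bad k n (y, l) then 1 else 0) \<partial>\<mu>)
      \<le> (\<integral>\<^sup>+y. (if k < \<phi> y then of_nat (\<phi> y) else 0)
          + (\<Sum>i=1..n. \<Sum>l<trunc k y. ?H ((trstep k ^^ i) (y, l))) \<partial>\<mu>)"
  proof (rule nn_integral_mono)
    fix y assume y: "y \<in> space \<mu>"
    show "(\<Sum>l<\<phi> y. if bad k n (y, l) then 1 else 0) \<le> (if k < \<phi> y then of_nat (\<phi> y) else 0)
          + (\<Sum>i=1..n. \<Sum>l<trunc k y. ?H ((trstep k ^^ i) (y, l)))"
    proof (cases "k < \<phi> y")
      case True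
      then have "(\<Sum>l<\<phi> y. if bad k n (y, l) then 1 else 0) = (of_nat (\<phi> y) :: ennreal)"
        by (simp add: bad_def)
      then show ?thesis using True by simp
    next
      case False
      then have tr: "trunc k y = \<phi> y" by (simp add: trunc_def)
      have "(\<Sum>l<\<phi> y. if bad k n (y, l) then 1 else 0 :: ennreal)
          \<le> (\<Sum>l<\<phi> y. \<Sum>i=1..n. ?H ((trstep k ^^ i) (y, l)))"
      proof (rule sum_mono)
        fix l
        show "(if bad k n (y, l) then 1 else 0 :: ennreal) \<le> (\<Sum>i=1..n. ?H ((trstep k ^^ i) (y, l)))"
        proof (cases "bad k n (y, l)")
          case True
          then obtain i where i: "i \<in> {1..n}" "entered k ((trstep k ^^ i) (y, l))"
            using False by (auto simp: bad_def)
          then have "1 \<le> ?H ((trstep k ^^ i) (y, l))" by simp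
          also have "\<dots> \<le> (\<Sum>i=1..n. ?H ((trstep k ^^ i) (y, l)))"
            using i(1) by (intro member_le_sum) auto
          finally show ?thesis using True by simp
        qed simp
      qed
      also have "\<dots> = (\<Sum>i=1..n. \<Sum>l<trunc k y. ?H ((trstep k ^^ i) (y, l)))"
        unfolding tr by (rule sum.swap)
      finally show ?thesis using False by simp
    qed
  qed
  also have "\<dots> = (\<integral>\<^sup>+y. (if k < \<phi> y then of_nat (\<phi> y) else 0) \<partial>\<mu>)
      + (\<integral>\<^sup>+y. (\<Sum>i=1..n. \<Sum>l<trunc k y. ?H ((trstep k ^^ i) (y, l))) \<partial>\<mu>)"
    by (intro nn_integral_add borel_measurable_sum Hm) measurable
  also have "(\<integral>\<^sup>+y. (\<Sum>i=1..n. \<Sum>l<trunc k y. ?H ((trstep k ^^ i) (y, l))) \<partial>\<mu>) = (\<Sum>i=1..n. ennreal (tailm k))"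
    by (subst nn_integral_sum[OF Hm]) (simp add: It)
  also have "\<dots> = ennreal (real n * tailm k)"
    by (subst sum_ennreal) auto
  also have "(\<integral>\<^sup>+y. (if k < \<phi> y then of_nat (\<phi> y) else 0) \<partial>\<mu>) + ennreal (real n * tailm k)
      = ennreal (real (Suc k) * tailm k + (\<Sum>\<^sub>\<infinity>j\<in>{k<..}. tailm j) + real n * tailm k)"
    unfolding high_column_measure
    by (rule ennreal_plus[symmetric]) (auto intro!: add_nonneg_nonneg infsum_nonneg)
  also have "\<dots> \<le> ennreal (3 * tail_error \<phi> \<mu> n k)"
  proof (rule ennreal_leI)
    define s where "s = (\<Sum>\<^sub>\<infinity>j\<in>{k<..}. tailm j)"
    define x where "x = real (Suc k) * tailm k"
    define z where "z = real n * tailm k"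
    have "x \<le> (2 * real n) * tailm k"
      unfolding x_def using k by (intro mult_right_mono) auto
    then have "x \<le> 2 * z" by (simp add: z_def)
    moreover have "0 \<le> s" unfolding s_def by (intro infsum_nonneg) auto
    ultimately show "real (Suc k) * tailm k + (\<Sum>\<^sub>\<infinity>j\<in>{k<..}. tailm j) + real n * tailm k \<le> 3 * tail_error \<phi> \<mu> n k"
      unfolding tail_error_def x_def[symmetric] z_def[symmetric] s_def[symmetric] by (simp add: algebra_simps)
  qed
  finally show ?thesis .
qed

definition bad_count :: "nat \<Rightarrow> nat \<Rightarrow> 'a \<Rightarrow> real" where
  "bad_count k n y = (\<Sum>l<\<phi> y. if bad k n (y, l) then 1 else 0)"

definition bad_sum :: "nat \<Rightarrow> nat \<Rightarrow> ('a \<Rightarrow> real) \<Rightarrow> 'a \<Rightarrow> real" where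
  "bad_sum k n v y = (\<Sum>l<\<phi> y. if bad k n (y, l) then \<bar>v (proj (y, l))\<bar> else 0)"

lemma bad_count_integrable: "integrable \<mu> (bad_count k n)"
proof (rule Bochner_Integration.integrable_bound[OF \<phi>_integrable])
  have "level_measurable borel (\<lambda>q. if bad k n q then 1 else 0 :: real)"
    unfolding level_measurable_def using bad_level_pred by (auto intro!: measurable_If simp: pred_def)
  from column_sum_measurable[OF this phi_meas]
  show "bad_count k n \<in> borel_measurable \<mu>" by (simp add: bad_count_def[abs_def])
  have "bad_count k n y \<le> real (\<phi> y)" for y
    using sum_bounded_above[of "{..<\<phi> y}" "\<lambda>l. if bad k n (y, l) then 1 else 0" "1::real"] by (simp add: bad_count_def)
  moreover have "0 \<le> bad_count k n y" for y unfolding bad_count_def by (intro sum_nonneg) auto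
  ultimately show "AE y in \<mu>. norm (bad_count k n y) \<le> norm (real (\<phi> y))" by simp
qed

lemma bad_count_integral_le:
  assumes "1 \<le> k" "k \<le> n"
  shows "(\<integral>y. bad_count k n y \<partial>\<mu>) \<le> 3 * tail_error \<phi> \<mu> n k"
proof -
  have pos: "0 \<le> bad_count k n y" for y unfolding bad_count_def by (intro sum_nonneg) auto
  have "ennreal (\<integral>y. bad_count k n y \<partial>\<mu>) = (\<integral>\<^sup>+y. ennreal (bad_count k n y) \<partial>\<mu>)"
    by (rule nn_integral_eq_integral[symmetric, OF bad_count_integrable]) (use pos in auto)
  also have "ennreal (bad_count k n y) = (\<Sum>l<\<phi> y. if bad k n (y, l) then 1 else 0)" for y
  proof -
    have "(\<Sum>l<\<phi> y. if bad k n (y, l) then 1 else 0) = (\<Sum>l<\<phi> y. ennreal (if bad k n (y, l) then 1 else 0))"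
      by (intro sum.cong) auto
    also have "\<dots> = ennreal (bad_count k n y)"
      unfolding bad_count_def by (rule sum_ennreal) auto
    finally show ?thesis by simp
  qed
  then have "(\<integral>\<^sup>+y. ennreal (bad_count k n y) \<partial>\<mu>) = (\<integral>\<^sup>+y. (\<Sum>l<\<phi> y. if bad k n (y, l) then 1 else 0) \<partial>\<mu>)"
    by simp
  also have "\<dots> \<le> ennreal (3 * tail_error \<phi> \<mu> n k)" by (rule bad_measure_le[OF assms])
  finally show ?thesis using tail_error_nonneg[of n k] by simp
qed

lemma bad_sum_integrable:
  assumes v: "integrable \<mu>X v" shows "integrable \<mu> (bad_sum k n v)"
proof (rule Bochner_Integration.integrable_bound)
  show "integrable \<mu> (\<lambda>y. \<Sum>l<\<phi> y. \<bar>v (proj (y, l))\<bar>)" using v by (intro integral_mu_X) simp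
  have vm: "v \<in> borel_measurable M" using borel_measurable_integrable[OF v] by simp
  have "level_measurable borel (\<lambda>q. if bad k n q then \<bar>v (proj q)\<bar> else 0)"
    unfolding level_measurable_def
  proof (intro allI measurable_If)
    fix l
    show "(\<lambda>y. \<bar>v (proj (y, l))\<bar>) \<in> borel_measurable \<mu>"
      using level_measurableD[OF level_measurable_proj[OF vm], of l] by simp
    show "{y \<in> space \<mu>. bad k n (y, l)} \<in> sets \<mu>" using bad_level_pred by (simp add: pred_def)
  qed simp
  from column_sum_measurable[OF this phi_meas]
  show "bad_sum k n v \<in> borel_measurable \<mu>" by (simp add: bad_sum_def[abs_def])
  have "0 \<le> bad_sum k n v y" "bad_sum k n v y \<le> (\<Sum>l<\<phi> y. \<bar>v (proj (y, l))\<bar>)" for y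
    unfolding bad_sum_def by (auto intro!: sum_nonneg sum_mono)
  then show "AE y in \<mu>. norm (bad_sum k n v y) \<le> norm (\<Sum>l<\<phi> y. \<bar>v (proj (y, l))\<bar>)"
    by (intro AE_I2) (simp add: abs_of_nonneg order.trans)
qed

lemma column_trunc_diff_le:
  "\<bar>(\<Sum>l<\<phi> y. v (proj (y, l))) - (\<Sum>l<trunc k y. v (proj (y, l)))\<bar> \<le> bad_sum k n v y"
proof (cases "k < \<phi> y")
  case True
  have "(\<Sum>l<\<phi> y. v (proj (y, l))) - (\<Sum>l<trunc k y. v (proj (y, l))) = (\<Sum>l\<in>{..<\<phi> y} - {..<trunc k y}. v (proj (y, l)))"
    by (rule sum_diff[symmetric]) (auto simp: trunc_def)
  also have "\<bar>\<dots>\<bar> \<le> (\<Sum>l\<in>{..<\<phi> y} - {..<trunc k y}. \<bar>v (proj (y, l))\<bar>)" by (rule sum_abs)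
  also have "\<dots> \<le> (\<Sum>l<\<phi> y. \<bar>v (proj (y, l))\<bar>)" by (intro sum_mono2) auto
  also have "\<dots> = bad_sum k n v y" using True by (simp add: bad_sum_def bad_def)
  finally show ?thesis .
next
  case False
  then have "trunc k y = \<phi> y" by (simp add: trunc_def)
  then show ?thesis by (auto simp: bad_sum_def intro!: sum_nonneg)
qed

lemma correlation_column_diff_le:
  assumes y: "y \<in> space \<mu>" and w: "\<And>x. \<bar>w x\<bar> \<le> c"
  shows "\<bar>(\<Sum>l<\<phi> y. v (proj (y, l)) * w ((T ^^ n) (proj (y, l))))
      - (\<Sum>l<trunc k y. v (proj (y, l)) * w (proj ((trstep k ^^ n) (y, l))))\<bar> \<le> 2 * c * bad_sum k n v y"
proof (cases "k < \<phi> y")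
  case True
  have bs: "bad_sum k n v y = (\<Sum>l<\<phi> y. \<bar>v (proj (y, l))\<bar>)" using True by (simp add: bad_sum_def bad_def)
  have c: "c \<ge> 0" using w by (meson abs_ge_zero order.trans)
  have "\<bar>\<Sum>l<\<phi> y. v (proj (y, l)) * w ((T ^^ n) (proj (y, l)))\<bar> \<le> (\<Sum>l<\<phi> y. c * \<bar>v (proj (y, l))\<bar>)"
    using w by (intro order.trans[OF sum_abs] sum_mono) (auto simp: abs_mult mult.commute[of c] intro!: mult_left_mono)
  moreover have "\<bar>\<Sum>l<trunc k y. v (proj (y, l)) * w (proj ((trstep k ^^ n) (y, l)))\<bar> \<le> (\<Sum>l<trunc k y. c * \<bar>v (proj (y, l))\<bar>)"
    using w by (intro order.trans[OF sum_abs] sum_mono) (auto simp: abs_mult mult.commute[of c] intro!: mult_left_mono)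
  moreover have "(\<Sum>l<trunc k y. c * \<bar>v (proj (y, l))\<bar>) \<le> (\<Sum>l<\<phi> y. c * \<bar>v (proj (y, l))\<bar>)"
    using c by (intro sum_mono2) (auto simp: trunc_def)
  ultimately show ?thesis unfolding bs by (simp add: sum_distrib_left[symmetric])
next
  case False
  then have tr: "trunc k y = \<phi> y" by (simp add: trunc_def)
  have "\<bar>(\<Sum>l<\<phi> y. v (proj (y, l)) * w ((T ^^ n) (proj (y, l))))
      - (\<Sum>l<\<phi> y. v (proj (y, l)) * w (proj ((trstep k ^^ n) (y, l))))\<bar>
      \<le> (\<Sum>l<\<phi> y. \<bar>v (proj (y, l)) * w ((T ^^ n) (proj (y, l))) - v (proj (y, l)) * w (proj ((trstep k ^^ n) (y, l)))\<bar>)"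
    unfolding sum_subtractf[symmetric] by (rule sum_abs)
  also have "\<dots> \<le> (\<Sum>l<\<phi> y. 2 * c * (if bad k n (y, l) then \<bar>v (proj (y, l))\<bar> else 0))"
  proof (rule sum_mono)
    fix l assume l: "l \<in> {..<\<phi> y}"
    show "\<bar>v (proj (y, l)) * w ((T ^^ n) (proj (y, l))) - v (proj (y, l)) * w (proj ((trstep k ^^ n) (y, l)))\<bar>
        \<le> 2 * c * (if bad k n (y, l) then \<bar>v (proj (y, l))\<bar> else 0)"
    proof (cases "bad k n (y, l)")
      case True
      have "\<bar>w ((T ^^ n) (proj (y, l))) - w (proj ((trstep k ^^ n) (y, l)))\<bar> \<le> 2 * c"
        using w[of "(T ^^ n) (proj (y, l))"] w[of "proj ((trstep k ^^ n) (y, l))"] by linarith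
      then have "\<bar>v (proj (y, l))\<bar> * \<bar>w ((T ^^ n) (proj (y, l))) - w (proj ((trstep k ^^ n) (y, l)))\<bar>
          \<le> \<bar>v (proj (y, l))\<bar> * (2 * c)" by (intro mult_left_mono) auto
      then show ?thesis using True by (simp add: mult.commute flip: abs_mult right_diff_distrib)
    next
      case False
      have "proj ((trstep k ^^ n) (y, l)) = (T ^^ n) (proj (y, l))"
        using good_path[OF y _ False] l by simp
      then show ?thesis using False by simp
    qed
  qed
  also have "\<dots> = 2 * c * bad_sum k n v y" by (simp add: bad_sum_def sum_distrib_left)
  finally show ?thesis unfolding tr .
qed

text \<open>Keeping the integral of \<open>\<bar>v\<bar>\<close> over the bad points, rather than a bound for \<open>v\<close>, covers unbounded
  observables on towers of bounded height, where there are almost no bad points.\<close>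

theorem corr_truncated_corr_le:
  assumes v: "integrable \<mu>X v" and w: "w \<in> borel_measurable M" "\<And>x. \<bar>w x\<bar> \<le> c"
    and k: "1 \<le> k" "k \<le> n"
  shows "\<bar>corr \<mu>X T v w n\<bar> \<le> \<bar>truncated_corr k v w n\<bar> + 3 * c * (\<integral>y. bad_sum k n v y \<partial>\<mu>)
     + 2 * c * (\<integral>y. bad_count k n y \<partial>\<mu>) * (\<integral>y. (\<Sum>l<\<phi> y. \<bar>v (proj (y, l))\<bar>) \<partial>\<mu>)"
proof -
  define \<beta> where "\<beta> = (\<integral>y. bad_sum k n v y \<partial>\<mu>)"
  define B where "B = (\<integral>y. bad_count k n y \<partial>\<mu>)"
  define N where "N = (\<integral>y. (\<Sum>l<\<phi> y. \<bar>v (proj (y, l))\<bar>) \<partial>\<mu>)"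
  have c: "c \<ge> 0" using w(2) by (meson abs_ge_zero order.trans)
  have vm[measurable]: "v \<in> borel_measurable M" using borel_measurable_integrable[OF v] by simp
  have wT[measurable]: "(\<lambda>x. w ((T ^^ n) x)) \<in> borel_measurable M"
    by (rule measurable_compose[OF T_iterate_measurable w(1)])
  have vw: "integrable \<mu>X (\<lambda>x. v x * w ((T ^^ n) x))"
  proof (rule Bochner_Integration.integrable_bound)
    show "integrable \<mu>X (\<lambda>x. c * v x)" using v by simp
    show "AE x in \<mu>X. norm (v x * w ((T ^^ n) x)) \<le> norm (c * v x)"
      using w(2) c by (intro AE_I2) (auto simp: abs_mult mult.commute[of c] intro!: mult_left_mono)
  qed measurable
  have \<phi>c: "integrable \<mu> (\<lambda>y. c * real (\<phi> y))" using \<phi>_integrable by simp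
  have wi: "integrable \<mu> (\<lambda>y. \<Sum>l<\<psi> y. w (proj (y, l)))"
    if \<psi>: "\<psi> \<in> measurable \<mu> (count_space UNIV)" "\<And>y. \<psi> y \<le> \<phi> y" for \<psi>
  proof (rule Bochner_Integration.integrable_bound[OF \<phi>c])
    show "(\<lambda>y. \<Sum>l<\<psi> y. w (proj (y, l))) \<in> borel_measurable \<mu>"
      by (rule column_sum_measurable[OF level_measurable_proj[OF w(1)] \<psi>(1)])
    show "AE y in \<mu>. norm (\<Sum>l<\<psi> y. w (proj (y, l))) \<le> norm (c * real (\<phi> y))"
    proof (rule AE_I2)
      fix y
      have "norm (\<Sum>l<\<psi> y. w (proj (y, l))) \<le> (\<Sum>l<\<psi> y. c)"
        using w(2) by (intro sum_norm_le) auto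
      also have "\<dots> \<le> c * real (\<phi> y)" using \<psi>(2)[of y] c by (simp add: mult.commute mult_left_mono)
      finally show "norm (\<Sum>l<\<psi> y. w (proj (y, l))) \<le> norm (c * real (\<phi> y))" using c by simp
    qed
  qed
  have tr_le: "trunc k y \<le> \<phi> y" for y by (simp add: trunc_def)
  have Ni: "integrable \<mu> (\<lambda>y. \<Sum>l<\<phi> y. \<bar>v (proj (y, l))\<bar>)" using v by (intro integral_mu_X) simp
  have vi: "integrable \<mu> (\<lambda>y. \<Sum>l<trunc k y. v (proj (y, l)))"
  proof (rule Bochner_Integration.integrable_bound[OF Ni])
    show "(\<lambda>y. \<Sum>l<trunc k y. v (proj (y, l))) \<in> borel_measurable \<mu>"
      by (rule column_sum_measurable[OF level_measurable_proj[OF vm] trunc_measurable])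
    have "\<bar>\<Sum>l<trunc k y. v (proj (y, l))\<bar> \<le> (\<Sum>l<\<phi> y. \<bar>v (proj (y, l))\<bar>)" for y
      using tr_le[of y] by (intro order.trans[OF sum_abs sum_mono2]) auto
    then show "AE y in \<mu>. norm (\<Sum>l<trunc k y. v (proj (y, l))) \<le> norm (\<Sum>l<\<phi> y. \<bar>v (proj (y, l))\<bar>)"
      by (intro AE_I2) (simp add: order.trans[OF _ abs_ge_self])
  qed
  have vwi: "integrable \<mu> (\<lambda>y. \<Sum>l<trunc k y. v (proj (y, l)) * w (proj ((trstep k ^^ n) (y, l))))"
  proof (rule Bochner_Integration.integrable_bound)
    show "integrable \<mu> (\<lambda>y. c * (\<Sum>l<\<phi> y. \<bar>v (proj (y, l))\<bar>))" using Ni by simp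
    have "level_measurable borel (\<lambda>p. v (proj p) * w (proj ((trstep k ^^ n) p)))"
      using level_measurableD[OF level_measurable_proj[OF vm]]
        level_measurableD[OF level_measurable_iterate[OF level_measurable_proj[OF w(1)] trunc_measurable]]
      by (simp add: level_measurable_def)
    from column_sum_measurable[OF this trunc_measurable]
    show "(\<lambda>y. \<Sum>l<trunc k y. v (proj (y, l)) * w (proj ((trstep k ^^ n) (y, l)))) \<in> borel_measurable \<mu>" .
    have "\<bar>\<Sum>l<trunc k y. v (proj (y, l)) * w (proj ((trstep k ^^ n) (y, l)))\<bar> \<le> c * (\<Sum>l<\<phi> y. \<bar>v (proj (y, l))\<bar>)" for y
    proof -
      have "\<bar>\<Sum>l<trunc k y. v (proj (y, l)) * w (proj ((trstep k ^^ n) (y, l)))\<bar> \<le> (\<Sum>l<trunc k y. c * \<bar>v (proj (y, l))\<bar>)"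
        using w(2) by (intro order.trans[OF sum_abs] sum_mono) (auto simp: abs_mult mult.commute[of c] intro!: mult_left_mono)
      also have "\<dots> \<le> (\<Sum>l<\<phi> y. c * \<bar>v (proj (y, l))\<bar>)" using c tr_le[of y] by (intro sum_mono2) auto
      finally show ?thesis by (simp add: sum_distrib_left)
    qed
    then show "AE y in \<mu>. norm (\<Sum>l<trunc k y. v (proj (y, l)) * w (proj ((trstep k ^^ n) (y, l))))
        \<le> norm (c * (\<Sum>l<\<phi> y. \<bar>v (proj (y, l))\<bar>))"
      by (intro AE_I2) (simp add: order.trans[OF _ abs_ge_self])
  qed
  define U where "U = mean_height * (\<integral>x. v x * w ((T ^^ n) x) \<partial>\<mu>X)"
  define U' where "U' = (\<integral>y. (\<Sum>l<trunc k y. v (proj (y, l)) * w (proj ((trstep k ^^ n) (y, l)))) \<partial>\<mu>)"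
  define Jv where "Jv = mean_height * (\<integral>x. v x \<partial>\<mu>X)"
  define Jv' where "Jv' = (\<integral>y. (\<Sum>l<trunc k y. v (proj (y, l))) \<partial>\<mu>)"
  define Jw where "Jw = (\<integral>y. (\<Sum>l<\<phi> y. w (proj (y, l))) \<partial>\<mu>)"
  define Jw' where "Jw' = (\<integral>y. (\<Sum>l<trunc k y. w (proj (y, l))) \<partial>\<mu>)"
  have dU: "\<bar>U - U'\<bar> \<le> 2 * c * \<beta>"
  proof -
    have eq: "U - U' = (\<integral>y. ((\<Sum>l<\<phi> y. v (proj (y, l)) * w ((T ^^ n) (proj (y, l))))
        - (\<Sum>l<trunc k y. v (proj (y, l)) * w (proj ((trstep k ^^ n) (y, l))))) \<partial>\<mu>)"
      unfolding U_def U'_def integral_mu_X(2)[OF vw, symmetric]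
      by (rule Bochner_Integration.integral_diff[OF integral_mu_X(1)[OF vw] vwi, symmetric])
    have "\<bar>(\<integral>y. ((\<Sum>l<\<phi> y. v (proj (y, l)) * w ((T ^^ n) (proj (y, l))))
        - (\<Sum>l<trunc k y. v (proj (y, l)) * w (proj ((trstep k ^^ n) (y, l))))) \<partial>\<mu>)\<bar> \<le> (\<integral>y. 2 * c * bad_sum k n v y \<partial>\<mu>)"
      unfolding real_norm_def[symmetric]
    proof (rule order.trans[OF integral_norm_bound integral_mono])
      show "integrable \<mu> (\<lambda>y. 2 * c * bad_sum k n v y)" using bad_sum_integrable[OF v] by simp
      show "integrable \<mu> (\<lambda>y. norm ((\<Sum>l<\<phi> y. v (proj (y, l)) * w ((T ^^ n) (proj (y, l))))
          - (\<Sum>l<trunc k y. v (proj (y, l)) * w (proj ((trstep k ^^ n) (y, l))))))"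
        by (intro integrable_norm Bochner_Integration.integrable_diff integral_mu_X(1)[OF vw] vwi)
    qed (unfold real_norm_def, rule correlation_column_diff_le[where v = v and w = w and c = c and k = k and n = n, OF _ w(2)])
    then show ?thesis unfolding eq by (simp add: \<beta>_def)
  qed
  have dv: "\<bar>Jv - Jv'\<bar> \<le> \<beta>"
  proof -
    have eq: "Jv - Jv' = (\<integral>y. ((\<Sum>l<\<phi> y. v (proj (y, l))) - (\<Sum>l<trunc k y. v (proj (y, l)))) \<partial>\<mu>)"
      unfolding Jv_def Jv'_def integral_mu_X(2)[OF v, symmetric]
      by (rule Bochner_Integration.integral_diff[OF integral_mu_X(1)[OF v] vi, symmetric])
    have "\<bar>(\<integral>y. ((\<Sum>l<\<phi> y. v (proj (y, l))) - (\<Sum>l<trunc k y. v (proj (y, l)))) \<partial>\<mu>)\<bar> \<le> \<beta>"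
      unfolding real_norm_def[symmetric] \<beta>_def
    proof (rule order.trans[OF integral_norm_bound integral_mono])
      show "integrable \<mu> (\<lambda>y. norm ((\<Sum>l<\<phi> y. v (proj (y, l))) - (\<Sum>l<trunc k y. v (proj (y, l)))))"
        by (intro integrable_norm Bochner_Integration.integrable_diff integral_mu_X(1)[OF v] vi)
    qed (unfold real_norm_def, rule bad_sum_integrable[OF v], rule column_trunc_diff_le[where v = v and k = k and n = n])
    then show ?thesis unfolding eq .
  qed
  have dw: "\<bar>Jw - Jw'\<bar> \<le> c * B"
  proof -
    have eq: "Jw - Jw' = (\<integral>y. ((\<Sum>l<\<phi> y. w (proj (y, l))) - (\<Sum>l<trunc k y. w (proj (y, l)))) \<partial>\<mu>)"
      unfolding Jw_def Jw'_def
      by (intro Bochner_Integration.integral_diff[symmetric] wi tr_le trunc_measurable phi_meas) simp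
    have "\<bar>(\<integral>y. ((\<Sum>l<\<phi> y. w (proj (y, l))) - (\<Sum>l<trunc k y. w (proj (y, l)))) \<partial>\<mu>)\<bar> \<le> (\<integral>y. c * bad_count k n y \<partial>\<mu>)"
      unfolding real_norm_def[symmetric]
    proof (rule order.trans[OF integral_norm_bound integral_mono])
      show "integrable \<mu> (\<lambda>y. c * bad_count k n y)" using bad_count_integrable by simp
      show "integrable \<mu> (\<lambda>y. norm ((\<Sum>l<\<phi> y. w (proj (y, l))) - (\<Sum>l<trunc k y. w (proj (y, l)))))"
        by (intro integrable_norm Bochner_Integration.integrable_diff wi tr_le trunc_measurable phi_meas) simp
      fix y
      have "bad_sum k n w y \<le> (\<Sum>l<\<phi> y. c * (if bad k n (y, l) then 1 else 0))"
        unfolding bad_sum_def using w(2) by (intro sum_mono) auto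
      then show "norm ((\<Sum>l<\<phi> y. w (proj (y, l))) - (\<Sum>l<trunc k y. w (proj (y, l)))) \<le> c * bad_count k n y"
        using column_trunc_diff_le[of w y k n] by (simp add: bad_count_def sum_distrib_left)
    qed
    then show ?thesis unfolding eq by (simp add: B_def)
  qed
  have dphi: "\<bar>mean_height - mean_return k\<bar> \<le> B"
  proof -
    have ti: "integrable \<mu> (\<lambda>y. real (trunc k y))"
      by (rule Bochner_Integration.integrable_bound[OF \<phi>_integrable]) (auto simp: trunc_def)
    have eq: "mean_height - mean_return k = (\<integral>y. (real (\<phi> y) - real (trunc k y)) \<partial>\<mu>)"
      unfolding mean_height_def mean_return_eq_integral
      by (rule Bochner_Integration.integral_diff[OF \<phi>_integrable ti, symmetric])
    have "\<bar>(\<integral>y. (real (\<phi> y) - real (trunc k y)) \<partial>\<mu>)\<bar> \<le> B"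
      unfolding real_norm_def[symmetric] B_def
    proof (rule order.trans[OF integral_norm_bound integral_mono])
      fix y
      show "norm (real (\<phi> y) - real (trunc k y)) \<le> bad_count k n y"
        using column_trunc_diff_le[of "\<lambda>_. 1" y k n] by (simp add: bad_count_def bad_sum_def)
      show "integrable \<mu> (\<lambda>y. norm (real (\<phi> y) - real (trunc k y)))"
        by (intro integrable_norm Bochner_Integration.integrable_diff \<phi>_integrable ti)
    qed (rule bad_count_integrable)
    then show ?thesis unfolding eq .
  qed
  have Jw_eq: "Jw = mean_height * (\<integral>x. w x \<partial>\<mu>X)"
  proof -
    have "integrable \<mu>X w"
    proof -
      have "emeasure \<mu>X (space \<mu>X) = (\<integral>\<^sup>+x. 1 \<partial>\<mu>X)" by simp
      also have "\<dots> = ennreal (1 / mean_height) * (\<integral>\<^sup>+y. of_nat (\<phi> y) \<partial>\<mu>)" by (subst nn_integral_mu_X) auto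
      also have "(\<integral>\<^sup>+y. of_nat (\<phi> y) \<partial>\<mu>) = ennreal mean_height"
        unfolding mean_height_def ennreal_of_nat_eq_real_of_nat
        by (rule nn_integral_eq_integral[OF \<phi>_integrable]) simp
      finally have "emeasure \<mu>X (space \<mu>X) < \<infinity>" by (simp add: ennreal_mult_less_top)
      then interpret finite_measure \<mu>X by (intro finite_measureI) auto
      show ?thesis using w by (intro integrable_const_bound[of _ c]) auto
    qed
    from integral_mu_X(2)[OF this] show ?thesis by (simp add: Jw_def)
  qed
  have Jw_le: "\<bar>Jw\<bar> \<le> c * mean_height"
  proof -
    have "\<bar>Jw\<bar> \<le> (\<integral>y. c * real (\<phi> y) \<partial>\<mu>)"
      unfolding Jw_def real_norm_def[symmetric]
    proof (rule order.trans[OF integral_norm_bound integral_mono])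
      show "integrable \<mu> (\<lambda>y. norm (\<Sum>l<\<phi> y. w (proj (y, l))))" by (intro integrable_norm wi phi_meas) simp
      show "norm (\<Sum>l<\<phi> y. w (proj (y, l))) \<le> c * real (\<phi> y)" for y
        using sum_norm_le[of "{..<\<phi> y}" "\<lambda>l. w (proj (y, l))" "\<lambda>_. c"] w(2) by (simp add: mult.commute)
    qed (rule \<phi>c)
    then show ?thesis by (simp add: mean_height_def)
  qed
  have Jv'_le: "\<bar>Jv'\<bar> \<le> N"
    unfolding Jv'_def N_def real_norm_def[symmetric]
  proof (rule order.trans[OF integral_norm_bound integral_mono])
    show "norm (\<Sum>l<trunc k y. v (proj (y, l))) \<le> (\<Sum>l<\<phi> y. norm (v (proj (y, l))))" for y
      using tr_le[of y] by (intro order.trans[OF norm_sum sum_mono2]) auto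
  qed (use vi Ni in auto)
  have p: "mean_return k \<ge> 1" "mean_height \<ge> 1" using mean_return_ge_1[OF k(1)] mean_height_ge_1 by auto
  have B: "B \<ge> 0" using dphi by linarith
  have N: "N \<ge> 0" using Jv'_le by linarith
  have \<beta>: "\<beta> \<ge> 0" using dv by linarith
  have ratio: "\<bar>Jw / mean_height - Jw' / mean_return k\<bar> \<le> 2 * c * B"
  proof -
    \<comment> \<open>Both the integral of \<open>w\<close> and the normalisation change.\<close>
    have "Jw / mean_height - Jw' / mean_return k = (Jw - Jw') / mean_return k - (Jw / mean_height) * ((mean_height - mean_return k) / mean_return k)"
      using p by (simp add: field_simps)
    then have "\<bar>Jw / mean_height - Jw' / mean_return k\<bar> \<le> \<bar>Jw - Jw'\<bar> / mean_return k + \<bar>Jw / mean_height\<bar> * (\<bar>mean_height - mean_return k\<bar> / mean_return k)"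
      using abs_triangle_ineq4[of "(Jw - Jw') / mean_return k" "(Jw / mean_height) * ((mean_height - mean_return k) / mean_return k)"] p
      by (simp add: abs_mult)
    also have "\<dots> \<le> c * B / 1 + c * (B / 1)"
    proof (intro add_mono frac_le mult_mono)
      show "\<bar>Jw / mean_height\<bar> \<le> c" using Jw_le p by (simp add: field_simps)
    qed (use dw dphi p c B in auto)
    finally show ?thesis by (simp add: mult_ac)
  qed
  have key: "mean_height * corr \<mu>X T v w n = truncated_corr k v w n
      + ((U - U') - (Jv - Jv') * (Jw / mean_height) - Jv' * (Jw / mean_height - Jw' / mean_return k))"
  proof -
    have "mean_height * corr \<mu>X T v w n = U - Jv * (Jw / mean_height)"
      using p by (simp add: corr_def U_def Jv_def Jw_eq algebra_simps)
    moreover have "truncated_corr k v w n = U' - Jv' * (Jw' / mean_return k)"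
      by (simp add: truncated_corr_def U'_def Jv'_def Jw'_def)
    moreover have "U - Jv * s = (U' - Jv' * t) + ((U - U') - (Jv - Jv') * s - Jv' * (s - t))" for s t
      by (simp add: algebra_simps)
    ultimately show ?thesis by metis
  qed
  have "\<bar>corr \<mu>X T v w n\<bar> \<le> mean_height * \<bar>corr \<mu>X T v w n\<bar>"
    using mult_right_mono[OF p(2), of "\<bar>corr \<mu>X T v w n\<bar>"] by simp
  also have "\<dots> = \<bar>mean_height * corr \<mu>X T v w n\<bar>" using p by (simp add: abs_mult)
  also have "\<dots> \<le> \<bar>truncated_corr k v w n\<bar> + (2 * c * \<beta> + \<beta> * c + N * (2 * c * B))"
  proof -
    have "\<bar>(Jv - Jv') * (Jw / mean_height)\<bar> \<le> \<beta> * c"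
      unfolding abs_mult using dv Jw_le p \<beta> by (intro mult_mono) (auto simp: field_simps)
    moreover have "\<bar>Jv' * (Jw / mean_height - Jw' / mean_return k)\<bar> \<le> N * (2 * c * B)"
      unfolding abs_mult using Jv'_le ratio N by (intro mult_mono) auto
    ultimately show ?thesis unfolding key using dU by linarith
  qed
  finally show ?thesis by (simp add: \<beta>_def B_def N_def algebra_simps)
qed

end

context good_inducing_scheme
begin

section \<open>The correlation bound\<close>

lemma Linf_AE_bound:
  assumes w: "w \<in> Linf N" shows "AE x in N. \<bar>w x\<bar> \<le> enn2real (Linf_norm N w)"
    and "Linf_norm N w = ennreal (enn2real (Linf_norm N w))"
proof -
  show eq: "Linf_norm N w = ennreal (enn2real (Linf_norm N w))"
    using w by (simp add: Linf_def ennreal_enn2real)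
  have "AE x in N. ennreal \<bar>w x\<bar> \<le> Linf_norm N w"
    unfolding Linf_norm_def by (rule esssup_AE)
  then show "AE x in N. \<bar>w x\<bar> \<le> enn2real (Linf_norm N w)"
    by eventually_elim (metis eq enn2real_nonneg ennreal_le_iff)
qed

text \<open>The projected measure is invariant, so clamping an essentially bounded observable leaves its
  compositions with iterates of \<open>T\<close> unchanged almost everywhere.\<close>

lemma corr_clamp:
  assumes v: "integrable \<mu>X v" and w: "w \<in> Linf \<mu>X"
  obtains w' where "w' \<in> borel_measurable M" "\<And>x. \<bar>w' x\<bar> \<le> enn2real (Linf_norm \<mu>X w)"
    "corr \<mu>X T v w n = corr \<mu>X T v w' n"
proof
  let ?c = "enn2real (Linf_norm \<mu>X w)"
  let ?w = "\<lambda>x. max (- ?c) (min ?c (w x))"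
  have wm[measurable]: "w \<in> borel_measurable M" using w by (auto simp: Linf_def)
  have vm[measurable]: "v \<in> borel_measurable M" using borel_measurable_integrable[OF v] by simp
  show w'm: "?w \<in> borel_measurable M" by measurable
  show "\<bar>?w x\<bar> \<le> ?c" for x
    using enn2real_nonneg[of "Linf_norm \<mu>X w"] by (simp add: abs_le_iff min_def max_def)
  have ae: "AE x in \<mu>X. w x = ?w x"
    using Linf_AE_bound(1)[OF w] by eventually_elim auto
  have wT: "(\<lambda>x. w ((T ^^ n) x)) \<in> borel_measurable M" "(\<lambda>x. ?w ((T ^^ n) x)) \<in> borel_measurable M"
    using measurable_compose[OF T_iterate_measurable wm] measurable_compose[OF T_iterate_measurable w'm] by auto
  have "(\<integral>x. v x * w ((T ^^ n) x) \<partial>\<mu>X) = (\<integral>x. v x * ?w ((T ^^ n) x) \<partial>\<mu>X)"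
  proof (rule integral_cong_AE)
    show "AE x in \<mu>X. v x * w ((T ^^ n) x) = v x * ?w ((T ^^ n) x)"
      using AE_mu_X_T_iterate[OF ae, of n] by eventually_elim simp
  qed (use vm wT in \<open>auto intro!: borel_measurable_times\<close>)
  moreover have "(\<integral>x. w x \<partial>\<mu>X) = (\<integral>x. ?w x \<partial>\<mu>X)"
    using ae wm w'm by (intro integral_cong_AE) auto
  ultimately show "corr \<mu>X T v w n = corr \<mu>X T v ?w n" by (simp add: corr_def)
qed

lemma truncation_error_le:
  assumes v: "integrable \<mu>X v" and \<nu>: "AE x in \<mu>X. \<bar>v x\<bar> \<le> \<nu>" "\<nu> \<ge> 0" and k: "1 \<le> k" "k \<le> n"
  shows "(\<integral>y. bad_sum k n v y \<partial>\<mu>) \<le> \<nu> * (3 * tail_error \<phi> \<mu> n k)"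
    and "(\<integral>y. (\<Sum>l<\<phi> y. \<bar>v (proj (y, l))\<bar>) \<partial>\<mu>) \<le> \<nu> * mean_height"
proof -
  note ae = AE_mu_X_tower[OF \<nu>(1)]
  have "(\<integral>y. bad_sum k n v y \<partial>\<mu>) \<le> (\<integral>y. \<nu> * bad_count k n y \<partial>\<mu>)"
  proof (rule integral_mono_AE)
    show "AE y in \<mu>. bad_sum k n v y \<le> \<nu> * bad_count k n y"
      using ae by eventually_elim (auto simp: bad_sum_def bad_count_def sum_distrib_left intro!: sum_mono)
  qed (use bad_sum_integrable[OF v] bad_count_integrable in auto)
  also have "\<dots> = \<nu> * (\<integral>y. bad_count k n y \<partial>\<mu>)" by simp
  also have "\<dots> \<le> \<nu> * (3 * tail_error \<phi> \<mu> n k)"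
    using bad_count_integral_le[OF k] \<nu>(2) by (rule mult_left_mono)
  finally show "(\<integral>y. bad_sum k n v y \<partial>\<mu>) \<le> \<nu> * (3 * tail_error \<phi> \<mu> n k)" .
  have "(\<integral>y. (\<Sum>l<\<phi> y. \<bar>v (proj (y, l))\<bar>) \<partial>\<mu>) \<le> (\<integral>y. \<nu> * real (\<phi> y) \<partial>\<mu>)"
  proof (rule integral_mono_AE)
    show "integrable \<mu> (\<lambda>y. \<Sum>l<\<phi> y. \<bar>v (proj (y, l))\<bar>)" using v by (intro integral_mu_X) simp
    show "integrable \<mu> (\<lambda>y. \<nu> * real (\<phi> y))" using \<phi>_integrable by simp
    show "AE y in \<mu>. (\<Sum>l<\<phi> y. \<bar>v (proj (y, l))\<bar>) \<le> \<nu> * real (\<phi> y)"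
      using ae
    proof eventually_elim
      case (elim y)
      then have "(\<Sum>l<\<phi> y. \<bar>v (proj (y, l))\<bar>) \<le> (\<Sum>l<\<phi> y. \<nu>)" by (intro sum_mono) auto
      then show ?case by (simp add: mult.commute)
    qed
  qed
  then show "(\<integral>y. (\<Sum>l<\<phi> y. \<bar>v (proj (y, l))\<bar>) \<partial>\<mu>) \<le> \<nu> * mean_height" by (simp add: mean_height_def)
qed

lemma truncation_error_zero:
  assumes v: "integrable \<mu>X v" and k: "1 \<le> k" "k \<le> n" and tail: "tail_error \<phi> \<mu> n k = 0"
  shows "(\<integral>y. bad_sum k n v y \<partial>\<mu>) = 0" "(\<integral>y. bad_count k n y \<partial>\<mu>) = 0"
proof -
  have pos: "0 \<le> bad_count k n y" for y unfolding bad_count_def by (intro sum_nonneg) auto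
  have "0 \<le> (\<integral>y. bad_count k n y \<partial>\<mu>)" using pos by (intro integral_nonneg_AE) auto
  then show z: "(\<integral>y. bad_count k n y \<partial>\<mu>) = 0" using bad_count_integral_le[OF k] tail by simp
  then have "AE y in \<mu>. bad_count k n y = 0"
    using bad_count_integrable pos by (subst (asm) integral_nonneg_eq_0_iff_AE) auto
  then have "AE y in \<mu>. bad_sum k n v y = 0"
  proof eventually_elim
    case (elim y)
    then have "\<forall>l\<in>{..<\<phi> y}. (if bad k n (y, l) then 1 else 0 :: real) = 0"
      unfolding bad_count_def by (subst (asm) sum_nonneg_eq_0_iff) auto
    then show ?case unfolding bad_sum_def by (intro sum.neutral) (auto split: if_splits)
  qed
  then show "(\<integral>y. bad_sum k n v y \<partial>\<mu>) = 0" by (rule integral_eq_zero_AE)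
qed

text \<open>If the tail error vanishes, there are almost no bad points, and if \<open>v\<close> is not essentially bounded while
  \<open>w\<close> and the tail error do not vanish, the right-hand side is infinite. Otherwise the bad points
  contribute at most their measure times the bounds of \<open>v\<close> and \<open>w\<close>.\<close>

lemma corr_bound_from_truncated:
  assumes v: "v \<in> B_X M T Y \<phi> \<mu> emb" and w: "w \<in> Linf \<mu>X" and k: "1 \<le> k" "k \<le> n"
    and main: "\<And>w'. w' \<in> borel_measurable M \<Longrightarrow> (\<And>x. \<bar>w' x\<bar> \<le> enn2real (Linf_norm \<mu>X w)) \<Longrightarrow>
       \<bar>truncated_corr k v w' n\<bar> \<le> C0 * exch_norm T Y \<phi> \<mu> emb v * enn2real (Linf_norm \<mu>X w) * X"
    and C: "0 \<le> C0" "C0 \<le> C" "9 + 6 * mean_height \<le> C" and X: "0 \<le> X"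
  shows "ennreal \<bar>corr \<mu>X T v w n\<bar>
          \<le> ennreal C * Linf_norm \<mu>X v * Linf_norm \<mu>X w * ennreal (tail_error \<phi> \<mu> n k)
            + ennreal C * ennreal (exch_norm T Y \<phi> \<mu> emb v) * Linf_norm \<mu>X w * ennreal X"
proof -
  define c where "c = enn2real (Linf_norm \<mu>X w)"
  define V where "V = exch_norm T Y \<phi> \<mu> emb v"
  define t where "t = tail_error \<phi> \<mu> n k"
  have vi: "integrable \<mu>X v" using v by (simp add: B_X_def)
  have c: "c \<ge> 0" "Linf_norm \<mu>X w = ennreal c" using Linf_AE_bound(2)[OF w] by (auto simp: c_def)
  have V: "V \<ge> 0"
  proof -
    obtain b where "\<And>j. norm (b j :: 'b) \<le> V"
      unfolding V_def by (rule derived_obs_in_space[OF v, of k]) blast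
    then show ?thesis using norm_ge_zero order.trans by blast
  qed
  have t: "t \<ge> 0" using tail_error_nonneg by (simp add: t_def)
  define \<beta> where "\<beta> = (\<integral>y. bad_sum k n v y \<partial>\<mu>)"
  define B where "B = (\<integral>y. bad_count k n y \<partial>\<mu>)"
  define N where "N = (\<integral>y. (\<Sum>l<\<phi> y. \<bar>v (proj (y, l))\<bar>) \<partial>\<mu>)"
  obtain w' where w': "w' \<in> borel_measurable M" "\<And>x. \<bar>w' x\<bar> \<le> c" "corr \<mu>X T v w n = corr \<mu>X T v w' n"
    unfolding c_def by (rule corr_clamp[OF vi w]) blast
  have "\<bar>truncated_corr k v w' n\<bar> \<le> C0 * V * c * X"
    unfolding V_def c_def by (rule main[OF w'(1) w'(2)[unfolded c_def]])
  also have "\<dots> \<le> C * V * c * X" using C V c X by (intro mult_right_mono) auto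
  finally have "\<bar>corr \<mu>X T v w n\<bar> \<le> C * V * c * X + (3 * c * \<beta> + 2 * c * B * N)"
    using corr_truncated_corr_le[OF vi w'(1,2) k] by (simp add: w'(3) \<beta>_def B_def N_def)
  then have le: "ennreal \<bar>corr \<mu>X T v w n\<bar> \<le> ennreal (C * V * c * X + max 0 (3 * c * \<beta> + 2 * c * B * N))"
    by (intro ennreal_leI) linarith
  also have "\<dots> = ennreal (C * V * c * X) + ennreal (max 0 (3 * c * \<beta> + 2 * c * B * N))"
    using C V c X by (intro ennreal_plus) auto
  also have "\<dots> \<le> ennreal (C * V * c * X) + ennreal C * Linf_norm \<mu>X v * ennreal c * ennreal t"
  proof (intro add_left_mono)
    consider "c = 0" | "t = 0" | "c > 0" "t > 0" "Linf_norm \<mu>X v = \<infinity>" | "Linf_norm \<mu>X v < \<infinity>"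
      using c(1) t by (cases "Linf_norm \<mu>X v = \<infinity>") (fastforce simp: less_top[symmetric])+
    then show "ennreal (max 0 (3 * c * \<beta> + 2 * c * B * N)) \<le> ennreal C * Linf_norm \<mu>X v * ennreal c * ennreal t"
    proof cases
      case 2
      then have "\<beta> = 0" "B = 0"
        using truncation_error_zero[OF vi k] by (auto simp: t_def \<beta>_def B_def)
      then show ?thesis by simp
    next
      case 3
      have "C > 0" using C mean_height_ge_1 by linarith
      then have "ennreal C * Linf_norm \<mu>X v * ennreal c * ennreal t = \<infinity>"
        using 3 by (simp add: ennreal_mult_eq_top_iff)
      then show ?thesis by simp
    next
      case 4
      have vL: "v \<in> Linf \<mu>X" using 4 borel_measurable_integrable[OF vi] by (simp add: Linf_def)
      define \<nu> where "\<nu> = enn2real (Linf_norm \<mu>X v)"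
      have \<nu>: "AE x in \<mu>X. \<bar>v x\<bar> \<le> \<nu>" "\<nu> \<ge> 0" "Linf_norm \<mu>X v = ennreal \<nu>"
        using Linf_AE_bound[OF vL] by (auto simp: \<nu>_def)
      have \<beta>: "\<beta> \<le> \<nu> * (3 * t)" and N: "N \<le> \<nu> * mean_height"
        using truncation_error_le[OF vi \<nu>(1,2) k] by (auto simp: \<beta>_def N_def t_def)
      have B: "B \<le> 3 * t" using bad_count_integral_le[OF k] by (simp add: B_def t_def)
      have B0: "0 \<le> B" unfolding B_def by (intro integral_nonneg_AE AE_I2) (auto simp: bad_count_def intro!: sum_nonneg)
      have N0: "0 \<le> N" unfolding N_def by (intro integral_nonneg_AE AE_I2) (auto intro!: sum_nonneg)
      have "3 * c * \<beta> + 2 * c * B * N \<le> 3 * c * (\<nu> * (3 * t)) + 2 * c * (3 * t) * (\<nu> * mean_height)"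
        using c(1) \<beta> B N B0 N0 t
        by (intro add_mono[OF mult_left_mono[of \<beta>] mult_mono[of _ _ N]] mult_left_mono) auto
      also have "\<dots> = (9 + 6 * mean_height) * (\<nu> * c * t)" by (simp add: algebra_simps)
      also have "\<dots> \<le> C * (\<nu> * c * t)" using C(3) \<nu>(2) c t by (intro mult_right_mono) auto
      finally have "max 0 (3 * c * \<beta> + 2 * c * B * N) \<le> C * (\<nu> * c * t)"
        using C \<nu>(2) c t by simp
      then have "ennreal (max 0 (3 * c * \<beta> + 2 * c * B * N)) \<le> ennreal (C * (\<nu> * c * t))" by (rule ennreal_leI)
      also have "\<dots> = ennreal C * Linf_norm \<mu>X v * ennreal c * ennreal t"
        using C \<nu>(2,3) c t by (simp add: ennreal_mult mult_ac)
      finally show ?thesis .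
    qed simp
  qed
  also have "ennreal (C * V * c * X) = ennreal C * ennreal V * ennreal c * ennreal X"
    using C V c X by (simp add: ennreal_mult)
  finally show ?thesis by (simp add: c(2) t_def V_def add.commute)
qed

end

context rate_scheme
begin

text \<open>What remains to be shown for a rate function \<open>G\<close>, with a constant independent of the observables.\<close>

definition decay_estimate :: "(nat \<Rightarrow> real) \<Rightarrow> real \<Rightarrow> nat \<Rightarrow> bool" where
  "decay_estimate G C k \<longleftrightarrow> (\<forall>v w c n. v \<in> B_X M T Y \<phi> \<mu> emb \<longrightarrow> w \<in> borel_measurable M \<longrightarrow>
     (\<forall>x. \<bar>w x\<bar> \<le> c) \<longrightarrow> k \<le> n \<longrightarrow>
     \<bar>truncated_corr k v w n\<bar> \<le> C * exch_norm T Y \<phi> \<mu> emb v * c * (G k * exp (- real n * a k)))"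

lemma corr_bound_from_rate:
  assumes C0: "C0 > 0" and G: "\<And>k. k \<ge> 1 \<Longrightarrow> 0 \<le> G k"
    and main: "\<forall>\<^sub>F k in sequentially. decay_estimate G C0 k"
  shows "corr_bound M T Y \<phi> \<mu> emb a G"
proof -
  obtain k0 where k0: "\<And>k. k0 \<le> k \<Longrightarrow> decay_estimate G C0 k"
    using main unfolding eventually_sequentially by blast
  define C where "C = C0 + (9 + 6 * mean_height)"
  have C: "C > 0" "C0 \<le> C" "9 + 6 * mean_height \<le> C" using C0 mean_height_ge_1 by (auto simp: C_def)
  show ?thesis
    unfolding corr_bound_def
  proof (intro exI[of _ C] exI[of _ "max 1 k0"] conjI ballI allI impI)
    fix v w n k
    assume v: "v \<in> B_X M T Y \<phi> \<mu> emb" and w: "w \<in> Linf \<mu>X" and k: "max 1 k0 \<le> k \<and> k \<le> n"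
    show "ennreal \<bar>corr \<mu>X T v w n\<bar>
          \<le> ennreal C * Linf_norm \<mu>X v * Linf_norm \<mu>X w * ennreal (tail_error \<phi> \<mu> n k)
            + ennreal C * ennreal (exch_norm T Y \<phi> \<mu> emb v) * Linf_norm \<mu>X w * ennreal (G k * exp (- real n * a k))"
    proof (rule corr_bound_from_truncated[OF v w])
      show "\<bar>truncated_corr k v w' n\<bar> \<le> C0 * exch_norm T Y \<phi> \<mu> emb v * enn2real (Linf_norm \<mu>X w)
          * (G k * exp (- real n * a k))"
        if "w' \<in> borel_measurable M" "\<And>x. \<bar>w' x\<bar> \<le> enn2real (Linf_norm \<mu>X w)" for w'
        using k that by (intro k0[of k, unfolded decay_estimate_def, rule_format, OF _ v]) auto
      show "0 \<le> G k * exp (- real n * a k)" using G[of k] k by simp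
      show "1 \<le> k" "k \<le> n" using k by auto
      show "0 \<le> C0" using C0 by simp
    qed (rule C)+
  qed (use C in auto)
qed

text \<open>A level functional only sees columns higher than its level, and on these the embedding gives a pointwise bound.
  It is therefore at most a multiple of \<open>\<mu>(\<phi> > l)\<close>, hence of the tail \<open>\<Sum>\<^bsub>j > l\<^esub> \<parallel>R\<^sub>j\<parallel>\<close>, so both
  bounds on \<open>W\<close> take the form required of \<open>V\<close>.\<close>

theorem corr_bound_embedded:
  assumes emb: "embedded_in_Linf \<mu> emb" and q: "0 < q" "q \<le> 1"
  shows "corr_bound M T Y \<phi> \<mu> emb a (\<lambda>k. S_sum Rn q k (a k))"
proof -
  obtain K where K: "K \<ge> 0" "\<And>b. Linf_norm \<mu> (emb b) \<le> ennreal (K * norm b)"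
    using emb unfolding embedded_in_Linf_def by blast
  have embAE: "AE y in \<mu>. \<bar>emb b y\<bar> \<le> K * norm b" for b
  proof -
    have "AE y in \<mu>. ennreal \<bar>emb b y\<bar> \<le> Linf_norm \<mu> (emb b)" unfolding Linf_norm_def by (rule esssup_AE)
    then show ?thesis
      by eventually_elim (metis K ennreal_le_iff mult_nonneg_nonneg norm_ge_zero order.trans)
  qed
  define \<kappa> where "\<kappa> = norm const_one"
  have \<kappa>: "\<kappa> \<ge> 1" using norm_e_ge by (simp add: \<kappa>_def)
  show ?thesis
  proof (rule truncated_corr_decay[OF q])
    fix C assume C: "C > 0" and ev: "\<forall>\<^sub>F k in sequentially. truncated_estimate q C k"
    define C0 where "C0 = C * (\<kappa> * (K * dbound + 1))"
    have C0: "C0 > 0" unfolding C0_def using C K \<kappa> dbound_ge_1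
      by (intro mult_pos_pos add_nonneg_pos) auto
    show ?thesis
    proof (rule corr_bound_from_rate[OF C0])
      show "0 \<le> S_sum Rn q k (a k)" if "k \<ge> 1" for k
        using tail_le_S_sum[OF that] tail_pos by (meson less_imp_le order.trans)
      show "\<forall>\<^sub>F k in sequentially. decay_estimate (\<lambda>k. S_sum Rn q k (a k)) C0 k"
        using ev eventually_weighted_tail_le
      proof eventually_elim
        case (elim k)
        note main = elim(1) and wt = elim(2)
        show ?case
          unfolding decay_estimate_def
        proof (intro allI impI)
          fix v w :: "'a \<Rightarrow> real" and c :: real and n :: nat
          assume v: "v \<in> B_X M T Y \<phi> \<mu> emb" and w: "w \<in> borel_measurable M" "\<forall>x. \<bar>w x\<bar> \<le> c" and n: "k \<le> n"
          have w2: "\<And>x. \<bar>w x\<bar> \<le> c" using w(2) by blast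
          have c: "c \<ge> 0" using w2 by (meson abs_ge_zero order.trans)
          let ?S = "S_sum Rn q k (a k)"
          have lev: "\<bar>pairing (level_obs k w l) x\<bar> \<le> K * c * \<kappa> * norm x * r l" for l x
          proof -
            have "\<bar>pairing (level_obs k w l) x\<bar> \<le> K * norm x * c * measure \<mu> {y \<in> space \<mu>. l < \<phi> y}"
              using K(1) by (intro level_obs_Linf_le[OF w(1) w2 embAE]) auto
            also have "\<dots> \<le> K * norm x * c * (\<kappa> * r l)"
              unfolding \<kappa>_def using K(1) c by (intro mult_left_mono measure_tail_le) auto
            finally show ?thesis by (simp add: mult_ac)
          qed
          have \<omega>0: "(\<Sum>l<k. exp (real l * a k) * \<bar>pairing (level_obs k w l) x\<bar>) \<le> (K * c * \<kappa> * dbound) * norm x" for x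
          proof -
            have "(\<Sum>l<k. exp (real l * a k) * \<bar>pairing (level_obs k w l) x\<bar>)
                \<le> (\<Sum>l<k. exp (real l * a k) * (K * c * \<kappa> * norm x * r l))"
              by (intro sum_mono mult_left_mono lev) auto
            also have "\<dots> = (K * c * \<kappa> * norm x) * (\<Sum>l<k. r l * exp (real l * a k))"
              by (simp add: sum_distrib_left mult_ac)
            also have "\<dots> \<le> (K * c * \<kappa> * norm x) * dbound"
            proof (rule mult_left_mono)
              have "0 \<le> (\<Sum>l<k. r l * exp (real l * a k))" using tail_norm_nonneg by (intro sum_nonneg) auto
              then show "(\<Sum>l<k. r l * exp (real l * a k)) \<le> dbound" using wt by linarith
            qed (use K c \<kappa> in auto)
            finally show ?thesis by (simp add: mult_ac)
          qed
          have \<omega>1: "(\<Sum>l<k. real l powr q * exp (real l * a k) * \<bar>pairing (level_obs k w l) const_one\<bar>) \<le> c * \<kappa> * ?S"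
          proof -
            have "\<bar>pairing (level_obs k w l) const_one\<bar> \<le> c * (\<kappa> * r l)" for l
              using level_obs_const_le[OF w(1) w2, of k l] mult_left_mono[OF measure_tail_le[of l] c] by (simp add: \<kappa>_def)
            then have "(\<Sum>l<k. real l powr q * exp (real l * a k) * \<bar>pairing (level_obs k w l) const_one\<bar>)
                \<le> (\<Sum>l<k. real l powr q * exp (real l * a k) * (c * (\<kappa> * r l)))"
              by (intro sum_mono mult_left_mono) auto
            also have "\<dots> = c * \<kappa> * (\<Sum>l<k. r l * (real l powr q * exp (real l * a k)))"
              by (simp add: sum_distrib_left mult_ac)
            also have "\<dots> \<le> c * \<kappa> * ?S"
              using c \<kappa> by (intro mult_left_mono weighted_tail_le_S_sum[OF q(1)]) auto
            finally show ?thesis .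
          qed
          have "\<bar>truncated_corr k v w n\<bar> \<le> C * exch_norm T Y \<phi> \<mu> emb v
              * ((K * c * \<kappa> * dbound) * ?S + c * \<kappa> * ?S) * exp (- real n * a k)"
            by (rule main[unfolded truncated_estimate_def, rule_format, OF v w(1) w2 n \<omega>0 \<omega>1])
          also have "\<dots> = C0 * exch_norm T Y \<phi> \<mu> emb v * c * (?S * exp (- real n * a k))"
            by (simp add: C0_def algebra_simps)
          finally show "\<bar>truncated_corr k v w n\<bar>
              \<le> C0 * exch_norm T Y \<phi> \<mu> emb v * c * (?S * exp (- real n * a k))" .
        qed
      qed
    qed
  qed
qed

text \<open>Without the embedding the level functionals have no decay in the level. Take \<open>q = 1\<close>: bounding \<open>k\<close> levels
  costs \<open>k exp (k a)\<close>, and \<open>S\<^sub>1(k, a)\<close> costs the same factor again.\<close>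

theorem corr_bound_general:
  "corr_bound M T Y \<phi> \<mu> emb a (\<lambda>k. (real k)\<^sup>2 * exp (2 * real k * a k))"
proof (rule truncated_corr_decay[OF zero_less_one order.refl])
  fix C assume C: "C > 0" and ev: "\<forall>\<^sub>F k in sequentially. truncated_estimate 1 C k"
  have r_sum: "suminf r \<ge> 0" by (rule suminf_nonneg[OF summable_tail_norm tail_norm_nonneg])
  define C0 where "C0 = C * (suminf r + 1)"
  have C0: "C0 > 0" unfolding C0_def using C r_sum by (intro mult_pos_pos) auto
  show ?thesis
  proof (rule corr_bound_from_rate[OF C0])
    show "0 \<le> (real k)\<^sup>2 * exp (2 * real k * a k)" for k by simp
    show "\<forall>\<^sub>F k in sequentially. decay_estimate (\<lambda>k. (real k)\<^sup>2 * exp (2 * real k * a k)) C0 k"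
      using ev eventually_ge_at_top[of 1]
    proof eventually_elim
      case (elim k)
      note main = elim(1) and k = elim(2)
      have ak: "a k > 0" using a_pos k by simp
      define x where "x = exp (real k * a k)"
      have x: "x \<ge> 1" using ak by (simp add: x_def)
      have xx: "exp (2 * real k * a k) = x * x" by (simp add: x_def flip: exp_add)
      have el: "exp (real l * a k) \<le> x" if "l \<le> k" for l
        using that ak by (simp add: x_def mult_right_mono)
      have S1: "S_sum Rn 1 k (a k) \<le> real k * x * suminf r"
      proof -
        have "S_sum Rn 1 k (a k) \<le> (\<Sum>j=1..k. real k * x * r j)"
          unfolding S_sum_eq
        proof (rule sum_mono)
          fix j assume j: "j \<in> {1..k}"
          have "(real j * exp (real j * a k)) * r j \<le> (real k * x) * r j"
            using j el[of j] tail_norm_nonneg[of j] by (intro mult_right_mono mult_mono) auto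
          then show "r j * real j powr 1 * exp (real j * a k) \<le> real k * x * r j" by (simp add: mult_ac)
        qed
        also have "\<dots> = real k * x * (\<Sum>j=1..k. r j)" by (simp add: sum_distrib_left)
        also have "\<dots> \<le> real k * x * suminf r"
          using x summable_tail_norm tail_norm_nonneg by (intro mult_left_mono sum_le_suminf) auto
        finally show ?thesis .
      qed
      show ?case
        unfolding decay_estimate_def
      proof (intro allI impI)
        fix v w :: "'a \<Rightarrow> real" and c :: real and n :: nat
        assume v: "v \<in> B_X M T Y \<phi> \<mu> emb" and w: "w \<in> borel_measurable M" "\<forall>x. \<bar>w x\<bar> \<le> c" and n: "k \<le> n"
        have w2: "\<And>x. \<bar>w x\<bar> \<le> c" using w(2) by blast
        have c: "c \<ge> 0" using w2 by (meson abs_ge_zero order.trans)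
        define V where "V = exch_norm T Y \<phi> \<mu> emb v"
        have V: "V \<ge> 0"
        proof -
          obtain b where "\<And>j. norm (b j :: 'b) \<le> V"
            unfolding V_def by (rule derived_obs_in_space[OF v, of k]) blast
          then show ?thesis using norm_ge_zero order.trans by blast
        qed
        have \<omega>0: "(\<Sum>l<k. exp (real l * a k) * \<bar>pairing (level_obs k w l) b\<bar>) \<le> (c * (real k * x)) * norm b" for b
        proof -
          have "(\<Sum>l<k. exp (real l * a k) * \<bar>pairing (level_obs k w l) b\<bar>) \<le> (\<Sum>l<k. x * (c * norm b))"
            using x by (intro sum_mono mult_mono el pairing_le[OF level_obs_bounded[OF w(1) w2]]) auto
          then show ?thesis by (simp add: mult_ac)
        qed
        have \<omega>1: "(\<Sum>l<k. real l powr 1 * exp (real l * a k) * \<bar>pairing (level_obs k w l) const_one\<bar>)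
            \<le> c * ((real k)\<^sup>2 * (x * x))"
        proof -
          have "(\<Sum>l<k. real l powr 1 * exp (real l * a k) * \<bar>pairing (level_obs k w l) const_one\<bar>)
              \<le> (\<Sum>l<k. real k * x * c)"
          proof (rule sum_mono)
            fix l assume l: "l \<in> {..<k}"
            have "\<bar>pairing (level_obs k w l) const_one\<bar> \<le> c * measure \<mu> {y \<in> space \<mu>. l < \<phi> y}"
              by (rule level_obs_const_le[OF w(1) w2])
            also have "\<dots> \<le> c * 1" using c prob_le_1 by (intro mult_left_mono) auto
            finally have "\<bar>pairing (level_obs k w l) const_one\<bar> \<le> c" by simp
            then show "real l powr 1 * exp (real l * a k) * \<bar>pairing (level_obs k w l) const_one\<bar> \<le> real k * x * c"
              using l el[of l] x by (intro mult_mono) auto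
          qed
          also have "\<dots> = c * ((real k)\<^sup>2 * x)" by (simp add: power2_eq_square mult_ac)
          also have "\<dots> \<le> c * ((real k)\<^sup>2 * (x * x))"
            using c x by (intro mult_left_mono) auto
          finally show ?thesis .
        qed
        have "\<bar>truncated_corr k v w n\<bar> \<le> C * V
            * ((c * (real k * x)) * S_sum Rn 1 k (a k) + c * ((real k)\<^sup>2 * (x * x))) * exp (- real n * a k)"
          unfolding V_def by (rule main[unfolded truncated_estimate_def, rule_format, OF v w(1) w2 n \<omega>0 \<omega>1])
        also have "\<dots> \<le> C * V
            * ((c * (real k * x)) * (real k * x * suminf r) + c * ((real k)\<^sup>2 * (x * x))) * exp (- real n * a k)"
          using S1 C V c x by (intro mult_right_mono mult_left_mono add_right_mono) auto
        also have "\<dots> = C0 * V * c * ((real k)\<^sup>2 * (x * x) * exp (- real n * a k))"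
          by (simp add: C0_def power2_eq_square algebra_simps)
        finally show "\<bar>truncated_corr k v w n\<bar> \<le> C0 * exch_norm T Y \<phi> \<mu> emb v * c
           * ((real k)\<^sup>2 * exp (2 * real k * a k) * exp (- real n * a k))"
          by (simp add: xx V_def)
      qed
    qed
  qed
qed

end

theorem theorem4p2:
  fixes M :: "'a measure" and T :: "'a \<Rightarrow> 'a" and Y :: "'a set"
    and \<phi> :: "'a \<Rightarrow> nat" and \<mu> :: "'a measure" and emb :: "'b::banach \<Rightarrow> 'a \<Rightarrow> real"
    and R :: "('a \<Rightarrow> real) \<Rightarrow> 'a \<Rightarrow> real" and Rn :: "nat \<Rightarrow> 'b \<Rightarrow>\<^sub>L 'b"
    and a :: "nat \<Rightarrow> real" and r :: real
  assumes good: "good_inducing_scheme M T Y \<phi> \<mu> emb R Rn"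
    and nontrivial: "measure \<mu> {y \<in> Y. 1 < \<phi> y} > 0"
    and a_pos: "\<And>k. 1 \<le> k \<Longrightarrow> 0 < a k"
    and r: "0 < r" "r \<le> 1"
    and a_lim: "(\<lambda>k. a k powr r * S_sum Rn r k (a k)) \<longlonglongrightarrow> 0"
  shows "(embedded_in_Linf \<mu> emb \<longrightarrow>
            (\<forall>q. 0 < q \<and> q \<le> 1 \<longrightarrow> corr_bound M T Y \<phi> \<mu> emb a (\<lambda>k. S_sum Rn q k (a k))))
       \<and> corr_bound M T Y \<phi> \<mu> emb a (\<lambda>k. (real k)\<^sup>2 * exp (2 * real k * a k))"
proof -
  interpret rate_scheme M T Y \<phi> \<mu> emb R Rn a r
    by (rule rate_scheme.intro[OF good rate_scheme_axioms.intro]) (use assms in auto)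
  show ?thesis using corr_bound_embedded corr_bound_general by blast
qed

end
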